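(* Let $Z_1,\dots,Z_n$ be i.i.d. with distribution $Q$ on a measurable space $\mathcal Z$, $Z\sim Q$, let $\psi:\mathcal Z\to\mathbb R^r$ be measurable with $\int\|\psi\|^2dQ<\infty$ and $\theta=\int\psi\,dQ$. Let $u_1,u_2,\dots$ be a sequence of measurable real functions on $\mathcal Z$ and let $m_n\to\infty$. Put $u_n=(u_1,\dots,u_{m_n})^\top$ and suppose that for each $n$, $\int\|u_n\|^2dQ<\infty$, $\int u_n\,dQ=0$, and $W_n=\int u_nu_n^\top dQ$ is nonsingular, and that the sequence $(W_n)$ is regular. Let $\bar W_n=\frac1n\sum_{j=1}^nu_n(Z_j)u_n(Z_j)^\top$. Assume (i) $\max_{1\le j\le n}\|u_n(Z_j)\|=o_p(m_n^{-3/2}n^{1/2})$; (ii) $|\bar W_n-W_n|_o=o_p(m_n^{-1})$; (iii) $\frac1n\sum_{j=1}^n\big(\psi(Z_j)u_n(Z_j)^\top-E[\psi(Z_j)u_n(Z_j)^\top]\big)=o_p(m_n^{-1/2})$. Then, with probability tending to one, there is a unique $\tilde\zeta_n\in\mathbb R^{m_n}$ with $1+u_n(Z_j)^\top\tilde\zeta_n>0$ for all $j$ and $\frac1n\sum_{j=1}^nu_n(Z_j)/(1+u_n(Z_j)^\top\tilde\zeta_n)=0$, and the estimator $$\tilde\theta_n=\frac1n\sum_{j=1}^n\frac{\psi(Z_j)}{1+u_n(Z_j)^\top\tilde\zeta_n}$$ satisfies, as $n\to\infty$, $\tilde\theta_n=\bar\psi-\bar\varphi_0+o_p(n^{-1/2})$,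 where $\varphi_0=\Pi(\psi\mid[u_\infty])$ and $\bar\varphi_0=\frac1n\sum_j\varphi_0(Z_j)$, $\bar\psi=\frac1n\sum_j\psi(Z_j)$. Consequently, if $\Sigma_0=\mathrm{Var}(\psi(Z))-\mathrm{Var}(\varphi_0(Z))$ is nonsingular, then $\sqrt n(\tilde\theta_n-\theta)\Rightarrow N(0,\Sigma_0)$.
   Context: A sequence of $m_n\times m_n$ dispersion matrices $W_n$ is called regular if $0<\inf_n\inf_{\|a\|=1}a^\top W_na\le\sup_n\sup_{\|a\|=1}a^\top W_na<\infty$. $|A|_o$ denotes the spectral (operator) norm. $[u_\infty]$ denotes the closed linear span in $L_2(Q)$ of $u_1,u_2,\dots$, and $\Pi(\psi\mid[u_\infty])$ is the componentwise orthogonal projection in $L_2(Q)$ of $\psi$ onto it. *)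

theory Defs
  imports "HOL-Probability.Probability"
begin

text \<open>Stochastic order: X n = o_p(a n), in the outer-probability sense: for every eps > 0
  the events {|X n| > eps * a n} are covered by measurable sets whose probability tends to 0.
  (For measurable X n this is the usual definition.)\<close>
definition oP :: "'a measure \<Rightarrow> (nat \<Rightarrow> 'a \<Rightarrow> 'b::real_normed_vector) \<Rightarrow> (nat \<Rightarrow> real) \<Rightarrow> bool" where
  "oP M X a \<longleftrightarrow> (\<forall>\<epsilon>>0. \<exists>B. (\<forall>n. B n \<in> sets M \<and>
       {\<omega> \<in> space M. \<epsilon> * a n < norm (X n \<omega>)} \<subseteq> B n) \<and>
       (\<lambda>n. measure M (B n)) \<longlonglongrightarrow> 0)"

text \<open>Vectors in R^m are represented as nat => real, only indices < m being relevant.\<close>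
definition dotm :: "nat \<Rightarrow> (nat \<Rightarrow> 'z \<Rightarrow> real) \<Rightarrow> 'z \<Rightarrow> (nat \<Rightarrow> real) \<Rightarrow> real" where
  "dotm m u z \<zeta> = (\<Sum>k<m. u k z * \<zeta> k)"

definition vnorm :: "nat \<Rightarrow> (nat \<Rightarrow> 'z \<Rightarrow> real) \<Rightarrow> 'z \<Rightarrow> real" where
  "vnorm m u z = sqrt (\<Sum>k<m. (u k z)\<^sup>2)"

definition mat_opnorm :: "nat \<Rightarrow> (nat \<Rightarrow> nat \<Rightarrow> real) \<Rightarrow> real" where
  "mat_opnorm m A = Sup {sqrt (\<Sum>i<m. (\<Sum>k<m. A i k * a k)\<^sup>2) | a. (\<Sum>k<m. (a k)\<^sup>2) = 1}"

definition regular_disp :: "(nat \<Rightarrow> nat) \<Rightarrow> (nat \<Rightarrow> nat \<Rightarrow> nat \<Rightarrow> real) \<Rightarrow> bool" where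
  "regular_disp m W \<longleftrightarrow> (\<exists>c C. 0 < c \<and> (\<forall>n a. (\<Sum>k<m n. (a k)\<^sup>2) = 1 \<longrightarrow>
       c \<le> (\<Sum>i<m n. \<Sum>k<m n. a i * W n i k * a k) \<and>
       (\<Sum>i<m n. \<Sum>k<m n. a i * W n i k * a k) \<le> C))"

definition nonsingular_m :: "nat \<Rightarrow> (nat \<Rightarrow> nat \<Rightarrow> real) \<Rightarrow> bool" where
  "nonsingular_m m A \<longleftrightarrow> (\<forall>a. (\<forall>i<m. (\<Sum>k<m. A i k * a k) = 0) \<longrightarrow> (\<forall>k<m. a k = 0))"

definition in_L2_span :: "'z measure \<Rightarrow> (nat \<Rightarrow> 'z \<Rightarrow> real) \<Rightarrow> ('z \<Rightarrow> real) \<Rightarrow> bool" where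
  "in_L2_span Q u f \<longleftrightarrow> f \<in> borel_measurable Q \<and> integrable Q (\<lambda>z. (f z)\<^sup>2) \<and>
     (\<forall>\<epsilon>>0. \<exists>K c. integrable Q (\<lambda>z. (f z - (\<Sum>k<K. c k * u k z))\<^sup>2) \<and>
        (\<integral>z. (f z - (\<Sum>k<K. c k * u k z))\<^sup>2 \<partial>Q) < \<epsilon>)"

definition L2_proj :: "'z measure \<Rightarrow> (nat \<Rightarrow> 'z \<Rightarrow> real) \<Rightarrow> ('z \<Rightarrow> real^'r) \<Rightarrow> ('z \<Rightarrow> real^'r) \<Rightarrow> bool" where
  "L2_proj Q u \<psi> \<phi> \<longleftrightarrow> (\<forall>i. in_L2_span Q u (\<lambda>z. \<phi> z $ i) \<and>
      (\<forall>k. (\<integral>z. (\<psi> z $ i - \<phi> z $ i) * u k z \<partial>Q) = 0))"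

definition cov_mat :: "'z measure \<Rightarrow> ('z \<Rightarrow> real^'r) \<Rightarrow> real^'r^'r" where
  "cov_mat Q f = (\<chi> i l. (\<integral>z. f z $ i * f z $ l \<partial>Q) - (\<integral>z. f z $ i \<partial>Q) * (\<integral>z. f z $ l \<partial>Q))"

definition zeta_eq :: "nat \<Rightarrow> nat \<Rightarrow> (nat \<Rightarrow> 'z \<Rightarrow> real) \<Rightarrow> (nat \<Rightarrow> 'a \<Rightarrow> 'z) \<Rightarrow> 'a \<Rightarrow> (nat \<Rightarrow> real) \<Rightarrow> bool" where
  "zeta_eq n m u Z \<omega> \<zeta> \<longleftrightarrow> (\<forall>k\<ge>m. \<zeta> k = 0) \<and>
     (\<forall>j<n. 0 < 1 + dotm m u (Z j \<omega>) \<zeta>) \<and>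
     (\<forall>k<m. (1 / real n) * (\<Sum>j<n. u k (Z j \<omega>) / (1 + dotm m u (Z j \<omega>) \<zeta>)) = 0)"

definition theta_tilde :: "nat \<Rightarrow> nat \<Rightarrow> (nat \<Rightarrow> 'z \<Rightarrow> real) \<Rightarrow> ('z \<Rightarrow> real^'r) \<Rightarrow> (nat \<Rightarrow> 'a \<Rightarrow> 'z) \<Rightarrow> 'a \<Rightarrow> real^'r" where
  "theta_tilde n m u \<psi> Z \<omega> =
     (if \<exists>!\<zeta>. zeta_eq n m u Z \<omega> \<zeta> then
        (let \<zeta> = (THE \<zeta>. zeta_eq n m u Z \<omega> \<zeta>) in
          (1 / real n) *\<^sub>R (\<Sum>j<n. (1 / (1 + dotm m u (Z j \<omega>) \<zeta>)) *\<^sub>R \<psi> (Z j \<omega>)))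
      else 0)"

definition mvnormal :: "real^'r^'r \<Rightarrow> (real^'r) measure \<Rightarrow> bool" where
  "mvnormal \<Sigma> N \<longleftrightarrow> prob_space N \<and> sets N = sets borel \<and>
     (\<forall>a. distr N borel (\<lambda>x. a \<bullet> x) =
        (if a \<bullet> (\<Sigma> *v a) = 0 then return borel 0
         else density lborel (normal_density 0 (sqrt (a \<bullet> (\<Sigma> *v a))))))"

definition conv_distr :: "'a measure \<Rightarrow> (nat \<Rightarrow> 'a \<Rightarrow> real^'r) \<Rightarrow> (real^'r) measure \<Rightarrow> bool" where
  "conv_distr M X N \<longleftrightarrow> (\<forall>f::real^'r \<Rightarrow> real. continuous_on UNIV f \<and> bounded (range f) \<longrightarrow>
     (\<lambda>n. \<integral>\<omega>. f (X n \<omega>) \<partial>M) \<longlonglongrightarrow> (\<integral>x. f x \<partial>N))"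

end

theory Submission
  imports Defs
begin

text \<open>On an event of probability tending to one the empirical Gram matrix is close to \<open>W\<^sub>n\<close> and
  \<open>|u\<^sub>n(Z\<^sub>j)|\<close> is small, so the strictly concave function \<open>\<Sum> ln (1 + u\<^sub>n(Z\<^sub>j) \<bullet> \<zeta>)\<close> has its maximum
  within distance \<open>O(sqrt (m/n))\<close> of the origin; this is the unique solution \<open>\<zeta>\<close>. The resulting weights
  annihilate \<open>u\<^sub>n\<close>, so \<open>\<psi>\<close> can be replaced by its population regression residual \<open>\<psi> - b\<^sub>n \<bullet> u\<^sub>n\<close>. Expanding
  \<open>1/(1 + x) = 1 - x + x\<^sup>2/(1 + x)\<close>, the linear term is small because the residual is nearly
  uncorrelated with \<open>u\<^sub>n\<close>, and the quadratic term is small by condition (i) and the Cauchy--Schwarz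
  inequality. Finally \<open>b\<^sub>n \<bullet> u\<^sub>n\<close> converges to \<open>\<phi>\<^sub>0\<close> in \<open>L\<^sub>2\<close>, so the means of the two differ by
  \<open>o\<^sub>p(n\<^bsup>-1/2\<^esup>)\<close>. The limit law follows from the one-dimensional central limit theorem applied to all
  projections of \<open>\<psi> - \<phi>\<^sub>0\<close>, since \<open>\<psi> - \<phi>\<^sub>0\<close> and \<open>\<phi>\<^sub>0\<close> are orthogonal.\<close>


section \<open>Weak convergence from trigonometric moments\<close>

text \<open>The exponents in (i)-(iii) make the powers of \<open>m\<close> cancel. The mean of
  \<open>u\<close> has expected squared norm at most \<open>C * m / n\<close>, so the solution is
  sought at radius \<open>K * sqrt (m / n)\<close>. At this radius (i) bounds every |u(Z j) . x| by
  a small multiple of \<open>1 / m\<close>, while (ii) and (iii) bound the empirical moments of the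
  residual against \<open>u\<close> by a small multiple of \<open>1 / sqrt m\<close>; both error
  terms become a small constant times \<open>1 / sqrt n\<close>, whatever \<open>m\<close> is. The
  lower regularity constant supplies curvature and bounds the regression coefficients uniformly in
  \<open>n\<close>; the upper one bounds second moments. Two obstacles shape the rest. The
  conditions are outer-probability statements, so each estimate is deterministic outside a
  measurable exceptional set, with constants fixed in the order \<open>T\<close>, \<open>K\<close>,
  \<open>\<delta>\<close>. The weak limit is stated with Bochner integrals of an estimator defined
  by unique existence, so its measurability needs a proof. Weak convergence on the vector space is
  reduced to limits of sines and cosines of projections, plus tightness, which is what
  one-dimensional limit theorems deliver.\<close>

inductive trig_poly :: "('b::euclidean_space \<Rightarrow> real) \<Rightarrow> bool" where
  cos: "trig_poly (\<lambda>x. cos (t \<bullet> x))"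
| sin: "trig_poly (\<lambda>x. sin (t \<bullet> x))"
| add: "trig_poly f \<Longrightarrow> trig_poly g \<Longrightarrow> trig_poly (\<lambda>x. f x + g x)"
| scale: "trig_poly f \<Longrightarrow> trig_poly (\<lambda>x. c * f x)"

lemma trig_poly_const: "trig_poly (\<lambda>x. c)"
  using trig_poly.scale[OF trig_poly.cos[of 0], of c] by simp

lemma trig_poly_sum:
  "finite A \<Longrightarrow> (\<And>i. i \<in> A \<Longrightarrow> trig_poly (f i)) \<Longrightarrow> trig_poly (\<lambda>x. \<Sum>i\<in>A. f i x)"
  by (induction A rule: finite_induct) (auto intro: trig_poly_const trig_poly.add)

lemma trig_poly_cos_mult: "trig_poly g \<Longrightarrow> trig_poly (\<lambda>x. cos (t \<bullet> x) * g x)"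
proof (induction rule: trig_poly.induct)
  case (cos s)
  have "(\<lambda>x. cos (t \<bullet> x) * cos (s \<bullet> x)) = (\<lambda>x. (1/2) * cos ((t - s) \<bullet> x) + (1/2) * cos ((t + s) \<bullet> x))"
    by (simp add: fun_eq_iff inner_add_left inner_diff_left cos_add cos_diff sin_add sin_diff field_simps)
  then show ?case by (simp only: trig_poly.intros)
next
  case (sin s)
  have "(\<lambda>x. cos (t \<bullet> x) * sin (s \<bullet> x)) = (\<lambda>x. (1/2) * sin ((t + s) \<bullet> x) + (-1/2) * sin ((t - s) \<bullet> x))"
    by (simp add: fun_eq_iff inner_add_left inner_diff_left cos_add cos_diff sin_add sin_diff field_simps)
  then show ?case by (simp only: trig_poly.intros)
qed (simp_all only: trig_poly.intros distrib_left mult.left_commute)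

lemma trig_poly_sin_mult: "trig_poly g \<Longrightarrow> trig_poly (\<lambda>x. sin (t \<bullet> x) * g x)"
proof (induction rule: trig_poly.induct)
  case (cos s)
  have "(\<lambda>x. sin (t \<bullet> x) * cos (s \<bullet> x)) = (\<lambda>x. (1/2) * sin ((t + s) \<bullet> x) + (1/2) * sin ((t - s) \<bullet> x))"
    by (simp add: fun_eq_iff inner_add_left inner_diff_left cos_add cos_diff sin_add sin_diff field_simps)
  then show ?case by (simp only: trig_poly.intros)
next
  case (sin s)
  have "(\<lambda>x. sin (t \<bullet> x) * sin (s \<bullet> x)) = (\<lambda>x. (1/2) * cos ((t - s) \<bullet> x) + (-1/2) * cos ((t + s) \<bullet> x))"
    by (simp add: fun_eq_iff inner_add_left inner_diff_left cos_add cos_diff sin_add sin_diff field_simps)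
  then show ?case by (simp only: trig_poly.intros)
qed (simp_all only: trig_poly.intros distrib_left mult.left_commute)

text \<open>Product-to-sum formulas keep the class closed under multiplication, so trigonometric
  polynomials can be substituted into ordinary ones.\<close>

lemma trig_poly_mult: "trig_poly f \<Longrightarrow> trig_poly g \<Longrightarrow> trig_poly (\<lambda>x. f x * g x)"
proof (induction rule: trig_poly.induct)
  case (cos t) then show ?case by (rule trig_poly_cos_mult)
next
  case (sin t) then show ?case by (rule trig_poly_sin_mult)
qed (simp_all only: trig_poly.intros distrib_right mult.assoc)

text \<open>Each coordinate \<open>sin ((x \<bullet> b) / l)\<close> is a trigonometric polynomial,
  and the class is an algebra; the linear generators of \<open>real_polynomial_function\<close>
  become finite sums of sines.\<close>

lemma trig_poly_compose_sin:
  assumes "real_polynomial_function p"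
  shows "trig_poly (\<lambda>x::'b::euclidean_space. p (\<Sum>b\<in>Basis. sin ((x \<bullet> b) / l) *\<^sub>R b))"
  using assms
proof (induction rule: real_polynomial_function.induct)
  case (linear f)
  interpret bounded_linear f by fact
  have "trig_poly (\<lambda>x. \<Sum>b\<in>Basis. f b * sin ((b /\<^sub>R l) \<bullet> x))"
    by (intro trig_poly_sum trig_poly.scale trig_poly.sin) simp
  moreover have "f (\<Sum>b\<in>Basis. sin ((x \<bullet> b) / l) *\<^sub>R b) = (\<Sum>b\<in>Basis. f b * sin ((b /\<^sub>R l) \<bullet> x))" for x
    by (simp add: sum scaleR inner_commute divide_inverse_commute mult.commute)
  ultimately show ?case by simp
qed (simp_all add: trig_poly_const trig_poly.add trig_poly_mult)

lemma trig_poly_continuous: "trig_poly f \<Longrightarrow> continuous_on UNIV f"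
  by (induction rule: trig_poly.induct) (auto intro!: continuous_intros)

lemma trig_poly_bounded: "trig_poly f \<Longrightarrow> \<exists>B. \<forall>x. \<bar>f x\<bar> \<le> B"
proof (induction rule: trig_poly.induct)
  case (add f g)
  then obtain B C where "\<forall>x. \<bar>f x\<bar> \<le> B" "\<forall>x. \<bar>g x\<bar> \<le> C" by auto
  then have "\<forall>x. \<bar>f x + g x\<bar> \<le> B + C" by (meson abs_triangle_ineq add_mono order_trans)
  then show ?case by blast
next
  case (scale f c)
  then obtain B where "\<forall>x. \<bar>f x\<bar> \<le> B" by auto
  then have "\<forall>x. \<bar>c * f x\<bar> \<le> \<bar>c\<bar> * B" by (simp add: abs_mult mult_left_mono)
  then show ?case by blast
qed (meson abs_cos_le_one abs_sin_le_one)+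

text \<open>Reading a function through arcsin turns its uniform approximation by polynomials on a cube
  into one by trigonometric polynomials that keep the same bound on the whole space.\<close>
lemma trig_poly_approx:
  fixes f :: "'b::euclidean_space \<Rightarrow> real"
  assumes f: "continuous_on UNIV f" "\<And>x. \<bar>f x\<bar> \<le> F" and "R > 0" "e > 0"
  obtains h where "trig_poly h" "\<And>x. norm x \<le> R \<Longrightarrow> \<bar>f x - h x\<bar> \<le> e" "\<And>x. \<bar>h x\<bar> \<le> F + e"
proof -
  \<comment> \<open>With this scale, \<open>norm x \<le> R\<close> puts every
    \<open>(x \<bullet> b) / l\<close> into [-pi/2, pi/2], where arcsin inverts sin.\<close>
  define l where "l = 2 * R / pi"
  have l: "l > 0" using \<open>R > 0\<close> by (simp add: l_def)
  let ?s = "\<lambda>x. \<Sum>b\<in>Basis. sin ((x \<bullet> b) / l) *\<^sub>R b :: 'b"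
  let ?g = "\<lambda>y. f (\<Sum>b\<in>Basis. (l * arcsin (y \<bullet> b)) *\<^sub>R b)"
  have box: "y \<in> cbox (- One) One \<longleftrightarrow> (\<forall>b\<in>Basis. - 1 \<le> y \<bullet> b \<and> y \<bullet> b \<le> 1)" for y :: 'b
    by (simp add: mem_box)
  have "continuous_on (cbox (- One) One) (\<lambda>y::'b. arcsin (y \<bullet> b))" if "b \<in> Basis" for b
    by (intro continuous_on_arcsin continuous_intros) (use that in \<open>simp add: box\<close>)
  then have "continuous_on (cbox (- One) One) (\<lambda>y::'b. \<Sum>b\<in>Basis. (l * arcsin (y \<bullet> b)) *\<^sub>R b)"
    by (intro continuous_on_sum continuous_on_scaleR continuous_on_mult continuous_on_const)
  then have "continuous_on (cbox (- One) One) ?g"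
    by (rule continuous_on_compose2[OF f(1)]) simp
  then obtain p where p: "real_polynomial_function p" "\<And>y. y \<in> cbox (- One) One \<Longrightarrow> \<bar>?g y - p y\<bar> < e"
    using Stone_Weierstrass_real_polynomial_function[OF compact_cbox _ \<open>e > 0\<close>] by blast
  have s: "?s x \<in> cbox (- One) One" for x
    by (simp add: box)
  show thesis
  proof
    show "trig_poly (\<lambda>x. p (?s x))" by (rule trig_poly_compose_sin[OF p(1)])
    show "\<bar>f x - p (?s x)\<bar> \<le> e" if x: "norm x \<le> R" for x
    proof -
      have "arcsin (?s x \<bullet> b) = (x \<bullet> b) / l" if "b \<in> Basis" for b
      proof -
        have "\<bar>x \<bullet> b\<bar> \<le> R" using Basis_le_norm[OF that, of x] x by simp
        then have "\<bar>(x \<bullet> b) / R\<bar> \<le> 1" using \<open>R > 0\<close> by simp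
        then have "pi / 2 * \<bar>(x \<bullet> b) / R\<bar> \<le> pi / 2 * 1" by (intro mult_left_mono) auto
        moreover have "pi / 2 * ((x \<bullet> b) / R) = (x \<bullet> b) / l" by (simp add: l_def)
        ultimately have "\<bar>(x \<bullet> b) / l\<bar> \<le> pi / 2" by (metis abs_mult abs_of_pos mult.right_neutral pi_half_gt_zero)
        then have "- (pi / 2) \<le> (x \<bullet> b) / l" "(x \<bullet> b) / l \<le> pi / 2" by linarith+
        then have "arcsin (sin ((x \<bullet> b) / l)) = (x \<bullet> b) / l" by (rule arcsin_sin)
        then show ?thesis using that by simp
      qed
      then have "?g (?s x) = f x" using l by (simp add: euclidean_representation)
      then show ?thesis using p(2)[OF s, of x] by simp
    qed
    \<comment> \<open>The sine image lies in the cube for every \<open>x\<close>, so even far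
      outside the ball \<open>p\<close> is within \<open>e\<close> of some value of
      \<open>f\<close>.\<close>
    show "\<bar>p (?s x)\<bar> \<le> F + e" for x
      using p(2)[OF s, of x] f(2)[of "\<Sum>b\<in>Basis. (l * arcsin (?s x \<bullet> b)) *\<^sub>R b"] by linarith
  qed
qed

text \<open>The difference is dominated pointwise by \<open>e\<close> plus \<open>F + G\<close>
  times the indicator of \<open>B\<close>. This is the common device for exchanging bounded
  integrands that are close off a small event.\<close>

lemma (in prob_space) expectation_diff_le_on_set:
  fixes f g :: "'a \<Rightarrow> real"
  assumes [measurable]: "f \<in> borel_measurable M" "g \<in> borel_measurable M" "B \<in> sets M"
    and F: "\<And>\<omega>. \<bar>f \<omega>\<bar> \<le> F" and G: "\<And>\<omega>. \<bar>g \<omega>\<bar> \<le> G" and "0 \<le> e"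
    and e: "\<And>\<omega>. \<omega> \<in> space M \<Longrightarrow> \<omega> \<notin> B \<Longrightarrow> \<bar>f \<omega> - g \<omega>\<bar> \<le> e"
  shows "\<bar>expectation f - expectation g\<bar> \<le> e + (F + G) * prob B"
proof -
  have i: "integrable M f" "integrable M g"
    by (rule integrable_const_bound[where B=F], use F in simp, simp)
      (rule integrable_const_bound[where B=G], use G in simp, simp)
  have "0 \<le> F" "0 \<le> G" using F G by (meson abs_ge_zero order_trans)+
  have "\<bar>expectation f - expectation g\<bar> = \<bar>expectation (\<lambda>\<omega>. f \<omega> - g \<omega>)\<bar>"
    using i by simp
  also have "\<dots> \<le> expectation (\<lambda>\<omega>. \<bar>f \<omega> - g \<omega>\<bar>)"
    by (rule integral_abs_bound)
  also have "\<dots> \<le> expectation (\<lambda>\<omega>. e + (F + G) * indicator B \<omega>)"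
  proof (rule integral_mono)
    show "\<bar>f \<omega> - g \<omega>\<bar> \<le> e + (F + G) * indicator B \<omega>" if "\<omega> \<in> space M" for \<omega>
      using e[OF that] F[of \<omega>] G[of \<omega>] \<open>0 \<le> e\<close> by (auto simp: indicator_def)
  qed (intro integrable_abs Bochner_Integration.integrable_diff i Bochner_Integration.integrable_add
      integrable_mult_right integrable_real_indicator, auto simp: emeasure_eq_measure)
  also have "\<dots> = e + (F + G) * prob B" by (subst Bochner_Integration.integral_add) (simp_all add: prob_space emeasure_eq_measure)
  finally show ?thesis .
qed

text \<open>Tightness confines both \<open>X n\<close> and the limit law to a large ball up to
  little mass. There a trigonometric polynomial replaces \<open>f\<close>, and its global bound
  controls the remaining mass; its integrals converge by linearity from the hypotheses
  \<open>cos\<close> and \<open>sin\<close>.\<close>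

theorem weak_limit_if_trig_limits:
  fixes X :: "nat \<Rightarrow> 'a \<Rightarrow> 'b::euclidean_space"
  assumes M: "prob_space M" and N: "prob_space N" "sets N = sets borel"
    and X [measurable]: "\<And>n. X n \<in> borel_measurable M"
    and tight: "\<And>\<eta>. \<eta> > 0 \<Longrightarrow> \<exists>R. \<forall>\<^sub>F n in sequentially. measure M {\<omega>\<in>space M. R < norm (X n \<omega>)} \<le> \<eta>"
    and cos: "\<And>t. (\<lambda>n. \<integral>\<omega>. cos (t \<bullet> X n \<omega>) \<partial>M) \<longlonglongrightarrow> (\<integral>x. cos (t \<bullet> x) \<partial>N)"
    and sin: "\<And>t. (\<lambda>n. \<integral>\<omega>. sin (t \<bullet> X n \<omega>) \<partial>M) \<longlonglongrightarrow> (\<integral>x. sin (t \<bullet> x) \<partial>N)"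
    and f: "continuous_on UNIV f" "bounded (range f)"
  shows "(\<lambda>n. \<integral>\<omega>. f (X n \<omega>) \<partial>M) \<longlonglongrightarrow> ((\<integral>x. f x \<partial>N) :: real)"
proof (rule LIMSEQ_I)
  interpret M: prob_space M by fact
  interpret N: prob_space N by fact
  have bm: "h \<in> borel_measurable borel" "h \<in> borel_measurable N" if "continuous_on UNIV h" for h :: "'b \<Rightarrow> real"
    using that borel_measurable_continuous_onI measurable_cong_sets[OF N(2) refl] by blast+
  have trig_int: "integrable N h" "integrable M (\<lambda>\<omega>. h (X n \<omega>))" if h: "trig_poly h" for h n
  proof -
    obtain B where B: "\<forall>x. \<bar>h x\<bar> \<le> B" using trig_poly_bounded[OF h] by blast
    note [measurable] = bm[OF trig_poly_continuous[OF h]]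
    show "integrable N h" by (rule N.integrable_const_bound[where B=B]) (use B in auto)
    show "integrable M (\<lambda>\<omega>. h (X n \<omega>))" by (rule M.integrable_const_bound[where B=B]) (use B in auto)
  qed
  have trig_lim: "(\<lambda>n. \<integral>\<omega>. h (X n \<omega>) \<partial>M) \<longlonglongrightarrow> (\<integral>x. h x \<partial>N)" if "trig_poly h" for h
    using that
  proof (induction rule: trig_poly.induct)
    case (add f g)
    then show ?case using tendsto_add[OF add.IH] by (simp add: trig_int)
  next
    case (scale f c)
    then show ?case using tendsto_mult_left[OF scale.IH] by (simp add: trig_int)
  qed (rule cos sin)+
  obtain F where F: "\<And>x. \<bar>f x\<bar> \<le> F"
    using f(2) unfolding bounded_iff by auto
  then have "0 \<le> F" by (meson abs_ge_zero order_trans)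
  note [measurable] = bm[OF f(1)]
  fix r :: real assume "r > 0"
  \<comment> \<open>\<open>e \<le> 1\<close> bounds the approximant by \<open>F + 1\<close> before
    it is chosen, so \<open>\<eta>\<close> can be fixed first; then
    \<open>e + (2 * F + 1) * \<eta> \<le> r / 3\<close>.\<close>
  define e where "e = min 1 (r / 6)"
  have e: "0 < e" "e \<le> 1" "e \<le> r / 6" using \<open>r > 0\<close> by (auto simp: e_def)
  define \<eta> where "\<eta> = r / (6 * (2 * F + 1))"
  have \<eta>: "\<eta> > 0" "(2 * F + 1) * \<eta> = r / 6" using \<open>r > 0\<close> \<open>0 \<le> F\<close> by (auto simp: \<eta>_def field_simps)
  obtain R1 where R1: "\<forall>\<^sub>F n in sequentially. measure M {\<omega>\<in>space M. R1 < norm (X n \<omega>)} \<le> \<eta>"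
    using tight[OF \<eta>(1)] by blast
  \<comment> \<open>The single law \<open>N\<close> is tight by continuity from above: the
    complements of growing balls decrease to the empty set.\<close>
  have "(\<lambda>k. N.prob {x\<in>space N. real k < norm x}) \<longlonglongrightarrow> N.prob (\<Inter>k. {x\<in>space N. real k < norm x})"
  proof (rule N.finite_Lim_measure_decseq)
    have "{x\<in>space N. real k < norm x} \<in> sets N" for k
      unfolding N sets_eq_imp_space_eq[OF N(2)] by simp
    then show "range (\<lambda>k. {x\<in>space N. real k < norm x}) \<subseteq> N.events" by auto
  qed (auto simp: decseq_def)
  moreover have "(\<Inter>k. {x\<in>space N. real k < norm x}) = {}"
    by auto (metis reals_Archimedean2 less_asym)
  ultimately have "(\<lambda>k. N.prob {x\<in>space N. real k < norm x}) \<longlonglongrightarrow> 0" by simp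
  then have "\<forall>\<^sub>F k in sequentially. N.prob {x\<in>space N. real k < norm x} < \<eta>"
    by (rule order_tendstoD(2)) (rule \<eta>(1))
  then obtain k where k: "N.prob {x\<in>space N. real k < norm x} < \<eta>"
    by (auto simp: eventually_sequentially)
  define R where "R = max 1 (max R1 (real k))"
  have R: "R > 0" "R1 \<le> R" "real k \<le> R" by (auto simp: R_def)
  obtain h where h: "trig_poly h" "\<And>x. norm x \<le> R \<Longrightarrow> \<bar>f x - h x\<bar> \<le> e" "\<And>x. \<bar>h x\<bar> \<le> F + e"
    using trig_poly_approx[OF f(1) F R(1) e(1)] by metis
  note [measurable] = bm[OF trig_poly_continuous[OF h(1)]]
  have h': "\<bar>h x\<bar> \<le> F + 1" for x using h(3)[of x] e by linarith
  have Nset: "{x\<in>space N. c < norm x} \<in> sets N" for c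
    unfolding N sets_eq_imp_space_eq[OF N(2)] by simp
  have "\<bar>(\<integral>x. f x \<partial>N) - (\<integral>x. h x \<partial>N)\<bar> \<le> e + (F + (F + 1)) * N.prob {x\<in>space N. R < norm x}"
    using e(1) by (intro N.expectation_diff_le_on_set F h') (auto intro!: h(2) Nset)
  also have "N.prob {x\<in>space N. R < norm x} \<le> \<eta>"
    by (rule order_trans[OF N.finite_measure_mono less_imp_le[OF k]]) (use R Nset in auto)
  finally have 1: "\<bar>(\<integral>x. f x \<partial>N) - (\<integral>x. h x \<partial>N)\<bar> \<le> r / 3"
    using e(3) \<eta>(2) \<open>0 \<le> F\<close> by simp
  have 2: "\<forall>\<^sub>F n in sequentially. \<bar>(\<integral>\<omega>. f (X n \<omega>) \<partial>M) - (\<integral>\<omega>. h (X n \<omega>) \<partial>M)\<bar> \<le> r / 3"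
    using R1
  proof eventually_elim
    case (elim n)
    have "\<bar>(\<integral>\<omega>. f (X n \<omega>) \<partial>M) - (\<integral>\<omega>. h (X n \<omega>) \<partial>M)\<bar> \<le> e + (F + (F + 1)) * M.prob {\<omega>\<in>space M. R < norm (X n \<omega>)}"
      using e(1) by (intro M.expectation_diff_le_on_set F h') (auto intro!: h(2))
    also have "M.prob {\<omega>\<in>space M. R < norm (X n \<omega>)} \<le> \<eta>"
      by (rule order_trans[OF M.finite_measure_mono elim]) (use R in auto)
    finally show ?case using e(3) \<eta>(2) \<open>0 \<le> F\<close> by simp
  qed
  have 3: "\<forall>\<^sub>F n in sequentially. \<bar>(\<integral>\<omega>. h (X n \<omega>) \<partial>M) - (\<integral>x. h x \<partial>N)\<bar> < r / 3"
    using tendstoD[OF trig_lim[OF h(1)], of "r/3"] \<open>r > 0\<close> by (simp add: dist_real_def)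
  have "\<forall>\<^sub>F n in sequentially. norm ((\<integral>\<omega>. f (X n \<omega>) \<partial>M) - (\<integral>x. f x \<partial>N)) < r"
    using 2 3 by eventually_elim (use 1 in \<open>simp add: abs_if split: if_splits\<close>)
  then show "\<exists>no. \<forall>n\<ge>no. norm ((\<integral>\<omega>. f (X n \<omega>) \<partial>M) - (\<integral>x. f x \<partial>N)) < r"
    by (simp add: eventually_sequentially)
qed


section \<open>Multivariate normal distributions\<close>

text \<open>Completing the square in the variable \<open>p\<close> splits off one square; what
  remains is the Schur complement, again symmetric and nonnegative. This plays the role of a
  Cholesky factorization for a possibly singular covariance matrix.\<close>

lemma psd_form_eq_sum_of_squares:
  fixes s :: "'i \<Rightarrow> 'i \<Rightarrow> real"
  assumes "finite I" and "\<And>i j. s i j = s j i"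
    and "\<And>a. 0 \<le> (\<Sum>i\<in>I. \<Sum>j\<in>I. a i * s i j * a j)"
  shows "\<exists>c. \<forall>a. (\<Sum>i\<in>I. \<Sum>j\<in>I. a i * s i j * a j) = (\<Sum>k\<in>I. (\<Sum>i\<in>I. c k i * a i)\<^sup>2)"
  using assms
proof (induction I arbitrary: s rule: finite_induct)
  case (insert p I)
  define q where "q a = (\<Sum>i\<in>I. \<Sum>j\<in>I. a i * s i j * a j)" for a
  define b where "b a = (\<Sum>j\<in>I. s p j * a j)" for a
  have split: "(\<Sum>i\<in>insert p I. \<Sum>j\<in>insert p I. a i * s i j * a j) = (a p)\<^sup>2 * s p p + 2 * a p * b a + q a" for a
  proof -
    have "(\<Sum>i\<in>I. a i * s i p * a p) = a p * b a"
      using insert.prems(1) by (auto simp: b_def sum_distrib_left intro!: sum.cong)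
    moreover have "(\<Sum>j\<in>I. a p * s p j * a j) = a p * b a"
      by (auto simp: b_def sum_distrib_left intro!: sum.cong)
    ultimately show ?thesis
      using insert.hyps by (simp add: sum.distrib q_def power2_eq_square)
  qed
  have upd: "q (a(p := t)) = q a" "b (a(p := t)) = b a" for a t
    using insert.hyps by (auto simp: q_def b_def intro!: sum.cong)
  have nonneg: "0 \<le> t\<^sup>2 * s p p + 2 * t * b a + q a" for a t
    using insert.prems(2)[of "a(p := t)"] unfolding split upd by simp
  \<comment> \<open>The Schur complement. If \<open>s p p = 0\<close>, division by zero yields 0 and
    \<open>s'\<close> is just \<open>s\<close>, which is right because \<open>b\<close> then
    vanishes.\<close>
  define s' where "s' i j = s i j - s p i * s p j / s p p" for i j
  have s': "(\<Sum>i\<in>I. \<Sum>j\<in>I. a i * s' i j * a j) = q a - (b a)\<^sup>2 / s p p" for a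
  proof -
    have "(b a)\<^sup>2 / s p p = (\<Sum>i\<in>I. \<Sum>j\<in>I. a i * (s p i * s p j / s p p) * a j)"
      by (simp add: b_def power2_eq_square sum_product sum_divide_distrib mult_ac)
    then show ?thesis
      by (simp add: s'_def q_def right_diff_distrib left_diff_distrib sum_subtractf)
  qed
  have pp: "0 \<le> s p p"
    using nonneg[of 1 "\<lambda>_. 0"] by (simp add: q_def b_def)
  \<comment> \<open>With \<open>s p p = 0\<close> the form is affine in the coordinate at
    \<open>p\<close>; the witness below gives it the value -1 unless the slope vanishes.\<close>
  have b0: "b a = 0" if "s p p = 0" for a
  proof (rule ccontr)
    assume "b a \<noteq> 0"
    then show False using nonneg[of "- (q a + 1) / (2 * b a)" a] that by (simp add: field_simps)
  qed
  have "0 \<le> (\<Sum>i\<in>I. \<Sum>j\<in>I. a i * s' i j * a j)" for a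
  proof (cases "s p p = 0")
    case True
    then show ?thesis using nonneg[of 0 a] by (simp add: s')
  next
    case False
    then have "(- (b a / s p p))\<^sup>2 * s p p + 2 * (- (b a / s p p)) * b a + q a = q a - (b a)\<^sup>2 / s p p"
      by (simp add: power2_eq_square field_simps)
    then show ?thesis using nonneg[of "- (b a / s p p)" a] by (simp add: s')
  qed
  moreover have "s' i j = s' j i" for i j
    using insert.prems(1)[of i j] by (simp add: s'_def mult.commute)
  ultimately obtain c where c: "\<And>a. (\<Sum>i\<in>I. \<Sum>j\<in>I. a i * s' i j * a j) = (\<Sum>k\<in>I. (\<Sum>i\<in>I. c k i * a i)\<^sup>2)"
    using insert.IH by blast
  \<comment> \<open>Row \<open>p\<close> is the square that was split off; the other rows come from
    the induction hypothesis, with coefficient 0 at \<open>p\<close>.\<close>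
  define c' where "c' k i = (if k = p then s p i / sqrt (s p p) else if i = p then 0 else c k i)" for k i
  have "(\<Sum>i\<in>insert p I. \<Sum>j\<in>insert p I. a i * s i j * a j) = (\<Sum>k\<in>insert p I. (\<Sum>i\<in>insert p I. c' k i * a i)\<^sup>2)" for a
  proof -
    have "(\<Sum>i\<in>insert p I. c' k i * a i) = (\<Sum>i\<in>I. c k i * a i)" if "k \<in> I" for k
      using insert.hyps that by (auto simp: c'_def intro!: sum.cong)
    then have "(\<Sum>k\<in>I. (\<Sum>i\<in>insert p I. c' k i * a i)\<^sup>2) = q a - (b a)\<^sup>2 / s p p"
      using c[of a] by (simp add: s')
    moreover have "(\<Sum>i\<in>insert p I. c' p i * a i) = (s p p * a p + b a) / sqrt (s p p)"
      using insert.hyps by (simp add: c'_def b_def sum_divide_distrib add_divide_distrib)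
    moreover have "((s p p * a p + b a) / sqrt (s p p))\<^sup>2 = (a p)\<^sup>2 * s p p + 2 * a p * b a + (b a)\<^sup>2 / s p p"
      using pp b0[of a] by (cases "s p p = 0") (simp_all add: power_divide power2_eq_square field_simps)
    ultimately show ?thesis
      unfolding split using insert.hyps by simp
  qed
  then show ?case by blast
qed simp

lemma distr_distributed_normal:
  assumes "distributed P lborel X (normal_density 0 s)"
  shows "distr P borel X = density lborel (normal_density 0 s)"
  using assms by (simp add: distributed_def cong: distr_cong)

text \<open>Writing the form as the sum of the squares of \<open>a \<bullet> v k\<close> exhibits it
  as the variance of a projection of a linear combination of the \<open>v k\<close> with independent
  standard normal weights. The law of that combination is the witness.\<close>

lemma mvnormal_exists:
  fixes \<Sigma> :: "real^'r^'r"
  assumes sym: "\<And>i j. \<Sigma> $ i $ j = \<Sigma> $ j $ i" and psd: "\<And>a. 0 \<le> a \<bullet> (\<Sigma> *v a)"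
  shows "\<exists>N. mvnormal \<Sigma> N"
proof -
  have form: "a \<bullet> (\<Sigma> *v a) = (\<Sum>i\<in>UNIV. \<Sum>j\<in>UNIV. a $ i * \<Sigma> $ i $ j * a $ j)" for a
    by (simp add: inner_vec_def matrix_vector_mult_def sum_distrib_left mult.assoc)
  have psd': "0 \<le> (\<Sum>i\<in>UNIV. \<Sum>j\<in>UNIV. a i * \<Sigma> $ i $ j * a j)" for a
    using psd[of "vec_lambda a"] unfolding form by simp
  have "\<exists>c. \<forall>a. (\<Sum>i\<in>UNIV. \<Sum>j\<in>UNIV. a i * \<Sigma> $ i $ j * a j) = (\<Sum>k\<in>(UNIV :: 'r set). (\<Sum>i\<in>UNIV. c k i * a i)\<^sup>2)"
    by (rule psd_form_eq_sum_of_squares[of UNIV "\<lambda>i j. \<Sigma> $ i $ j", OF finite sym psd'])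
  then obtain c where c: "\<And>a. (\<Sum>i\<in>UNIV. \<Sum>j\<in>UNIV. a i * \<Sigma> $ i $ j * a j) = (\<Sum>k\<in>(UNIV :: 'r set). (\<Sum>i\<in>UNIV. c k i * a i)\<^sup>2)"
    by blast
  define v where "v k = vec_lambda (c k)" for k
  have v: "a \<bullet> (\<Sigma> *v a) = (\<Sum>k\<in>UNIV. (a \<bullet> v k)\<^sup>2)" for a
    unfolding form c by (simp add: v_def inner_vec_def mult.commute)
  define P where "P = Pi\<^sub>M (UNIV :: 'r set) (\<lambda>_. std_normal_distribution)"
  define X where "X \<omega> = (\<Sum>k\<in>UNIV. \<omega> k *\<^sub>R v k)" for \<omega> :: "'r \<Rightarrow> real"
  interpret std: prob_space std_normal_distribution
    by (rule prob_space_normal_density) simp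
  interpret P: product_prob_space "\<lambda>_. std_normal_distribution" "UNIV :: 'r set"
    by standard
  interpret P': prob_space P unfolding P_def by (rule P.prob_space_axioms)
  have sP: "sets P = sets (Pi\<^sub>M (UNIV :: 'r set) (\<lambda>_. borel :: real measure))"
    unfolding P_def by (intro sets_PiM_cong) auto
  have coord [measurable]: "(\<lambda>\<omega>. \<omega> k) \<in> borel_measurable P" for k
    unfolding measurable_cong_sets[OF sP refl] by (rule measurable_component_singleton) simp
  have X [measurable]: "X \<in> borel_measurable P"
    unfolding X_def by measurable
  have dist: "distributed P lborel (\<lambda>\<omega>. \<omega> k) std_normal_density" for k
  proof -
    have "distr P (std_normal_distribution) (\<lambda>\<omega>. \<omega> k) = std_normal_distribution"
      unfolding P_def by (rule P.PiM_component) simp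
    then have "distr P lborel (\<lambda>\<omega>. \<omega> k) = std_normal_distribution"
      by (simp cong: distr_cong)
    then show ?thesis by (simp add: distributed_def)
  qed
  have indep: "P'.indep_vars (\<lambda>_. borel) (\<lambda>k \<omega>. \<omega> k) UNIV"
  proof -
    have "distr P (Pi\<^sub>M UNIV (\<lambda>_. borel)) (\<lambda>\<omega>. \<lambda>k\<in>UNIV. \<omega> k) = Pi\<^sub>M UNIV (\<lambda>k. distr P borel (\<lambda>\<omega>. \<omega> k))"
    proof -
      have "distr P borel (\<lambda>\<omega>. \<omega> k) = std_normal_distribution" for k
        by (rule distr_distributed_normal[OF dist])
      moreover have "distr P (Pi\<^sub>M UNIV (\<lambda>_. borel)) (\<lambda>\<omega>. \<lambda>k\<in>UNIV. \<omega> k) = distr P P (\<lambda>\<omega>. \<omega>)"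
        by (rule distr_cong) (auto simp: sP)
      ultimately show ?thesis by (simp add: P_def[symmetric] distr_id)
    qed
    then show ?thesis by (subst P'.indep_vars_iff_distr_eq_PiM') auto
  qed
  define N where "N = distr P borel X"
  have "distr N borel (\<lambda>x. a \<bullet> x) = (if a \<bullet> (\<Sigma> *v a) = 0 then return borel 0
         else density lborel (normal_density 0 (sqrt (a \<bullet> (\<Sigma> *v a)))))" for a
  proof -
    \<comment> \<open>Zero terms are dropped because a normal density needs a positive standard
      deviation; an empty \<open>I\<close> is exactly the branch
      \<open>return borel 0\<close>.\<close>
    define I where "I = {k. a \<bullet> v k \<noteq> 0}"
    have aX: "(\<lambda>\<omega>. a \<bullet> X \<omega>) = (\<lambda>\<omega>. \<Sum>k\<in>I. (a \<bullet> v k) * \<omega> k)"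
      unfolding X_def I_def by (auto simp: inner_sum_right fun_eq_iff mult.commute intro!: sum.mono_neutral_right)
    have var: "a \<bullet> (\<Sigma> *v a) = (\<Sum>k\<in>I. (a \<bullet> v k)\<^sup>2)"
      unfolding v I_def by (rule sum.mono_neutral_right) auto
    have N: "distr N borel (\<lambda>x. a \<bullet> x) = distr P borel (\<lambda>\<omega>. a \<bullet> X \<omega>)"
      unfolding N_def by (subst distr_distr) (auto simp: comp_def)
    show ?thesis
    proof (cases "I = {}")
      case True
      then show ?thesis unfolding N aX var by (simp add: P'.prob_space_axioms prob_space.distr_const)
    next
      case False
      have "distributed P lborel (\<lambda>\<omega>. \<Sum>k\<in>I. (a \<bullet> v k) * \<omega> k) (normal_density (\<Sum>k\<in>I. 0) (sqrt (\<Sum>k\<in>I. \<bar>a \<bullet> v k\<bar>\<^sup>2)))"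
      proof (rule P'.sum_indep_normal)
        show "P'.indep_vars (\<lambda>_. borel) (\<lambda>k \<omega>. (a \<bullet> v k) * \<omega> k) I"
          by (rule P'.indep_vars_compose2[OF P'.indep_vars_subset[OF indep]]) auto
        show "distributed P lborel (\<lambda>\<omega>. (a \<bullet> v k) * \<omega> k) (normal_density 0 \<bar>a \<bullet> v k\<bar>)" if "k \<in> I" for k
          using P'.normal_density_affine[OF dist[of k], of "a \<bullet> v k" 0] that by (simp add: I_def)
      qed (use False in \<open>auto simp: I_def\<close>)
      then have "distr P borel (\<lambda>\<omega>. a \<bullet> X \<omega>) = density lborel (normal_density 0 (sqrt (a \<bullet> (\<Sigma> *v a))))"
        unfolding aX var by (intro distr_distributed_normal) simp
      moreover have "a \<bullet> (\<Sigma> *v a) \<noteq> 0"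
        using False unfolding var by (subst sum_nonneg_eq_0_iff) (auto simp: I_def)
      ultimately show ?thesis by (simp add: N)
    qed
  qed
  moreover have "prob_space N" unfolding N_def by (rule P'.prob_space_distr) simp
  ultimately show ?thesis unfolding mvnormal_def N_def by (metis sets_distr)
qed


section \<open>The tilting equation for fixed data\<close>

lemma abs_sum_mult_le_L2_set: "\<bar>\<Sum>k\<in>A. x k * y k\<bar> \<le> L2_set x A * L2_set y A"
proof -
  have "\<bar>\<Sum>k\<in>A. x k * y k\<bar> \<le> (\<Sum>k\<in>A. \<bar>x k\<bar> * \<bar>y k\<bar>)"
    using sum_abs[of "\<lambda>k. x k * y k" A] by (simp add: abs_mult)
  also have "\<dots> \<le> L2_set x A * L2_set y A" by (rule L2_set_mult_ineq)
  finally show ?thesis .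
qed

lemma L2_set_squared: "(L2_set x A)\<^sup>2 = (\<Sum>k\<in>A. (x k)\<^sup>2)"
  by (simp add: L2_set_def sum_nonneg)

text \<open>Vectors of every dimension share one function type. Pinning the coordinates from
  \<open>m\<close> on to 0 makes the ball compact in the product topology, as minimization over it
  requires.\<close>

definition vball :: "nat \<Rightarrow> real \<Rightarrow> (nat \<Rightarrow> real) set" where
  "vball m R = {x. (\<forall>k\<ge>m. x k = 0) \<and> (\<Sum>k<m. (x k)\<^sup>2) \<le> R\<^sup>2}"

lemma vball_L2_set: "x \<in> vball m R \<Longrightarrow> 0 \<le> R \<Longrightarrow> L2_set x {..<m} \<le> R"
  by (simp add: vball_def L2_set_def real_le_lsqrt)

section \<open>Compactness of balls, interior minima and linear systems\<close>

lemma continuous_on_coordinate [continuous_intros]: "continuous_on S (\<lambda>x. x i :: real)"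
  by (rule continuous_on_subset[OF continuous_on_product_coordinates]) simp

text \<open>Tychonoff's theorem: each factor is an interval or the single point 0.\<close>

lemma compact_coordinate_box: "compact {x :: nat \<Rightarrow> real. \<forall>k. x k \<in> (if k < m then {- R..R} else {0})}"
proof -
  have "compactin (product_topology (\<lambda>_. euclidean) UNIV) (\<Pi>\<^sub>E k\<in>UNIV. if k < m then {- R..R} else {0 :: real})"
    unfolding compactin_PiE by auto
  moreover have "(\<Pi>\<^sub>E k\<in>UNIV. if k < m then {- R..R} else {0 :: real}) = {x. \<forall>k. x k \<in> (if k < m then {- R..R} else {0})}"
    by (auto simp: PiE_def Pi_def)
  ultimately show ?thesis
    by (simp add: euclidean_product_topology)
qed

lemma compact_vball:
  assumes "0 \<le> R"
  shows "compact (vball m R)"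
proof -
  have closed: "closed (vball m R)"
  proof -
    have "vball m R = (\<Inter>k\<in>{m..}. {x. x k = 0}) \<inter> {x. (\<Sum>k<m. (x k)\<^sup>2) \<le> R\<^sup>2}"
      by (auto simp: vball_def)
    then show ?thesis
      by (auto intro!: closed_INT closed_Collect_eq closed_Collect_le continuous_intros)
  qed
  moreover have "vball m R \<subseteq> {x. \<forall>k. x k \<in> (if k < m then {- R..R} else {0})}"
  proof safe
    fix x k assume x: "x \<in> vball m R"
    show "x k \<in> (if k < m then {- R..R} else {0})"
    proof (cases "k < m")
      case True
      then have "(x k)\<^sup>2 \<le> (\<Sum>k<m. (x k)\<^sup>2)" by (intro member_le_sum) auto
      then have "(x k)\<^sup>2 \<le> R\<^sup>2" using x by (auto simp: vball_def)
      then have "\<bar>x k\<bar> \<le> R" using assms by (simp add: abs_le_square_iff[symmetric])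
      then show ?thesis using True by (auto simp: abs_le_iff)
    qed (use x in \<open>auto simp: vball_def\<close>)
  qed
  moreover have "compact (vball m R \<inter> {x. \<forall>k. x k \<in> (if k < m then {- R..R} else {0})})"
    by (rule closed_Int_compact[OF closed compact_coordinate_box])
  ultimately show ?thesis by (simp only: inf.absorb1)
qed

lemma fun_upd_has_real_derivative [derivative_intros]:
  "((\<lambda>t. (x(k := t)) i) has_real_derivative (if i = k then 1 else 0)) (at s)"
  by (cases "i = k") (auto intro!: derivative_eq_intros)

text \<open>A minimum over the compact ball cannot lie on the sphere, where \<open>f\<close> exceeds
  its value at the centre, so every coordinate derivative vanishes there. This serves both the
  normal equations of the regression and the tilting equation.\<close>

lemma interior_minimizer:
  assumes R: "0 < R" and f: "continuous_on (vball m R) f"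
    and bd: "\<And>x. x \<in> vball m R \<Longrightarrow> (\<Sum>k<m. (x k)\<^sup>2) = R\<^sup>2 \<Longrightarrow> f (\<lambda>_. 0) < (f x :: real)"
  obtains x where "x \<in> vball m R"
    and "\<And>k D. k < m \<Longrightarrow> ((\<lambda>t. f (x(k := t))) has_real_derivative D) (at (x k)) \<Longrightarrow> D = 0"
proof -
  have 0: "(\<lambda>_. 0) \<in> vball m R" by (simp add: vball_def)
  then obtain x where x: "x \<in> vball m R" "\<And>y. y \<in> vball m R \<Longrightarrow> f x \<le> f y"
    using continuous_attains_inf[OF compact_vball _ f] R by (metis empty_iff less_imp_le)
  have lt: "(\<Sum>k<m. (x k)\<^sup>2) < R\<^sup>2"
    using x(1) bd[OF x(1)] x(2)[OF 0] by (fastforce simp: vball_def)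
  have "D = 0" if k: "k < m" and D: "((\<lambda>t. f (x(k := t))) has_real_derivative D) (at (x k))" for k D
  proof -
    have "open {t. (\<Sum>i<m. ((x(k := t)) i)\<^sup>2) < R\<^sup>2}"
    proof (intro open_Collect_less continuous_intros)
      show "continuous_on UNIV (\<lambda>t. (x(k := t)) i)" for i by (cases "i = k") auto
    qed
    moreover have "x k \<in> {t. (\<Sum>i<m. ((x(k := t)) i)\<^sup>2) < R\<^sup>2}" using lt by (simp only: mem_Collect_eq fun_upd_triv)
    ultimately have "\<exists>d>0. \<forall>t. dist t (x k) < d \<longrightarrow> t \<in> {t. (\<Sum>i<m. ((x(k := t)) i)\<^sup>2) < R\<^sup>2}"
      unfolding open_dist by (rule bspec)
    then obtain d where d: "d > 0" "\<And>t. dist t (x k) < d \<Longrightarrow> (\<Sum>i<m. ((x(k := t)) i)\<^sup>2) < R\<^sup>2"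
      by blast
    have "f (x(k := x k)) \<le> f (x(k := t))" if "\<bar>x k - t\<bar> < d" for t
    proof -
      have "x(k := t) \<in> vball m R"
        using d(2)[of t] that x(1) k by (auto simp: vball_def dist_real_def abs_minus_commute)
      then show ?thesis using x(2) by simp
    qed
    then show ?thesis using DERIV_local_min[OF D d(1)] by blast
  qed
  then show thesis using that x(1) by blast
qed

text \<open>The gradient of x^T w x / 2 - v^T x is w x - v, so a minimizer of this quadratic solves
  the system.\<close>

lemma positive_definite_solve:
  fixes w :: "nat \<Rightarrow> nat \<Rightarrow> real"
  assumes c: "0 < c" and sym: "\<And>i j. w i j = w j i"
    and low: "\<And>a. c * (\<Sum>k<m. (a k)\<^sup>2) \<le> (\<Sum>i<m. \<Sum>j<m. a i * w i j * a j)"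
  obtains b where "\<And>k. k < m \<Longrightarrow> (\<Sum>l<m. w k l * b l) = v k"
proof -
  define f where "f x = (\<Sum>i<m. \<Sum>j<m. x i * w i j * x j) / 2 - (\<Sum>i<m. v i * x i)" for x
  \<comment> \<open>Chosen so that \<open>c * R / 2\<close> exceeds the norm of \<open>v\<close> by
    \<open>c / 2\<close>; on the sphere the quadratic part then beats the linear one.\<close>
  define R where "R = 2 * L2_set v {..<m} / c + 1"
  have R: "0 < R" using c by (simp add: R_def add_nonneg_pos)
  have "f (\<lambda>_. 0) < f x" if "x \<in> vball m R" and eq: "(\<Sum>k<m. (x k)\<^sup>2) = R\<^sup>2" for x
  proof -
    have "(\<Sum>i<m. v i * x i) \<le> L2_set v {..<m} * L2_set x {..<m}"
      using abs_sum_mult_le_L2_set[of v x "{..<m}"] by simp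
    also have "L2_set x {..<m} = R" using R by (simp add: L2_set_def eq)
    finally have "f x \<ge> R * (c * R / 2 - L2_set v {..<m})"
      using low[of x] unfolding eq f_def by (simp add: algebra_simps power2_eq_square)
    moreover have "c * R / 2 - L2_set v {..<m} = c / 2"
      using c by (simp add: R_def field_simps)
    ultimately have "f x \<ge> R * (c / 2)" by simp
    then have "0 < f x" using R c by (smt (verit) mult_pos_pos half_gt_zero)
    then show ?thesis by (simp add: f_def)
  qed
  moreover have "continuous_on (vball m R) f"
    unfolding f_def by (intro continuous_intros) auto
  ultimately obtain x where x: "\<And>k D. k < m \<Longrightarrow> ((\<lambda>t. f (x(k := t))) has_real_derivative D) (at (x k)) \<Longrightarrow> D = 0"
    using interior_minimizer[OF R, of m f] by blast
  have "(\<Sum>l<m. w k l * x l) = v k" if k: "k < m" for k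
  proof -
    have "((\<lambda>t. f (x(k := t))) has_real_derivative
        (\<Sum>i<m. \<Sum>j<m. (if i = k then 1 else 0) * (w i j * x j) + (if j = k then 1 else 0) * (x i * w i j)) / 2
        - (\<Sum>i<m. (if i = k then 1 else 0) * v i)) (at (x k))"
      unfolding f_def
      by (rule DERIV_diff DERIV_cdivide DERIV_sum derivative_eq_intros refl | simp add: mult_ac)+
    then have "(\<Sum>i<m. \<Sum>j<m. (if i = k then 1 else 0) * (w i j * x j) + (if j = k then 1 else 0) * (x i * w i j)) / 2
        - (\<Sum>i<m. (if i = k then 1 else 0) * v i) = 0"
      by (rule x[OF k])
    moreover have "(\<Sum>i<m. \<Sum>j<m. (if i = k then 1 else 0) * (w i j * x j) + (if j = k then 1 else 0) * (x i * w i j))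
        = (\<Sum>i<m. (if i = k then 1 else 0) * (\<Sum>j<m. w i j * x j)) + (\<Sum>i<m. \<Sum>j<m. (if j = k then 1 else 0) * (x i * w i j))"
      by (simp add: sum.distrib sum_distrib_left)
    moreover have "(\<Sum>i<m. (if i = k then 1 else 0) * (\<Sum>j<m. w i j * x j)) = (\<Sum>l<m. w k l * x l)"
      using k by (simp add: if_distrib[of "\<lambda>z. z * _"] sum.delta cong: if_cong)
    moreover have "(\<Sum>i<m. \<Sum>j<m. (if j = k then 1 else 0) * (x i * w i j)) = (\<Sum>l<m. w k l * x l)"
      using k by (simp add: if_distrib[of "\<lambda>z. z * _"] sum.delta sym[of _ k] cong: if_cong)
        (simp add: mult.commute)
    moreover have "(\<Sum>i<m. (if i = k then 1 else 0) * v i) = v k"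
      using k by (simp add: if_distrib[of "\<lambda>z. z * _"] sum.delta cong: if_cong)
    ultimately show ?thesis by simp
  qed
  then show thesis using that by blast
qed

text \<open>Since ln(1 + x) = 2 ln(sqrt(1 + x)) is at most 2 (sqrt(1 + x) - 1), a quadratic upper
  bound for the square root suffices, and that one is verified by squaring.\<close>

lemma ln_one_plus_le_quadratic:
  fixes x :: real
  assumes "\<bar>x\<bar> \<le> 1/2"
  shows "ln (1 + x) \<le> x - x\<^sup>2 / 8"
proof -
  have x: "1 + x > 0" using assms by (simp add: abs_le_iff)
  have "0 \<le> x\<^sup>2 * (2 - x)" using assms by (intro mult_nonneg_nonneg) (auto simp: abs_le_iff)
  then have "1 + x \<le> (1 + x / 2 - x\<^sup>2 / 16)\<^sup>2"
    using zero_le_power2[of "x\<^sup>2"] by (simp add: power2_eq_square algebra_simps)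
  moreover have "0 \<le> 1 + x / 2 - x\<^sup>2 / 16"
  proof -
    have "x\<^sup>2 \<le> (1/2)\<^sup>2" using assms by (subst abs_le_square_iff[symmetric]) simp
    then show ?thesis using assms by (simp add: abs_le_iff power2_eq_square)
  qed
  ultimately have "sqrt (1 + x) \<le> 1 + x / 2 - x\<^sup>2 / 16"
    by (intro real_le_lsqrt) auto
  moreover have "ln (sqrt (1 + x)) \<le> sqrt (1 + x) - 1"
    using x by (intro ln_le_minus_one) auto
  moreover have "ln (1 + x) = 2 * ln (sqrt (1 + x))"
    using x by (simp add: ln_sqrt)
  ultimately show ?thesis by simp
qed

section \<open>Existence and uniqueness for the tilting equation\<close>

lemma dotm_le: "\<bar>dotm m u z x\<bar> \<le> vnorm m u z * L2_set x {..<m}"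
  using abs_sum_mult_le_L2_set[of "\<lambda>k. u k z" x "{..<m}"] by (simp add: dotm_def vnorm_def L2_set_def)

lemma sum_dotm: "(\<Sum>j<n. f j * dotm m u (z j) x) = (\<Sum>k<m. (\<Sum>j<n. f j * u k (z j)) * x k)"
  unfolding dotm_def sum_distrib_left sum_distrib_right
  by (subst sum.swap) (simp add: mult.assoc)

lemma dotm_diff: "dotm m u z (\<lambda>k. x k - y k) = dotm m u z x - dotm m u z y"
  by (simp add: dotm_def right_diff_distrib sum_subtractf)

text \<open>The solution minimises the convex function \<open>- \<Sum> ln (1 + u(Z\<^sub>j) \<bullet> x)\<close>.\<close>
lemma zeta_eq_exists:
  assumes n: "0 < n" and R: "0 < R" and c: "0 < c"
    and low: "\<And>x. c * (\<Sum>k<m. (x k)\<^sup>2) \<le> (1 / real n) * (\<Sum>j<n. (dotm m u (Z j \<omega>) x)\<^sup>2)"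
    and umax: "\<And>j. j < n \<Longrightarrow> vnorm m u (Z j \<omega>) * R \<le> 1/2"
    and ubar: "L2_set (\<lambda>k. (1 / real n) * (\<Sum>j<n. u k (Z j \<omega>))) {..<m} < c * R / 8"
  obtains \<zeta> where "zeta_eq n m u Z \<omega> \<zeta>" "\<zeta> \<in> vball m R"
proof -
  let ?d = "\<lambda>j. dotm m u (Z j \<omega>)"
  define f where "f x = - (\<Sum>j<n. ln (1 + ?d j x))" for x
  have d: "\<bar>?d j x\<bar> \<le> 1/2" if "x \<in> vball m R" "j < n" for j x
  proof -
    have "\<bar>?d j x\<bar> \<le> vnorm m u (Z j \<omega>) * L2_set x {..<m}" by (rule dotm_le)
    also have "\<dots> \<le> vnorm m u (Z j \<omega>) * R"
      using vball_L2_set[OF that(1)] R by (intro mult_left_mono) (auto simp: vnorm_def sum_nonneg)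
    finally show ?thesis using umax[OF that(2)] by simp
  qed
  then have dpos: "0 < 1 + ?d j x" if "x \<in> vball m R" "j < n" for j x
    using that by (fastforce simp: abs_le_iff)
  \<comment> \<open>On the sphere the linear part of the logarithm bound stays below
    \<open>n * c * R\<^sup>2 / 8\<close> by \<open>ubar\<close>, and the quadratic part takes away
    at least that much by \<open>low\<close>. The 8 in \<open>ubar\<close> is the 8 of
    \<open>ln_one_plus_le_quadratic\<close>.\<close>
  have "f (\<lambda>_. 0) < f x" if x: "x \<in> vball m R" and eq: "(\<Sum>k<m. (x k)\<^sup>2) = R\<^sup>2" for x
  proof -
    have "(\<Sum>j<n. ln (1 + ?d j x)) \<le> (\<Sum>j<n. ?d j x - (?d j x)\<^sup>2 / 8)"
      by (intro sum_mono ln_one_plus_le_quadratic d x) auto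
    also have "\<dots> = (\<Sum>j<n. ?d j x) - (\<Sum>j<n. (?d j x)\<^sup>2) / 8"
      by (simp add: sum_subtractf sum_divide_distrib)
    also have "(\<Sum>j<n. ?d j x) = real n * (\<Sum>k<m. (1 / real n) * (\<Sum>j<n. u k (Z j \<omega>)) * x k)"
      using sum_dotm[of "\<lambda>_. 1" m u "\<lambda>j. Z j \<omega>" x n] n by (simp add: sum_distrib_left[of "real n"] field_simps)
    also have "(\<Sum>k<m. (1 / real n) * (\<Sum>j<n. u k (Z j \<omega>)) * x k)
        \<le> L2_set (\<lambda>k. (1 / real n) * (\<Sum>j<n. u k (Z j \<omega>))) {..<m} * L2_set x {..<m}"
      using abs_sum_mult_le_L2_set[of "\<lambda>k. (1 / real n) * (\<Sum>j<n. u k (Z j \<omega>))" x "{..<m}"] by linarith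
    also have "L2_set x {..<m} = R" using R by (simp add: L2_set_def eq)
    also have "L2_set (\<lambda>k. (1 / real n) * (\<Sum>j<n. u k (Z j \<omega>))) {..<m} * R < c * R / 8 * R"
      using ubar R by (rule mult_strict_right_mono)
    finally have "(\<Sum>j<n. ln (1 + ?d j x)) < real n * (c * R / 8 * R) - (\<Sum>j<n. (?d j x)\<^sup>2) / 8"
      using n by simp
    also have "\<dots> \<le> 0"
      using low[of x] n unfolding eq by (simp add: field_simps power2_eq_square)
    finally show ?thesis by (simp add: f_def dotm_def)
  qed
  moreover have "continuous_on (vball m R) f"
    unfolding f_def using dpos
    by (intro continuous_on_minus continuous_on_sum continuous_on_ln)
      (fastforce simp: dotm_def intro!: continuous_intros)+
  ultimately obtain x where x: "x \<in> vball m R"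
    "\<And>k D. k < m \<Longrightarrow> ((\<lambda>t. f (x(k := t))) has_real_derivative D) (at (x k)) \<Longrightarrow> D = 0"
    using interior_minimizer[OF R, of m f] by blast
  have "(\<Sum>j<n. u k (Z j \<omega>) / (1 + ?d j x)) = 0" if k: "k < m" for k
  proof -
    have dd: "((\<lambda>t. ?d j (x(k := t))) has_real_derivative u k (Z j \<omega>)) (at (x k))" for j
    proof -
      have "((\<lambda>t. ?d j (x(k := t))) has_real_derivative (\<Sum>i<m. u i (Z j \<omega>) * (if i = k then 1 else 0))) (at (x k))"
        unfolding dotm_def by (intro DERIV_sum DERIV_cmult fun_upd_has_real_derivative)
      then show ?thesis using k by (simp add: if_distrib[of "\<lambda>z. _ * z"] sum.delta cong: if_cong)
    qed
    have "((\<lambda>t. ln (1 + ?d j (x(k := t)))) has_real_derivative u k (Z j \<omega>) / (1 + ?d j x)) (at (x k))" if "j < n" for j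
      using dpos[OF x(1) that] by (auto intro!: derivative_eq_intros dd)
    then have "((\<lambda>t. f (x(k := t))) has_real_derivative - (\<Sum>j<n. u k (Z j \<omega>) / (1 + ?d j x))) (at (x k))"
      unfolding f_def by (intro DERIV_minus DERIV_sum) auto
    then show ?thesis using x(2)[OF k] by fastforce
  qed
  then have "zeta_eq n m u Z \<omega> x"
    using x(1) dpos[OF x(1)] by (auto simp: zeta_eq_def vball_def)
  then show thesis using that x(1) by blast
qed

text \<open>Subtracting the two equations and testing with \<open>x - y\<close> leaves a sum of
  squares with positive weights that equals 0. So all \<open>u (Z j \<omega>)\<close> annihilate
  \<open>x - y\<close>, and the positive Gram form forces it to vanish.\<close>

lemma zeta_eq_unique:
  assumes n: "0 < n" and c: "0 < c"
    and low: "\<And>x. c * (\<Sum>k<m. (x k)\<^sup>2) \<le> (1 / real n) * (\<Sum>j<n. (dotm m u (Z j \<omega>) x)\<^sup>2)"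
    and x: "zeta_eq n m u Z \<omega> x" and y: "zeta_eq n m u Z \<omega> y"
  shows "x = y"
proof -
  let ?d = "\<lambda>j. dotm m u (Z j \<omega>)"
  let ?z = "\<lambda>k. x k - y k"
  have eq: "(\<Sum>j<n. ?d j ?z / (1 + ?d j v)) = 0" if v: "zeta_eq n m u Z \<omega> v" for v
  proof -
    have "(\<Sum>j<n. ?d j ?z / (1 + ?d j v)) = (\<Sum>k<m. (\<Sum>j<n. u k (Z j \<omega>) / (1 + ?d j v)) * ?z k)"
      using sum_dotm[of "\<lambda>j. 1 / (1 + ?d j v)" m u "\<lambda>j. Z j \<omega>" ?z n] by simp
    also have "\<dots> = 0" using v n by (intro sum.neutral) (auto simp: zeta_eq_def)
    finally show ?thesis .
  qed
  have pos: "0 < 1 + ?d j x" "0 < 1 + ?d j y" if "j < n" for j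
    using that x y by (auto simp: zeta_eq_def)
  have "(\<Sum>j<n. (?d j ?z)\<^sup>2 / ((1 + ?d j x) * (1 + ?d j y))) = (\<Sum>j<n. ?d j ?z / (1 + ?d j y) - ?d j ?z / (1 + ?d j x))"
  proof (rule sum.cong)
    fix j assume "j \<in> {..<n}"
    then show "(?d j ?z)\<^sup>2 / ((1 + ?d j x) * (1 + ?d j y)) = ?d j ?z / (1 + ?d j y) - ?d j ?z / (1 + ?d j x)"
      using pos[of j] by (simp add: dotm_diff divide_simps) (simp add: power2_eq_square algebra_simps)
  qed simp
  also have "\<dots> = 0" by (simp add: sum_subtractf eq x y)
  finally have "\<forall>j\<in>{..<n}. (?d j ?z)\<^sup>2 / ((1 + ?d j x) * (1 + ?d j y)) = 0"
    using pos by (subst (asm) sum_nonneg_eq_0_iff) (auto intro!: divide_nonneg_pos mult_pos_pos)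
  then have "?d j ?z = 0" if "j < n" for j
    using pos[OF that] that by fastforce
  then have "c * (\<Sum>k<m. (?z k)\<^sup>2) \<le> 0" using low[of ?z] by simp
  then have "(\<Sum>k<m. (?z k)\<^sup>2) \<le> 0" using c by (simp add: mult_le_0_iff)
  then have "(\<Sum>k<m. (?z k)\<^sup>2) = 0" by (simp add: order_antisym sum_nonneg)
  then have "\<forall>k<m. x k = y k" by (simp add: sum_nonneg_eq_0_iff)
  then show ?thesis
    using x y unfolding zeta_eq_def by (metis ext not_le)
qed


section \<open>Measurability of the estimator\<close>

text \<open>Non-measurable integrands have Bochner integral 0, so the weak limit requires the estimator to be
  measurable, although it is defined through an unbounded quantifier. Compactness reduces the
  quantifier over \<open>K\<close> to one over a countable dense subset.\<close>
lemma sets_ex_zero_compact: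
  fixes G :: "'a \<Rightarrow> 'x::{metric_space, second_countable_topology} \<Rightarrow> real"
  assumes K: "compact K" and cont: "\<And>\<omega>. \<omega> \<in> space M \<Longrightarrow> continuous_on K (G \<omega>)"
    and meas [measurable]: "\<And>x. (\<lambda>\<omega>. G \<omega> x) \<in> borel_measurable M"
    and nonneg: "\<And>\<omega> x. 0 \<le> G \<omega> x"
  shows "{\<omega> \<in> space M. \<exists>x\<in>K. G \<omega> x = 0} \<in> sets M"
proof -
  obtain D where D: "countable D" "D \<subseteq> K" "K \<subseteq> closure D"
    using separable by blast
  have "(\<exists>x\<in>K. G \<omega> x = 0) \<longleftrightarrow> (\<forall>i. \<exists>x\<in>D. G \<omega> x < inverse (real (Suc i)))" if \<omega>: "\<omega> \<in> space M" for \<omega>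
  proof
    assume "\<exists>x\<in>K. G \<omega> x = 0"
    then obtain x where x: "x \<in> K" "G \<omega> x = 0" by blast
    show "\<forall>i. \<exists>x\<in>D. G \<omega> x < inverse (real (Suc i))"
    proof
      fix i
      obtain d where d: "d > 0" "\<And>y. y \<in> K \<Longrightarrow> dist y x < d \<Longrightarrow> dist (G \<omega> y) (G \<omega> x) < inverse (real (Suc i))"
        using cont[OF \<omega>] x(1) unfolding continuous_on_iff by (metis inverse_positive_iff_positive of_nat_0_less_iff zero_less_Suc)
      obtain y where y: "y \<in> D" "dist y x < d"
        using D(3) x(1) d(1) by (meson closure_approachable subsetD)
      then show "\<exists>x\<in>D. G \<omega> x < inverse (real (Suc i))"
        using d(2)[OF subsetD[OF D(2)], of y] x(2) by (auto simp: dist_real_def intro!: bexI[of _ y])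
    qed
  next
    \<comment> \<open>By compactness the infimum over \<open>K\<close> is attained, so values on
      \<open>D\<close> below every 1/(i+1) force the minimum to be 0.\<close>
    assume *: "\<forall>i. \<exists>x\<in>D. G \<omega> x < inverse (real (Suc i))"
    then have "K \<noteq> {}" using D(2) by auto
    then obtain y where y: "y \<in> K" "\<And>x. x \<in> K \<Longrightarrow> G \<omega> y \<le> G \<omega> x"
      using continuous_attains_inf[OF K _ cont[OF \<omega>]] by blast
    have "\<not> 0 < G \<omega> y"
    proof
      assume "0 < G \<omega> y"
      then obtain i where "inverse (real (Suc i)) < G \<omega> y" using reals_Archimedean by blast
      moreover obtain x where "x \<in> D" "G \<omega> x < inverse (real (Suc i))" using * by blast
      ultimately show False using y(2)[of x] D(2) by force
    qed
    then show "\<exists>x\<in>K. G \<omega> x = 0" using nonneg[of \<omega> y] y(1) by (auto simp: not_less intro!: bexI[of _ y])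
  qed
  then have "{\<omega> \<in> space M. \<exists>x\<in>K. G \<omega> x = 0} = {\<omega> \<in> space M. \<forall>i. \<exists>x\<in>D. G \<omega> x < inverse (real (Suc i))}"
    by blast
  also have "\<dots> \<in> sets M" using D(1) by measurable
  finally show ?thesis .
qed

text \<open>A nonnegative function, continuous in \<open>x\<close>, whose zeros are the solutions
  with denominators at least \<open>c\<close>.\<close>
definition zeta_gap :: "real \<Rightarrow> nat \<Rightarrow> nat \<Rightarrow> (nat \<Rightarrow> 'z \<Rightarrow> real) \<Rightarrow> (nat \<Rightarrow> 'a \<Rightarrow> 'z) \<Rightarrow> 'a \<Rightarrow> (nat \<Rightarrow> real) \<Rightarrow> real" where
  "zeta_gap c n m u Z \<omega> x =
     (\<Sum>k<m. \<bar>\<Sum>j<n. u k (Z j \<omega>) / max c (1 + dotm m u (Z j \<omega>) x)\<bar>)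
     + (\<Sum>j<n. max 0 (c - (1 + dotm m u (Z j \<omega>) x)))"

text \<open>The second sum forces all denominators to be at least \<open>c\<close>, where the
  truncation by \<open>max\<close> in the first sum is inactive.\<close>

lemma zeta_gap_eq_0_iff:
  assumes "0 < c"
  shows "zeta_gap c n m u Z \<omega> x = 0 \<longleftrightarrow>
    (\<forall>j<n. c \<le> 1 + dotm m u (Z j \<omega>) x) \<and> (\<forall>k<m. (\<Sum>j<n. u k (Z j \<omega>) / (1 + dotm m u (Z j \<omega>) x)) = 0)"
proof -
  have "zeta_gap c n m u Z \<omega> x = 0 \<longleftrightarrow>
      (\<forall>k<m. (\<Sum>j<n. u k (Z j \<omega>) / max c (1 + dotm m u (Z j \<omega>) x)) = 0)
      \<and> (\<forall>j<n. max 0 (c - (1 + dotm m u (Z j \<omega>) x)) = 0)"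
    unfolding zeta_gap_def
    by (subst add_nonneg_eq_0_iff) (auto simp: sum_nonneg sum_nonneg_eq_0_iff)
  moreover have "(\<forall>j<n. max 0 (c - (1 + dotm m u (Z j \<omega>) x)) = 0) \<longleftrightarrow> (\<forall>j<n. c \<le> 1 + dotm m u (Z j \<omega>) x)"
    by (simp add: max_def) force
  moreover have "(\<Sum>j<n. u k (Z j \<omega>) / max c (1 + dotm m u (Z j \<omega>) x))
      = (\<Sum>j<n. u k (Z j \<omega>) / (1 + dotm m u (Z j \<omega>) x))" if "\<forall>j<n. c \<le> 1 + dotm m u (Z j \<omega>) x" for k
    using that by (intro sum.cong) (auto simp: max_absorb2)
  ultimately show ?thesis by auto
qed

text \<open>Finitely many positive denominators have a positive minimum, and the norm is finite, so
  one integer \<open>N\<close> controls both. The solution set thus becomes a countable union of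
  zero sets of continuous functions on compact balls.\<close>

lemma zeta_eq_iff_zeta_gap:
  "zeta_eq n m u Z \<omega> x \<longleftrightarrow>
    (\<exists>N. x \<in> vball m (real N) \<and> zeta_gap (inverse (real (Suc N))) n m u Z \<omega> x = 0)" (is "?L \<longleftrightarrow> ?R")
proof
  assume ?R
  then obtain N where N: "x \<in> vball m (real N)" "\<forall>j<n. inverse (real (Suc N)) \<le> 1 + dotm m u (Z j \<omega>) x"
    "\<forall>k<m. (\<Sum>j<n. u k (Z j \<omega>) / (1 + dotm m u (Z j \<omega>) x)) = 0"
    by (subst (asm) zeta_gap_eq_0_iff) auto
  moreover from N(2) have "\<forall>j<n. 0 < 1 + dotm m u (Z j \<omega>) x"
    by (metis inverse_positive_iff_positive less_le_trans of_nat_0_less_iff zero_less_Suc)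
  ultimately show ?L unfolding zeta_eq_def vball_def by auto
next
  assume L: ?L
  \<comment> \<open>Inserting 1 keeps the minimum defined when \<open>n = 0\<close>.\<close>
  define g where "g = Min (insert 1 ((\<lambda>j. 1 + dotm m u (Z j \<omega>) x) ` {..<n}))"
  have "0 < g" using L unfolding g_def by (subst Min_gr_iff) (auto simp: zeta_eq_def)
  then obtain N1 where N1: "inverse (real (Suc N1)) < g" using reals_Archimedean by blast
  obtain N2 :: nat where N2: "(\<Sum>k<m. (x k)\<^sup>2) \<le> real N2" using real_arch_simple by blast
  define N where "N = max N1 N2"
  have "x \<in> vball m (real N)"
  proof -
    have "real N2 \<le> (real N)\<^sup>2"
      using self_le_power[of "real N" 2] by (cases "N = 0") (auto simp: N_def)
    then have "(\<Sum>k<m. (x k)\<^sup>2) \<le> (real N)\<^sup>2" using N2 by linarith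
    then show ?thesis using L by (simp add: vball_def zeta_eq_def)
  qed
  moreover have "inverse (real (Suc N)) \<le> 1 + dotm m u (Z j \<omega>) x" if "j < n" for j
  proof -
    have "inverse (real (Suc N)) \<le> inverse (real (Suc N1))" by (simp add: N_def)
    also have "\<dots> \<le> g" using N1 by simp
    also have "g \<le> 1 + dotm m u (Z j \<omega>) x" unfolding g_def using that by (intro Min_le) auto
    finally show ?thesis .
  qed
  moreover have "(\<Sum>j<n. u k (Z j \<omega>) / (1 + dotm m u (Z j \<omega>) x)) = 0" if "k < m" for k
    using L that by (cases "n = 0") (auto simp: zeta_eq_def)
  ultimately have "x \<in> vball m (real N) \<and> zeta_gap (inverse (real (Suc N))) n m u Z \<omega> x = 0"
    by (subst zeta_gap_eq_0_iff) auto
  then show ?R ..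
qed

section \<open>Measurability of the unique solution\<close>

context
  fixes M :: "'a measure" and u :: "nat \<Rightarrow> 'z \<Rightarrow> real" and Z :: "nat \<Rightarrow> 'a \<Rightarrow> 'z"
  assumes uZ [measurable]: "\<And>k j. (\<lambda>\<omega>. u k (Z j \<omega>)) \<in> borel_measurable M"
begin

text \<open>The closed set \<open>C\<close> allows single coordinates of a solution to be tested
  through half-spaces, which both uniqueness and the coordinate functions require.\<close>

lemma sets_zeta_eq_closed:
  assumes C: "closed C"
  shows "{\<omega> \<in> space M. \<exists>x\<in>C. zeta_eq n m u Z \<omega> x} \<in> sets M"
proof -
  have "{\<omega> \<in> space M. \<exists>x\<in>C. zeta_eq n m u Z \<omega> x} =
      (\<Union>N. {\<omega> \<in> space M. \<exists>x\<in>C \<inter> vball m (real N). zeta_gap (inverse (real (Suc N))) n m u Z \<omega> x = 0})"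
    unfolding zeta_eq_iff_zeta_gap by blast
  also have "\<dots> \<in> sets M"
  proof (intro sets.countable_UN image_subsetI sets_ex_zero_compact)
    fix N \<omega> x
    show "compact (C \<inter> vball m (real N))"
      by (intro closed_Int_compact C compact_vball) simp
    show "0 \<le> zeta_gap (inverse (real (Suc N))) n m u Z \<omega> x"
      by (simp add: zeta_gap_def sum_nonneg)
    show "(\<lambda>\<omega>. zeta_gap (inverse (real (Suc N))) n m u Z \<omega> x) \<in> borel_measurable M"
      unfolding zeta_gap_def dotm_def by measurable
    have "max (inverse (real (Suc N))) y \<noteq> 0" for y
      using less_le_trans[of 0 "inverse (real (Suc N))" "max (inverse (real (Suc N))) y"] by fastforce
    then show "continuous_on (C \<inter> vball m (real N)) (zeta_gap (inverse (real (Suc N))) n m u Z \<omega>)"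
      unfolding zeta_gap_def dotm_def by (auto intro!: continuous_intros)
  qed
  finally show ?thesis .
qed

text \<open>Two distinct solutions differ in some coordinate, where two rationals separate them.
  Uniqueness is therefore existence minus a countable union of events, each demanding a solution in
  both of two disjoint half-spaces.\<close>

lemma sets_ex1_zeta_eq [measurable]: "{\<omega> \<in> space M. \<exists>!x. zeta_eq n m u Z \<omega> x} \<in> sets M"
proof -
  let ?S = "\<lambda>C. {\<omega> \<in> space M. \<exists>x\<in>C. zeta_eq n m u Z \<omega> x}"
  have two: "x = y" if xy: "zeta_eq n m u Z \<omega> x" "zeta_eq n m u Z \<omega> y" and "\<omega> \<in> space M"
    and *: "\<omega> \<notin> (\<Union>(k, q, r) \<in> {(k, q, r). q < r}. ?S {x. x k \<le> of_rat q} \<inter> ?S {x. of_rat r \<le> x k})" for x y \<omega>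
  proof -
    have "\<not> v k < w k" if vw: "zeta_eq n m u Z \<omega> v" "zeta_eq n m u Z \<omega> w" for v w k
    proof
      assume "v k < w k"
      then obtain q where q: "v k < of_rat q" "of_rat q < w k" using of_rat_dense by blast
      then obtain r where "of_rat q < (of_rat r :: real)" "of_rat r < w k" using of_rat_dense by blast
      then have "q < r" "of_rat r \<le> w k" by (auto simp: of_rat_less)
      then have "\<omega> \<in> (\<Union>(k, q, r) \<in> {(k, q, r). q < r}. ?S {x. x k \<le> of_rat q} \<inter> ?S {x. of_rat r \<le> x k})"
        using q vw \<open>\<omega> \<in> space M\<close>
        by (intro UN_I[of "(k, q, r)"]) (auto intro: less_imp_le)
      then show False using *(1) by blast
    qed
    then show "x = y" using xy by (meson ext linorder_neqE_linordered_idom)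
  qed
  have one: False if S: "\<omega> \<in> ?S {x. x k \<le> of_rat q}" "\<omega> \<in> ?S {x. of_rat r \<le> x k}" "q < r"
    and ex1: "\<exists>!x. zeta_eq n m u Z \<omega> x" for \<omega> k q r
  proof -
    obtain x y where "zeta_eq n m u Z \<omega> x" "x k \<le> of_rat q" "zeta_eq n m u Z \<omega> y" "of_rat r \<le> y k"
      using S(1,2) by blast
    moreover from this have "x = y" using ex1 by blast
    ultimately have "of_rat r \<le> x k" "x k \<le> (of_rat q :: real)" by simp_all
    then have "of_rat r \<le> (of_rat q :: real)" by (rule order_trans)
    then show False using \<open>q < r\<close> by (simp add: of_rat_less_eq)
  qed
  have "{\<omega> \<in> space M. \<exists>!x. zeta_eq n m u Z \<omega> x} =
      ?S UNIV - (\<Union>(k, q, r) \<in> {(k, q, r). q < r}. ?S {x. x k \<le> of_rat q} \<inter> ?S {x. of_rat r \<le> x k})" (is "?L = ?R")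
  proof (intro equalityI subsetI)
    fix \<omega> assume "\<omega> \<in> ?L"
    then show "\<omega> \<in> ?R" using one by blast
  next
    fix \<omega> assume \<omega>: "\<omega> \<in> ?R"
    then obtain x where "zeta_eq n m u Z \<omega> x" "\<omega> \<in> space M" by blast
    then show "\<omega> \<in> ?L" using two \<omega> by blast
  qed
  also have "\<dots> \<in> sets M"
  proof (rule sets.Diff[OF sets_zeta_eq_closed sets.countable_UN''])
    fix p :: "nat \<times> rat \<times> rat"
    obtain k q r where p: "p = (k, q, r)" by (cases p)
    have "?S {x. x k \<le> of_rat q} \<inter> ?S {x. of_rat r \<le> x k} \<in> sets M"
      by (intro sets.Int sets_zeta_eq_closed closed_Collect_le continuous_intros)
    then show "(case p of (k, q, r) \<Rightarrow> ?S {x. x k \<le> of_rat q} \<inter> ?S {x. of_rat r \<le> x k}) \<in> sets M"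
      by (simp only: p prod.case)
  qed auto
  finally show ?thesis .
qed

text \<open>Given uniqueness, the coordinate is at most \<open>q\<close> iff the half-space contains
  some solution, a measurable event; elsewhere the function is 0, hence the distinction on the sign
  of \<open>q\<close>.\<close>

lemma measurable_THE_zeta_eq:
  "(\<lambda>\<omega>. if \<exists>!x. zeta_eq n m u Z \<omega> x then (THE x. zeta_eq n m u Z \<omega> x) k else 0) \<in> borel_measurable M"
    (is "?f \<in> _")
proof (rule borel_measurableI_le)
  fix q
  have "{\<omega> \<in> space M. ?f \<omega> \<le> q} =
      {\<omega> \<in> space M. \<exists>!x. zeta_eq n m u Z \<omega> x} \<inter> {\<omega> \<in> space M. \<exists>x\<in>{x. x k \<le> q}. zeta_eq n m u Z \<omega> x}
      \<union> (if 0 \<le> q then space M - {\<omega> \<in> space M. \<exists>!x. zeta_eq n m u Z \<omega> x} else {})"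
    (is "?L = ?R")
  proof (intro set_eqI)
    fix \<omega>
    show "\<omega> \<in> ?L \<longleftrightarrow> \<omega> \<in> ?R"
    proof (cases "\<exists>!x. zeta_eq n m u Z \<omega> x")
      case True
      then obtain x where x: "zeta_eq n m u Z \<omega> x" "\<And>y. zeta_eq n m u Z \<omega> y \<Longrightarrow> y = x" by blast
      have The: "(THE x. zeta_eq n m u Z \<omega> x) = x" by (rule the_equality) (fact x)+
      have "(\<exists>x\<in>{x. x k \<le> q}. zeta_eq n m u Z \<omega> x) \<longleftrightarrow> x k \<le> q" using x by blast
      then have "\<omega> \<in> ?R \<longleftrightarrow> \<omega> \<in> space M \<and> x k \<le> q" using True by (simp del: bex_simps)
      then show ?thesis using True by (simp add: The)
    qed simp
  qed
  also have "\<dots> \<in> sets M"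
    by (intro sets.Un sets.Int sets_zeta_eq_closed sets_ex1_zeta_eq closed_Collect_le continuous_intros)
      (simp add: sets.compl_sets[OF sets_ex1_zeta_eq])
  finally show "{\<omega> \<in> space M. ?f \<omega> \<le> q} \<in> sets M" .
qed

lemma measurable_theta_tilde:
  fixes \<psi> :: "'z \<Rightarrow> real^'r"
  assumes [measurable]: "\<And>j. (\<lambda>\<omega>. \<psi> (Z j \<omega>)) \<in> borel_measurable M"
  shows "theta_tilde n m u \<psi> Z \<in> borel_measurable M"
proof -
  let ?z = "\<lambda>\<omega> k. if \<exists>!x. zeta_eq n m u Z \<omega> x then (THE x. zeta_eq n m u Z \<omega> x) k else 0"
  have "theta_tilde n m u \<psi> Z = (\<lambda>\<omega>. if \<exists>!x. zeta_eq n m u Z \<omega> x then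
      (1 / real n) *\<^sub>R (\<Sum>j<n. (1 / (1 + (\<Sum>k<m. u k (Z j \<omega>) * ?z \<omega> k))) *\<^sub>R \<psi> (Z j \<omega>)) else 0)"
    by (auto simp: theta_tilde_def dotm_def Let_def fun_eq_iff)
  also have "\<dots> \<in> borel_measurable M"
    by (intro measurable_If sets_ex1_zeta_eq borel_measurable_scaleR borel_measurable_const
        borel_measurable_sum borel_measurable_divide borel_measurable_add borel_measurable_times
        measurable_THE_zeta_eq assms uZ)
  finally show ?thesis .
qed

end


section \<open>Expansion of the weighted mean on good samples\<close>

text \<open>Homogeneity reduces the claim to unit vectors, where it is the defining supremum. A
  supremum of reals is informative only for a bounded set; row-wise Cauchy-Schwarz supplies the
  bound.\<close>

lemma L2_set_le_mat_opnorm: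
  "L2_set (\<lambda>i. \<Sum>k<m. A i k * a k) {..<m} \<le> mat_opnorm m A * L2_set a {..<m}"
proof -
  define S where "S = {sqrt (\<Sum>i<m. (\<Sum>k<m. A i k * a k)\<^sup>2) | a. (\<Sum>k<m. (a k)\<^sup>2) = 1}"
  have bdd: "bdd_above S"
  proof (rule bdd_aboveI)
    fix s assume "s \<in> S"
    then obtain a where a: "s = sqrt (\<Sum>i<m. (\<Sum>k<m. A i k * a k)\<^sup>2)" "(\<Sum>k<m. (a k)\<^sup>2) = 1"
      unfolding S_def by blast
    have "(\<Sum>k<m. A i k * a k)\<^sup>2 \<le> (L2_set (A i) {..<m})\<^sup>2" for i
      using abs_sum_mult_le_L2_set[of "A i" a "{..<m}"] a(2)
      by (subst abs_le_square_iff[symmetric]) (simp add: L2_set_def)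
    then show "s \<le> sqrt (\<Sum>i<m. (L2_set (A i) {..<m})\<^sup>2)"
      unfolding a(1) by (intro real_sqrt_le_mono sum_mono)
  qed
  show ?thesis
  proof (cases "L2_set a {..<m} = 0")
    case True
    then have "\<forall>k<m. a k = 0" by (simp add: L2_set_eq_0_iff)
    then show ?thesis by (simp add: L2_set_def)
  next
    case False
    define r where "r = L2_set a {..<m}"
    have r: "r > 0" using False by (simp add: r_def less_le)
    have "(\<Sum>k<m. (a k / r)\<^sup>2) = (\<Sum>k<m. (a k)\<^sup>2) / r\<^sup>2"
      by (simp add: power_divide sum_divide_distrib)
    also have "\<dots> = 1" using r by (simp add: r_def L2_set_squared[symmetric])
    finally have "L2_set (\<lambda>i. \<Sum>k<m. A i k * (a k / r)) {..<m} \<in> S"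
      unfolding S_def L2_set_def by (intro CollectI exI[of _ "\<lambda>k. a k / r"]) simp
    then have "L2_set (\<lambda>i. \<Sum>k<m. A i k * (a k / r)) {..<m} \<le> mat_opnorm m A"
      unfolding mat_opnorm_def S_def[symmetric] by (rule cSup_upper[OF _ bdd])
    moreover have "L2_set (\<lambda>i. \<Sum>k<m. A i k * a k) {..<m} = r * L2_set (\<lambda>i. \<Sum>k<m. A i k * (a k / r)) {..<m}"
      using r by (subst L2_set_right_distrib) (auto simp: sum_distrib_left)
    ultimately show ?thesis
      using r by (simp add: r_def mult.commute mult_left_mono)
  qed
qed

lemma mean_dotm:
  "(1 / real n) * (\<Sum>j<n. f j * dotm m u (z j) x) = (\<Sum>k<m. ((1 / real n) * (\<Sum>j<n. f j * u k (z j))) * x k)"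
  unfolding sum_dotm by (subst sum_distrib_left) (simp only: mult.assoc)

text \<open>Since the weights annihilate \<open>u\<close>, \<open>p\<close> may be replaced by its regression residual
  \<open>p - u \<bullet> b\<close>, which is nearly uncorrelated with \<open>u\<close>; the linear term in \<open>\<zeta>\<close> is then negligible.\<close>
lemma weighted_mean_expansion:
  fixes p :: "'z \<Rightarrow> real" and b :: "nat \<Rightarrow> real"
  assumes n: "0 < n" and z: "zeta_eq n m u Z \<omega> \<zeta>" and R: "\<zeta> \<in> vball m R" "0 \<le> R"
    and h: "\<And>j. j < n \<Longrightarrow> vnorm m u (Z j \<omega>) * R \<le> h" "h \<le> 1/2"
  defines "q \<equiv> \<lambda>j. p (Z j \<omega>) - dotm m u (Z j \<omega>) b"
  shows "\<bar>(1 / real n) * (\<Sum>j<n. p (Z j \<omega>) / (1 + dotm m u (Z j \<omega>) \<zeta>)) - (1 / real n) * (\<Sum>j<n. q j)\<bar>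
    \<le> L2_set (\<lambda>k. (1 / real n) * (\<Sum>j<n. q j * u k (Z j \<omega>))) {..<m} * R
      + 2 * h * (L2_set q {..<n} * L2_set (\<lambda>j. dotm m u (Z j \<omega>) \<zeta>) {..<n}) / real n"
proof -
  let ?d = "\<lambda>j. dotm m u (Z j \<omega>) \<zeta>"
  have d: "\<bar>?d j\<bar> \<le> h" if "j < n" for j
  proof -
    have "\<bar>?d j\<bar> \<le> vnorm m u (Z j \<omega>) * L2_set \<zeta> {..<m}" by (rule dotm_le)
    also have "\<dots> \<le> vnorm m u (Z j \<omega>) * R"
      using vball_L2_set[OF R] by (intro mult_left_mono) (auto simp: vnorm_def sum_nonneg)
    finally show ?thesis using h(1)[OF that] by simp
  qed
  have "(\<Sum>j<n. dotm m u (Z j \<omega>) b / (1 + ?d j)) = (\<Sum>k<m. (\<Sum>j<n. u k (Z j \<omega>) / (1 + ?d j)) * b k)"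
    using sum_dotm[of "\<lambda>j. 1 / (1 + ?d j)" m u "\<lambda>j. Z j \<omega>" b n] by simp
  also have "\<dots> = 0" using z n by (intro sum.neutral) (auto simp: zeta_eq_def)
  finally have "(\<Sum>j<n. p (Z j \<omega>) / (1 + ?d j)) = (\<Sum>j<n. q j / (1 + ?d j))"
    by (simp add: q_def diff_divide_distrib sum_subtractf)
  also have "\<dots> = (\<Sum>j<n. q j - q j * ?d j + q j * (?d j)\<^sup>2 / (1 + ?d j))"
  proof (rule sum.cong)
    fix j assume "j \<in> {..<n}"
    then have "0 < 1 + ?d j" using z by (simp add: zeta_eq_def)
    then show "q j / (1 + ?d j) = q j - q j * ?d j + q j * (?d j)\<^sup>2 / (1 + ?d j)"
      by (simp add: divide_simps) (simp add: algebra_simps power2_eq_square)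
  qed simp
  finally have "(\<Sum>j<n. p (Z j \<omega>) / (1 + ?d j)) - (\<Sum>j<n. q j)
      = - (\<Sum>j<n. q j * ?d j) + (\<Sum>j<n. q j * (?d j)\<^sup>2 / (1 + ?d j))"
    by (simp add: sum.distrib sum_subtractf)
  then have "(1 / real n) * (\<Sum>j<n. p (Z j \<omega>) / (1 + ?d j)) - (1 / real n) * (\<Sum>j<n. q j)
      = (- (\<Sum>j<n. q j * ?d j) + (\<Sum>j<n. q j * (?d j)\<^sup>2 / (1 + ?d j))) / real n"
    by (simp add: diff_divide_distrib[symmetric])
  then have "\<bar>(1 / real n) * (\<Sum>j<n. p (Z j \<omega>) / (1 + ?d j)) - (1 / real n) * (\<Sum>j<n. q j)\<bar>
      \<le> \<bar>(\<Sum>j<n. q j * ?d j) / real n\<bar> + \<bar>\<Sum>j<n. q j * (?d j)\<^sup>2 / (1 + ?d j)\<bar> / real n"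
    using abs_triangle_ineq[of "- (\<Sum>j<n. q j * ?d j) / real n" "(\<Sum>j<n. q j * (?d j)\<^sup>2 / (1 + ?d j)) / real n"]
    by (simp only: add_divide_distrib abs_divide abs_of_nat minus_divide_left[symmetric] abs_minus_cancel)
  also have "(\<Sum>j<n. q j * ?d j) / real n = (\<Sum>k<m. (1 / real n) * (\<Sum>j<n. q j * u k (Z j \<omega>)) * \<zeta> k)"
    using mean_dotm[of n q m u "\<lambda>j. Z j \<omega>" \<zeta>] by simp
  also have "\<bar>\<dots>\<bar> \<le> L2_set (\<lambda>k. (1 / real n) * (\<Sum>j<n. q j * u k (Z j \<omega>))) {..<m} * L2_set \<zeta> {..<m}"
    by (rule abs_sum_mult_le_L2_set)
  also have "\<dots> \<le> L2_set (\<lambda>k. (1 / real n) * (\<Sum>j<n. q j * u k (Z j \<omega>))) {..<m} * R"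
    using vball_L2_set[OF R] by (intro mult_left_mono) auto
  also have "\<bar>\<Sum>j<n. q j * (?d j)\<^sup>2 / (1 + ?d j)\<bar> \<le> 2 * h * (L2_set q {..<n} * L2_set ?d {..<n})"
  proof -
    \<comment> \<open>Only one factor |d_j| is traded for \<open>h\<close>, the denominator costing
      a factor 2; the other is kept for Cauchy-Schwarz against \<open>q\<close>.\<close>
    have "\<bar>q j * (?d j)\<^sup>2 / (1 + ?d j)\<bar> \<le> 2 * h * (\<bar>q j\<bar> * \<bar>?d j\<bar>)" if "j < n" for j
    proof -
      have 1: "1 / 2 \<le> 1 + ?d j" using d[OF that] h(2) by linarith
      have "\<bar>q j * (?d j)\<^sup>2 / (1 + ?d j)\<bar> = (\<bar>q j\<bar> * \<bar>?d j\<bar>) * (\<bar>?d j\<bar> / (1 + ?d j))"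
        using 1 by (simp add: abs_mult power2_eq_square)
      also have "\<dots> \<le> (\<bar>q j\<bar> * \<bar>?d j\<bar>) * (h / (1 / 2))"
        using 1 d[OF that] by (intro mult_left_mono frac_le) auto
      finally show ?thesis by (simp add: mult_ac)
    qed
    then have "\<bar>\<Sum>j<n. q j * (?d j)\<^sup>2 / (1 + ?d j)\<bar> \<le> (\<Sum>j<n. 2 * h * (\<bar>q j\<bar> * \<bar>?d j\<bar>))"
      by (intro order_trans[OF sum_abs] sum_mono) simp
    also have "\<dots> = 2 * h * (\<Sum>j<n. \<bar>q j\<bar> * \<bar>?d j\<bar>)" by (simp add: sum_distrib_left)
    also have "\<dots> \<le> 2 * h * (L2_set q {..<n} * L2_set ?d {..<n})"
      using d[of 0] n by (intro mult_left_mono L2_set_mult_ineq) auto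
    finally show ?thesis .
  qed
  finally show ?thesis using n by (simp add: divide_right_mono)
qed

text \<open>The deterministic side of the argument: one sample point at which the random conditions
  hold. \<open>T\<close> bounds the random sums, \<open>K\<close> scales the search radius
  \<open>rad\<close>, and \<open>\<delta>\<close> is the small factor in (i) and (ii). The numerical
  links are what \<open>zeta_eq_exists\<close> asks for with Gram constant \<open>c / 2\<close>:
  \<open>\<delta> \<le> c / 2\<close> secures that constant, \<open>\<delta> * K \<le> 1 / 2\<close>
  keeps |u . x| at most 1/2, and \<open>T < c * K / 16\<close> puts the mean of \<open>u\<close>
  below \<open>(c / 2) * rad / 8\<close>.\<close>

locale good_sample =
  fixes n m :: nat and u :: "nat \<Rightarrow> 'z \<Rightarrow> real" and Z :: "nat \<Rightarrow> 'a \<Rightarrow> 'z" and \<omega> :: 'a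
    and w :: "nat \<Rightarrow> nat \<Rightarrow> real" and c C T \<delta> K :: real
  assumes n: "0 < n" and m: "0 < m" and c: "0 < c"
    and w_low: "\<And>a. c * (\<Sum>k<m. (a k)\<^sup>2) \<le> (\<Sum>i<m. \<Sum>k<m. a i * w i k * a k)"
    and w_up: "\<And>a. (\<Sum>i<m. \<Sum>k<m. a i * w i k * a k) \<le> C * (\<Sum>k<m. (a k)\<^sup>2)"
    and T: "0 \<le> T" and \<delta>: "0 < \<delta>" "\<delta> \<le> c / 2" "\<delta> * K \<le> 1 / 2"
    and K: "T < c * K / 16"
    and umax: "\<And>j. j < n \<Longrightarrow> vnorm m u (Z j \<omega>) \<le> \<delta> * (real m powr (-3/2) * sqrt (real n))"
    and op: "mat_opnorm m (\<lambda>k l. (1 / real n) * (\<Sum>j<n. u k (Z j \<omega>) * u l (Z j \<omega>)) - w k l) \<le> \<delta> / real m"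
    and ubar: "(\<Sum>k<m. ((1 / real n) * (\<Sum>j<n. u k (Z j \<omega>)))\<^sup>2) \<le> T\<^sup>2 * (real m / real n)"
begin

abbreviation "d x j \<equiv> dotm m u (Z j \<omega>) x"

definition "err k l = (1 / real n) * (\<Sum>j<n. u k (Z j \<omega>) * u l (Z j \<omega>)) - w k l"

definition "rad = K * sqrt (real m / real n)"

lemma K_pos: "0 < K"
  using T K c by (smt (verit) mult_nonneg_nonpos divide_nonpos_pos)

lemma rad_pos: "0 < rad"
  using K_pos n m by (simp add: rad_def)

lemma err_le: "L2_set (\<lambda>k. \<Sum>l<m. err k l * x l) {..<m} \<le> \<delta> / real m * L2_set x {..<m}"
  unfolding err_def by (rule order_trans[OF L2_set_le_mat_opnorm mult_right_mono[OF op]]) simp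

lemma gram_eq:
  "(1 / real n) * (\<Sum>j<n. (d x j)\<^sup>2) =
    (\<Sum>k<m. \<Sum>l<m. x k * w k l * x l) + (\<Sum>k<m. x k * (\<Sum>l<m. err k l * x l))"
proof -
  have "(1 / real n) * (\<Sum>j<n. (d x j)\<^sup>2) = (\<Sum>k<m. ((1 / real n) * (\<Sum>j<n. d x j * u k (Z j \<omega>))) * x k)"
    using mean_dotm[of n "d x" m u "\<lambda>j. Z j \<omega>" x] by (simp only: power2_eq_square)
  also have "\<dots> = (\<Sum>k<m. x k * (\<Sum>l<m. ((1 / real n) * (\<Sum>j<n. u k (Z j \<omega>) * u l (Z j \<omega>))) * x l))"
    using mean_dotm[of n "\<lambda>j. u _ (Z j \<omega>)" m u "\<lambda>j. Z j \<omega>" x] by (simp only: mult.commute)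
  also have "\<dots> = (\<Sum>k<m. x k * (\<Sum>l<m. (w k l + err k l) * x l))"
    by (simp add: err_def)
  finally show ?thesis
    by (simp add: distrib_right distrib_left sum.distrib sum_distrib_left mult.assoc)
qed

lemma err_form_le: "\<bar>\<Sum>k<m. x k * (\<Sum>l<m. err k l * x l)\<bar> \<le> c / 2 * (\<Sum>k<m. (x k)\<^sup>2)"
proof -
  have "\<bar>\<Sum>k<m. x k * (\<Sum>l<m. err k l * x l)\<bar> \<le> L2_set x {..<m} * L2_set (\<lambda>k. \<Sum>l<m. err k l * x l) {..<m}"
    by (rule abs_sum_mult_le_L2_set)
  also have "\<dots> \<le> L2_set x {..<m} * (\<delta> / real m * L2_set x {..<m})"
    by (intro mult_left_mono err_le) simp
  also have "\<dots> = \<delta> / real m * (\<Sum>k<m. (x k)\<^sup>2)"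
    unfolding L2_set_squared[symmetric] by (simp add: power2_eq_square)
  also have "\<dots> \<le> c / 2 * (\<Sum>k<m. (x k)\<^sup>2)"
  proof (intro mult_right_mono)
    have "\<delta> / real m \<le> \<delta>" using \<delta>(1) m by (simp add: divide_le_eq)
    then show "\<delta> / real m \<le> c / 2" using \<delta>(2) by linarith
  qed (simp add: sum_nonneg)
  finally show ?thesis .
qed

text \<open>The error of the empirical Gram matrix costs at most half of the lower bound
  \<open>c\<close> on \<open>w\<close>.\<close>

lemma gram_low: "c / 2 * (\<Sum>k<m. (x k)\<^sup>2) \<le> (1 / real n) * (\<Sum>j<n. (d x j)\<^sup>2)"
  using w_low[of x] err_form_le[of x] unfolding gram_eq by (simp add: abs_le_iff)

lemma L2_set_d_le: "L2_set (d x) {..<n} \<le> sqrt (real n) * (sqrt (2 * C) * L2_set x {..<m})"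
proof -
  \<comment> \<open>The two bounds on \<open>w\<close> compare \<open>c\<close> with
    \<open>C\<close>, so a Gram error of size \<open>c / 2\<close> is absorbed by doubling
    \<open>C\<close>.\<close>
  have "c / 2 * (\<Sum>k<m. (x k)\<^sup>2) \<le> C * (\<Sum>k<m. (x k)\<^sup>2)"
  proof -
    have "c / 2 * (\<Sum>k<m. (x k)\<^sup>2) \<le> c * (\<Sum>k<m. (x k)\<^sup>2)"
      using c by (intro mult_right_mono sum_nonneg) auto
    then show ?thesis using w_low[of x] w_up[of x] by linarith
  qed
  then have "(1 / real n) * (\<Sum>j<n. (d x j)\<^sup>2) \<le> 2 * C * (\<Sum>k<m. (x k)\<^sup>2)"
    using w_up[of x] err_form_le[of x] unfolding gram_eq by (simp add: abs_le_iff)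
  then have "(\<Sum>j<n. (d x j)\<^sup>2) \<le> real n * (2 * C * (\<Sum>k<m. (x k)\<^sup>2))"
    using n by (simp add: field_simps)
  then have "L2_set (d x) {..<n} \<le> sqrt (real n * (2 * C * (\<Sum>k<m. (x k)\<^sup>2)))"
    unfolding L2_set_def by (rule real_sqrt_le_mono)
  then show ?thesis by (simp add: real_sqrt_mult L2_set_def)
qed

lemma sqrt_m: "sqrt (real m) / real m \<le> 1"
  using m by (simp add: real_le_lsqrt power2_eq_square)

text \<open>Here the exponent -3/2 is spent: times the radius \<open>K * sqrt (m / n)\<close> it
  leaves \<open>1 / m\<close>, which absorbs the factor \<open>sqrt m\<close> that
  \<open>\<zeta>\<close> brings into the quadratic remainder.\<close>

lemma umax_rad: "j < n \<Longrightarrow> vnorm m u (Z j \<omega>) * rad \<le> \<delta> * K / real m"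
proof -
  assume "j < n"
  then have "vnorm m u (Z j \<omega>) * rad \<le> \<delta> * (real m powr (-3/2) * sqrt (real n)) * rad"
    using umax rad_pos by (intro mult_right_mono) auto
  also have "\<dots> = \<delta> * K * (real m powr (-3/2) * sqrt (real m))"
    using n by (simp add: rad_def real_sqrt_divide)
  also have "real m powr (-3/2) * sqrt (real m) = real m powr (-1)"
    by (simp add: powr_half_sqrt[symmetric] powr_add[symmetric])
  finally show ?thesis using m by (simp add: powr_minus divide_inverse)
qed

lemma delta_K_m: "\<delta> * K / real m \<le> 1 / 2"
proof -
  have "\<delta> * K / real m \<le> \<delta> * K" using \<delta>(1) K_pos m by (simp add: divide_le_eq)
  then show ?thesis using \<delta>(3) by linarith
qed

text \<open>\<open>zeta_eq_exists\<close> finds a solution inside the ball; uniqueness among all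
  solutions then places any given solution in that ball.\<close>

lemma zeta_ex1: "\<exists>!\<zeta>. zeta_eq n m u Z \<omega> \<zeta>"
  and zeta_in_vball: "zeta_eq n m u Z \<omega> \<zeta> \<Longrightarrow> \<zeta> \<in> vball m rad"
proof -
  have c2: "0 < c / 2" using c by simp
  have "sqrt (\<Sum>k<m. ((1 / real n) * (\<Sum>j<n. u k (Z j \<omega>)))\<^sup>2) \<le> sqrt (T\<^sup>2 * (real m / real n))"
    by (rule real_sqrt_le_mono[OF ubar])
  also have "\<dots> = T * sqrt (real m / real n)" using T by (simp only: real_sqrt_mult real_sqrt_abs abs_of_nonneg)
  also have "\<dots> < c * K / 16 * sqrt (real m / real n)"
    using K n m by (intro mult_strict_right_mono) auto
  finally have "L2_set (\<lambda>k. (1 / real n) * (\<Sum>j<n. u k (Z j \<omega>))) {..<m} < c / 2 * rad / 8"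
    by (simp add: L2_set_def rad_def)
  then obtain \<xi> where \<xi>: "zeta_eq n m u Z \<omega> \<xi>" "\<xi> \<in> vball m rad"
    using zeta_eq_exists[of n rad "c / 2" m u Z \<omega>] n rad_pos c2 gram_low order_trans[OF umax_rad delta_K_m]
    by blast
  have uniq: "\<zeta> = \<xi>" if "zeta_eq n m u Z \<omega> \<zeta>" for \<zeta>
    by (rule zeta_eq_unique[of n "c / 2", OF n c2 _ that \<xi>(1)]) (rule gram_low)
  then show "\<exists>!\<zeta>. zeta_eq n m u Z \<omega> \<zeta>" using \<xi>(1) by blast
  show "zeta_eq n m u Z \<omega> \<zeta> \<Longrightarrow> \<zeta> \<in> vball m rad" using uniq \<xi>(2) by blast
qed

text \<open>Because \<open>b\<close> solves \<open>w b = v\<close>, the population moments cancel,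
  and the empirical moments of the residual against \<open>u\<close> reduce to the fluctuation in
  \<open>v\<close> minus the Gram error applied to \<open>b\<close>. Times \<open>rad\<close>, these
  give the first summand of the constant; the quadratic remainder gives the second. Leftover powers
  of \<open>m\<close> are absorbed by \<open>sqrt m / m \<le> 1\<close>, so the constant is free of
  \<open>n\<close> and \<open>m\<close>.\<close>

lemma expansion:
  assumes z: "zeta_eq n m u Z \<omega> \<zeta>"
    and b: "\<And>k. k < m \<Longrightarrow> (\<Sum>l<m. w k l * b l) = v k" "L2_set b {..<m} \<le> \<beta>"
    and v: "L2_set (\<lambda>k. (1 / real n) * (\<Sum>j<n. p (Z j \<omega>) * u k (Z j \<omega>)) - v k) {..<m} \<le> \<delta> / sqrt (real m)"
    and p: "(1 / real n) * (\<Sum>j<n. (p (Z j \<omega>))\<^sup>2) \<le> T\<^sup>2"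
  shows "\<bar>(1 / real n) * (\<Sum>j<n. p (Z j \<omega>) / (1 + d \<zeta> j)) - (1 / real n) * (\<Sum>j<n. p (Z j \<omega>) - d b j)\<bar>
    \<le> \<delta> * (K * (1 + \<beta>) + 2 * K\<^sup>2 * sqrt (2 * C) * (T + sqrt (2 * C) * \<beta>)) / sqrt (real n)"
proof -
  let ?q = "\<lambda>j. p (Z j \<omega>) - d b j"
  have \<beta>: "0 \<le> \<beta>" using b(2) L2_set_nonneg order_trans by blast
  have C: "0 \<le> C"
  proof -
    \<comment> \<open>Both bounds on \<open>w\<close> at the first unit vector, available since
      \<open>0 < m\<close>, give \<open>c \<le> C\<close>.\<close>
    have "(\<Sum>k<m. (if k = 0 then 1 else 0 :: real)\<^sup>2) = 1"
      using m by (simp add: if_distrib[of "\<lambda>z. z\<^sup>2"] sum.delta cong: if_cong)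
    then show ?thesis using w_low[of "\<lambda>k. if k = 0 then 1 else 0"] w_up[of "\<lambda>k. if k = 0 then 1 else 0"] c by simp
  qed
  have "L2_set (\<lambda>k. (1 / real n) * (\<Sum>j<n. ?q j * u k (Z j \<omega>))) {..<m}
      = L2_set (\<lambda>k. ((1 / real n) * (\<Sum>j<n. p (Z j \<omega>) * u k (Z j \<omega>)) - v k) + - (\<Sum>l<m. err k l * b l)) {..<m}"
  proof (rule L2_set_cong)
    fix k assume k: "k \<in> {..<m}"
    have "(1 / real n) * (\<Sum>j<n. d b j * u k (Z j \<omega>)) = (\<Sum>l<m. (w k l + err k l) * b l)"
      using mean_dotm[of n "\<lambda>j. u k (Z j \<omega>)" m u "\<lambda>j. Z j \<omega>" b] by (simp add: err_def mult.commute)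
    also have "\<dots> = v k + (\<Sum>l<m. err k l * b l)"
      using b(1)[of k] k by (simp add: distrib_right sum.distrib)
    finally show "(1 / real n) * (\<Sum>j<n. ?q j * u k (Z j \<omega>))
      = ((1 / real n) * (\<Sum>j<n. p (Z j \<omega>) * u k (Z j \<omega>)) - v k) + - (\<Sum>l<m. err k l * b l)"
      by (simp add: left_diff_distrib sum_subtractf diff_divide_distrib)
  qed simp
  also have "\<dots> \<le> L2_set (\<lambda>k. (1 / real n) * (\<Sum>j<n. p (Z j \<omega>) * u k (Z j \<omega>)) - v k) {..<m}
      + L2_set (\<lambda>k. - (\<Sum>l<m. err k l * b l)) {..<m}"
    by (rule L2_set_triangle_ineq)
  also have "L2_set (\<lambda>k. - (\<Sum>l<m. err k l * b l)) {..<m} = L2_set (\<lambda>k. \<Sum>l<m. err k l * b l) {..<m}"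
    by (simp add: L2_set_def)
  also have "\<dots> \<le> \<delta> / real m * \<beta>"
    using \<delta>(1) by (intro order_trans[OF err_le mult_left_mono[OF b(2)]]) auto
  finally have e: "L2_set (\<lambda>k. (1 / real n) * (\<Sum>j<n. ?q j * u k (Z j \<omega>))) {..<m} \<le> \<delta> / sqrt (real m) + \<delta> / real m * \<beta>"
    using v by linarith
  have "L2_set (\<lambda>k. (1 / real n) * (\<Sum>j<n. ?q j * u k (Z j \<omega>))) {..<m} * rad
      \<le> (\<delta> / sqrt (real m) + \<delta> / real m * \<beta>) * rad"
    using rad_pos by (intro mult_right_mono e) simp
  also have "\<dots> = \<delta> * K * (1 + \<beta> * (sqrt (real m) / real m)) / sqrt (real n)"
    using m n by (simp add: rad_def real_sqrt_divide field_simps)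
  also have "\<dots> \<le> \<delta> * K * (1 + \<beta> * 1) / sqrt (real n)"
    using \<beta> \<delta>(1) K_pos sqrt_m by (intro divide_right_mono mult_left_mono add_left_mono) auto
  finally have 1: "L2_set (\<lambda>k. (1 / real n) * (\<Sum>j<n. ?q j * u k (Z j \<omega>))) {..<m} * rad
      \<le> \<delta> * K * (1 + \<beta>) / sqrt (real n)" by simp
  have "L2_set ?q {..<n} \<le> L2_set (\<lambda>j. p (Z j \<omega>)) {..<n} + L2_set (\<lambda>j. - d b j) {..<n}"
    using L2_set_triangle_ineq[of "\<lambda>j. p (Z j \<omega>)" "\<lambda>j. - d b j" "{..<n}"] by simp
  also have "L2_set (\<lambda>j. - d b j) {..<n} = L2_set (d b) {..<n}" by (simp add: L2_set_def)
  also have "\<dots> \<le> sqrt (real n) * (sqrt (2 * C) * \<beta>)"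
    using C by (intro order_trans[OF L2_set_d_le] mult_left_mono b(2)) auto
  also have "L2_set (\<lambda>j. p (Z j \<omega>)) {..<n} \<le> sqrt (real n) * T"
  proof -
    have "(\<Sum>j<n. (p (Z j \<omega>))\<^sup>2) \<le> real n * T\<^sup>2" using p n by (simp add: field_simps)
    then have "L2_set (\<lambda>j. p (Z j \<omega>)) {..<n} \<le> sqrt (real n * T\<^sup>2)"
      unfolding L2_set_def by (rule real_sqrt_le_mono)
    then show ?thesis using T by (simp add: real_sqrt_mult)
  qed
  finally have q: "L2_set ?q {..<n} \<le> sqrt (real n) * (T + sqrt (2 * C) * \<beta>)"
    by (simp add: distrib_left)
  have dz: "L2_set (d \<zeta>) {..<n} \<le> sqrt (real n) * (sqrt (2 * C) * rad)"
    using C rad_pos vball_L2_set[OF zeta_in_vball[OF z]]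
    by (intro order_trans[OF L2_set_d_le] mult_left_mono) auto
  have "2 * (\<delta> * K / real m) * (L2_set ?q {..<n} * L2_set (d \<zeta>) {..<n}) / real n
      \<le> 2 * (\<delta> * K / real m) * ((sqrt (real n) * (T + sqrt (2 * C) * \<beta>)) * (sqrt (real n) * (sqrt (2 * C) * rad))) / real n"
    using \<delta>(1) K_pos C T \<beta> by (intro divide_right_mono mult_left_mono mult_mono q dz) auto
  also have "\<dots> = 2 * (\<delta> * K / real m) * ((T + sqrt (2 * C) * \<beta>) * (sqrt (2 * C) * rad)) * (sqrt (real n) * sqrt (real n)) / real n"
    by (simp only: mult_ac)
  also have "\<dots> = 2 * (\<delta> * K / real m) * ((T + sqrt (2 * C) * \<beta>) * (sqrt (2 * C) * rad))"
    using n by simp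
  also have "\<dots> = \<delta> * (2 * K\<^sup>2 * sqrt (2 * C) * (T + sqrt (2 * C) * \<beta>)) / sqrt (real n) * (sqrt (real m) / real m)"
    by (simp add: rad_def real_sqrt_divide power2_eq_square mult_ac)
  also have "\<dots> \<le> \<delta> * (2 * K\<^sup>2 * sqrt (2 * C) * (T + sqrt (2 * C) * \<beta>)) / sqrt (real n) * 1"
    using \<delta>(1) C T \<beta> sqrt_m by (intro mult_left_mono) auto
  finally have 2: "2 * (\<delta> * K / real m) * (L2_set ?q {..<n} * L2_set (d \<zeta>) {..<n}) / real n
      \<le> \<delta> * (2 * K\<^sup>2 * sqrt (2 * C) * (T + sqrt (2 * C) * \<beta>)) / sqrt (real n)" by simp
  have "\<bar>(1 / real n) * (\<Sum>j<n. p (Z j \<omega>) / (1 + d \<zeta> j)) - (1 / real n) * (\<Sum>j<n. ?q j)\<bar>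
    \<le> L2_set (\<lambda>k. (1 / real n) * (\<Sum>j<n. ?q j * u k (Z j \<omega>))) {..<m} * rad
      + 2 * (\<delta> * K / real m) * (L2_set ?q {..<n} * L2_set (d \<zeta>) {..<n}) / real n"
    using rad_pos by (intro weighted_mean_expansion n z zeta_in_vball umax_rad delta_K_m) auto
  also note add_mono[OF 1 2]
  finally show ?thesis by (simp add: distrib_left add_divide_distrib mult_ac)
qed

end


section \<open>Square-integrable functions and i.i.d. samples\<close>

definition sq_integrable :: "'z measure \<Rightarrow> ('z \<Rightarrow> real) \<Rightarrow> bool" where
  "sq_integrable Q f \<longleftrightarrow> f \<in> borel_measurable Q \<and> integrable Q (\<lambda>z. (f z)\<^sup>2)"

lemma sq_integrable_measurable [measurable_dest]: "sq_integrable Q f \<Longrightarrow> f \<in> borel_measurable Q"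
  by (simp add: sq_integrable_def)

lemma sq_integrable_square: "sq_integrable Q f \<Longrightarrow> integrable Q (\<lambda>z. (f z)\<^sup>2)"
  by (simp add: sq_integrable_def)

lemma sq_integrable_mult:
  assumes "sq_integrable Q f" "sq_integrable Q g"
  shows "integrable Q (\<lambda>z. f z * g z)"
proof (rule Bochner_Integration.integrable_bound)
  show "integrable Q (\<lambda>z. (f z)\<^sup>2 + (g z)\<^sup>2)"
    by (intro Bochner_Integration.integrable_add assms[THEN sq_integrable_square])
  show "(\<lambda>z. f z * g z) \<in> borel_measurable Q" using assms by measurable
  have "\<bar>x * y\<bar> \<le> \<bar>x\<^sup>2 + y\<^sup>2\<bar>" for x y :: real
  proof -
    have "0 \<le> \<bar>x\<bar> * \<bar>y\<bar>" by simp
    then have "\<bar>x\<bar> * \<bar>y\<bar> \<le> \<bar>x\<bar>\<^sup>2 + \<bar>y\<bar>\<^sup>2"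
      using sum_squares_bound[of "\<bar>x\<bar>" "\<bar>y\<bar>"] by linarith
    then show ?thesis by (simp add: abs_mult)
  qed
  then show "AE z in Q. norm (f z * g z) \<le> norm ((f z)\<^sup>2 + (g z)\<^sup>2)" by simp
qed

lemma sq_integrable_add:
  assumes "sq_integrable Q f" "sq_integrable Q g"
  shows "sq_integrable Q (\<lambda>z. f z + g z)"
proof -
  have "integrable Q (\<lambda>z. (f z)\<^sup>2 + (g z)\<^sup>2 + 2 * (f z * g z))"
    by (intro Bochner_Integration.integrable_add integrable_mult_right sq_integrable_mult
        assms[THEN sq_integrable_square] assms)
  then show ?thesis
    using assms unfolding sq_integrable_def by (simp add: power2_sum mult.assoc borel_measurable_add)
qed

lemma sq_integrable_cmult: "sq_integrable Q f \<Longrightarrow> sq_integrable Q (\<lambda>z. f z * c)"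
  by (simp add: sq_integrable_def power_mult_distrib borel_measurable_times)

lemma sq_integrable_diff: "sq_integrable Q f \<Longrightarrow> sq_integrable Q g \<Longrightarrow> sq_integrable Q (\<lambda>z. f z - g z)"
  using sq_integrable_add[of Q f "\<lambda>z. g z * (- 1)"] sq_integrable_cmult[of Q g "-1"] by simp

lemma sq_integrable_sum:
  "finite A \<Longrightarrow> (\<And>i. i \<in> A \<Longrightarrow> sq_integrable Q (f i)) \<Longrightarrow> sq_integrable Q (\<lambda>z. \<Sum>i\<in>A. f i z)"
proof (induction A rule: finite_induct)
  case empty
  then show ?case by (simp add: sq_integrable_def)
qed (simp add: sq_integrable_add)

lemma sq_integrable_imp_integrable: "finite_measure Q \<Longrightarrow> sq_integrable Q f \<Longrightarrow> integrable Q f"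
  by (simp add: sq_integrable_def finite_measure.square_integrable_imp_integrable)

lemma sq_integrable_const: "finite_measure Q \<Longrightarrow> sq_integrable Q (\<lambda>z. c)"
  by (simp add: sq_integrable_def finite_measure.integrable_const)

lemma (in prob_space) prob_greater_le:
  assumes Y: "integrable M Y" "\<And>\<omega>. 0 \<le> Y \<omega>" and "0 < (c::real)"
  shows "prob {\<omega> \<in> space M. c < Y \<omega>} \<le> expectation Y / c"
proof -
  note [measurable] = borel_measurable_integrable[OF Y(1)]
  have "prob {\<omega> \<in> space M. c < Y \<omega>} \<le> prob {\<omega> \<in> space M. c \<le> Y \<omega>}"
    by (intro finite_measure_mono) auto
  also have "\<dots> \<le> expectation Y / c"
    using Y by (intro integral_Markov_inequality_measure[of _ _ "{}"] assms) auto
  finally show ?thesis .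
qed

locale iid_sample =
  fixes M :: "'a measure" and Q :: "'z measure" and Z :: "nat \<Rightarrow> 'a \<Rightarrow> 'z"
  assumes M: "prob_space M" and Q: "prob_space Q"
    and indep: "prob_space.indep_vars M (\<lambda>_. Q) Z UNIV"
    and distr: "\<And>j. distr M Q (Z j) = Q"
begin

sublocale M: prob_space M by (rule M)
sublocale Q: prob_space Q by (rule Q)

lemma Z_measurable [measurable]: "Z j \<in> measurable M Q"
  using indep by (simp add: M.indep_vars_def)

lemma compose_measurable: "f \<in> borel_measurable Q \<Longrightarrow> (\<lambda>\<omega>. f (Z j \<omega>)) \<in> borel_measurable M"
  by (rule measurable_compose[OF Z_measurable])

lemma expectation_sample:
  fixes f :: "'z \<Rightarrow> real"
  assumes "f \<in> borel_measurable Q"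
  shows "M.expectation (\<lambda>\<omega>. f (Z j \<omega>)) = Q.expectation f"
  using integral_distr[OF Z_measurable assms, of j] by (simp add: distr)

lemma integrable_sample:
  fixes f :: "'z \<Rightarrow> real"
  assumes "integrable Q f"
  shows "integrable M (\<lambda>\<omega>. f (Z j \<omega>))"
  using integrable_distr_eq[OF Z_measurable borel_measurable_integrable[OF assms], of j] assms
  by (simp add: distr)

lemma expectation_sample_product:
  assumes f: "sq_integrable Q f" "Q.expectation f = 0"
  shows "M.expectation (\<lambda>\<omega>. f (Z i \<omega>) * f (Z j \<omega>)) = (if i = j then Q.expectation (\<lambda>z. (f z)\<^sup>2) else 0)"
    and "integrable M (\<lambda>\<omega>. f (Z i \<omega>) * f (Z j \<omega>))"
proof -
  note [measurable] = sq_integrable_measurable[OF f(1)]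
  have int: "integrable Q f" "integrable Q (\<lambda>z. (f z)\<^sup>2)"
    using f(1) sq_integrable_imp_integrable sq_integrable_square Q.finite_measure_axioms by blast+
  have "sq_integrable M (\<lambda>\<omega>. f (Z j \<omega>))" for j
    using integrable_sample[OF int(2)] by (simp add: sq_integrable_def)
  then show "integrable M (\<lambda>\<omega>. f (Z i \<omega>) * f (Z j \<omega>))" by (intro sq_integrable_mult)
  show "M.expectation (\<lambda>\<omega>. f (Z i \<omega>) * f (Z j \<omega>)) = (if i = j then Q.expectation (\<lambda>z. (f z)\<^sup>2) else 0)"
  proof (cases "i = j")
    case True
    then show ?thesis using expectation_sample[of "\<lambda>z. (f z)\<^sup>2" j] by (simp add: power2_eq_square)
  next
    case False
    have "M.indep_vars (\<lambda>_. borel) (\<lambda>j \<omega>. f (Z j \<omega>)) {i, j}"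
      by (rule M.indep_vars_compose2[OF M.indep_vars_subset[OF indep]]) auto
    then have "M.expectation (\<lambda>\<omega>. \<Prod>k\<in>{i, j}. f (Z k \<omega>)) = (\<Prod>k\<in>{i, j}. M.expectation (\<lambda>\<omega>. f (Z k \<omega>)))"
      by (intro M.indep_vars_lebesgue_integral) (auto intro: integrable_sample int)
    then show ?thesis using False by (simp add: expectation_sample f(2))
  qed
qed

text \<open>Independence and mean 0 kill the off-diagonal terms of the expanded square.\<close>

lemma expectation_square_sum:
  assumes f: "sq_integrable Q f" "Q.expectation f = 0"
  shows "M.expectation (\<lambda>\<omega>. (\<Sum>j<n. f (Z j \<omega>))\<^sup>2) = real n * Q.expectation (\<lambda>z. (f z)\<^sup>2)"
    and "integrable M (\<lambda>\<omega>. (\<Sum>j<n. f (Z j \<omega>))\<^sup>2)"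
proof -
  have eq: "(\<Sum>j<n. f (Z j \<omega>))\<^sup>2 = (\<Sum>i<n. \<Sum>j<n. f (Z i \<omega>) * f (Z j \<omega>))" for \<omega>
    by (simp add: power2_eq_square sum_product)
  show "integrable M (\<lambda>\<omega>. (\<Sum>j<n. f (Z j \<omega>))\<^sup>2)"
    unfolding eq by (intro Bochner_Integration.integrable_sum expectation_sample_product f)
  have "M.expectation (\<lambda>\<omega>. (\<Sum>j<n. f (Z j \<omega>))\<^sup>2) = (\<Sum>i<n. \<Sum>j<n. M.expectation (\<lambda>\<omega>. f (Z i \<omega>) * f (Z j \<omega>)))"
    unfolding eq by (simp add: expectation_sample_product[OF f])
  also have "\<dots> = (\<Sum>i<n. Q.expectation (\<lambda>z. (f z)\<^sup>2))"
    by (simp add: expectation_sample_product[OF f])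
  finally show "M.expectation (\<lambda>\<omega>. (\<Sum>j<n. f (Z j \<omega>))\<^sup>2) = real n * Q.expectation (\<lambda>z. (f z)\<^sup>2)" by simp
qed

text \<open>Chebyshev's inequality at scale n^(-1/2). The bound involves \<open>f\<close> only
  through its second moment, so \<open>f\<close> may change with \<open>n\<close>, as the regression
  remainders later do.\<close>

lemma prob_mean_le:
  assumes f: "sq_integrable Q f" "Q.expectation f = 0" and "0 < n" "0 < t"
  shows "M.prob {\<omega> \<in> space M. t / sqrt (real n) < \<bar>(1 / real n) * (\<Sum>j<n. f (Z j \<omega>))\<bar>}
    \<le> Q.expectation (\<lambda>z. (f z)\<^sup>2) / t\<^sup>2"
proof -
  have "t / sqrt (real n) < \<bar>(1 / real n) * s\<bar> \<longleftrightarrow> real n * t\<^sup>2 < s\<^sup>2" for s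
  proof -
    have "t / sqrt (real n) < \<bar>(1 / real n) * s\<bar> \<longleftrightarrow> t * (real n / sqrt (real n)) < \<bar>s\<bar>"
      using \<open>0 < n\<close> by (simp add: abs_mult field_simps)
    also have "\<dots> \<longleftrightarrow> \<bar>t * sqrt (real n)\<bar> < \<bar>s\<bar>" using \<open>0 < t\<close> by (simp add: real_div_sqrt abs_mult)
    also have "\<dots> \<longleftrightarrow> (t * sqrt (real n))\<^sup>2 < s\<^sup>2" by (simp only: abs_le_square_iff not_le[symmetric])
    finally show ?thesis by (simp add: power_mult_distrib mult.commute)
  qed
  then have "M.prob {\<omega> \<in> space M. t / sqrt (real n) < \<bar>(1 / real n) * (\<Sum>j<n. f (Z j \<omega>))\<bar>}
      = M.prob {\<omega> \<in> space M. real n * t\<^sup>2 < (\<Sum>j<n. f (Z j \<omega>))\<^sup>2}" by simp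
  also have "\<dots> \<le> M.expectation (\<lambda>\<omega>. (\<Sum>j<n. f (Z j \<omega>))\<^sup>2) / (real n * t\<^sup>2)"
    using assms by (intro M.prob_greater_le expectation_square_sum) auto
  also have "\<dots> = Q.expectation (\<lambda>z. (f z)\<^sup>2) / t\<^sup>2"
    using \<open>0 < n\<close> by (simp add: expectation_square_sum[OF f])
  finally show ?thesis .
qed

lemma prob_mean_greater_le:
  assumes f: "integrable Q f" "\<And>z. 0 \<le> f z" and "0 < n" "0 < t"
  shows "M.prob {\<omega> \<in> space M. t < (1 / real n) * (\<Sum>j<n. f (Z j \<omega>))} \<le> Q.expectation f / t"
proof -
  have "M.prob {\<omega> \<in> space M. t < (1 / real n) * (\<Sum>j<n. f (Z j \<omega>))}
      \<le> M.expectation (\<lambda>\<omega>. (1 / real n) * (\<Sum>j<n. f (Z j \<omega>))) / t"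
    using assms by (intro M.prob_greater_le integrable_mult_right Bochner_Integration.integrable_sum integrable_sample)
      (auto simp: sum_nonneg)
  also have "M.expectation (\<lambda>\<omega>. (1 / real n) * (\<Sum>j<n. f (Z j \<omega>))) = Q.expectation f"
    using \<open>0 < n\<close> f(1) by (simp add: integrable_sample expectation_sample)
  finally show ?thesis .
qed

end

text \<open>An outer-probability statement is used through its measurable covers: outside
  \<open>B n\<close> the bound holds pointwise, and deterministic reasoning can take over.\<close>

lemma oP_D:
  assumes "oP M X a" "0 < \<epsilon>" "0 < \<eta>"
  obtains B where "\<And>n. B n \<in> sets M" "\<And>n \<omega>. \<omega> \<in> space M \<Longrightarrow> \<omega> \<notin> B n \<Longrightarrow> norm (X n \<omega>) \<le> \<epsilon> * a n"
    "\<forall>\<^sub>F n in sequentially. measure M (B n) < \<eta>"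
proof -
  obtain B where B: "\<And>n. B n \<in> sets M" "\<And>n. {\<omega> \<in> space M. \<epsilon> * a n < norm (X n \<omega>)} \<subseteq> B n"
    "(\<lambda>n. measure M (B n)) \<longlonglongrightarrow> 0"
    using assms(1,2) unfolding oP_def by metis
  show thesis
  proof
    show "\<forall>\<^sub>F n in sequentially. measure M (B n) < \<eta>" by (rule order_tendstoD(2)[OF B(3) assms(3)])
    show "norm (X n \<omega>) \<le> \<epsilon> * a n" if "\<omega> \<in> space M" "\<omega> \<notin> B n" for n \<omega>
      using that B(2)[of n] by (intro leI) blast
  qed (rule B(1))
qed

lemma oP_mono:
  assumes "oP M X a" "\<And>n \<omega>. norm (Y n \<omega>) \<le> norm (X n \<omega>)"
  shows "oP M Y a"
proof -
  have "{\<omega> \<in> space M. \<epsilon> * a n < norm (Y n \<omega>)} \<subseteq> {\<omega> \<in> space M. \<epsilon> * a n < norm (X n \<omega>)}" for \<epsilon> n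
    using assms(2) less_le_trans by blast
  then show ?thesis using assms(1) unfolding oP_def by (meson subset_trans)
qed


section \<open>Regular constraints\<close>

lemma powr_minus_half: "0 \<le> x \<Longrightarrow> x powr (-1/2) = 1 / sqrt x" for x :: real
  by (simp only: minus_divide_left[symmetric] powr_minus powr_half_sqrt inverse_eq_divide)

text \<open>\<open>c\<close> and \<open>C\<close> are the regularity constants, in homogeneous form
  for arbitrary vectors. Condition (iii) concerns the function being averaged, so it is attached to
  individual results, one coordinate at a time.\<close>

locale empirical_likelihood = iid_sample M Q Z
  for M :: "'a measure" and Q :: "'z measure" and Z :: "nat \<Rightarrow> 'a \<Rightarrow> 'z" +
  fixes u :: "nat \<Rightarrow> 'z \<Rightarrow> real" and m :: "nat \<Rightarrow> nat" and c C :: real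
  assumes u_meas [measurable]: "\<And>k. u k \<in> borel_measurable Q"
    and m_lim: "filterlim m at_top sequentially"
    and u_L2: "\<And>n. integrable Q (\<lambda>z. \<Sum>k<m n. (u k z)\<^sup>2)"
    and u_mean0: "\<And>n k. k < m n \<Longrightarrow> (\<integral>z. u k z \<partial>Q) = 0"
    and c: "0 < c"
    and W_low: "\<And>n a. c * (\<Sum>k<m n. (a k)\<^sup>2) \<le> (\<Sum>i<m n. \<Sum>k<m n. a i * (\<integral>z. u i z * u k z \<partial>Q) * a k)"
    and W_up: "\<And>n a. (\<Sum>i<m n. \<Sum>k<m n. a i * (\<integral>z. u i z * u k z \<partial>Q) * a k) \<le> C * (\<Sum>k<m n. (a k)\<^sup>2)"
    and cond_i: "oP M (\<lambda>n \<omega>. Max ((\<lambda>j. vnorm (m n) u (Z j \<omega>)) ` {..<n}))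
                   (\<lambda>n. real (m n) powr (-3/2) * sqrt (real n))"
    and cond_ii: "oP M (\<lambda>n \<omega>. mat_opnorm (m n)
                   (\<lambda>k l. (1 / real n) * (\<Sum>j<n. u k (Z j \<omega>) * u l (Z j \<omega>))
                          - (\<integral>z. u k z * u l z \<partial>Q)))
                   (\<lambda>n. real (m n) powr (-1))"
begin

abbreviation W :: "nat \<Rightarrow> nat \<Rightarrow> real" where
  "W k l \<equiv> \<integral>z. u k z * u l z \<partial>Q"

lemma eventually_m_gt: "\<forall>\<^sub>F n in sequentially. k < m n"
  using m_lim unfolding filterlim_at_top by (auto dest: spec[of _ "Suc k"] simp: Suc_le_eq)

text \<open>Every index \<open>k\<close> lies below some \<open>m n\<close> because
  \<open>m n\<close> tends to infinity.\<close>

lemma u_sq_integrable: "sq_integrable Q (u k)"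
proof -
  obtain n where n: "k < m n"
    using eventually_m_gt[of k] by (auto simp: eventually_sequentially)
  have "integrable Q (\<lambda>z. (u k z)\<^sup>2)"
  proof (rule Bochner_Integration.integrable_bound[OF u_L2[of n]])
    have "(u k z)\<^sup>2 \<le> (\<Sum>k<m n. (u k z)\<^sup>2)" for z
      using n by (intro member_le_sum) auto
    then show "AE z in Q. norm ((u k z)\<^sup>2) \<le> norm (\<Sum>k<m n. (u k z)\<^sup>2)"
      by (intro AE_I2) (simp add: sum_nonneg)
  qed measurable
  then show ?thesis by (simp add: sq_integrable_def)
qed

lemma u_mean: "(\<integral>z. u k z \<partial>Q) = 0"
  using eventually_m_gt[of k] u_mean0 by (auto simp: eventually_sequentially)

lemma dotm_sq_integrable: "sq_integrable Q (\<lambda>z. dotm k u z a)"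
  unfolding dotm_def by (intro sq_integrable_sum sq_integrable_cmult u_sq_integrable) simp

lemma dotm_mean: "(\<integral>z. dotm k u z a \<partial>Q) = 0"
  using sq_integrable_imp_integrable[OF Q.finite_measure_axioms u_sq_integrable]
  unfolding dotm_def by (simp add: u_mean)

lemma integral_square_diff_dotm:
  assumes \<phi>: "sq_integrable Q \<phi>"
  shows "(\<integral>z. (\<phi> z - dotm k u z a)\<^sup>2 \<partial>Q) =
    (\<integral>z. (\<phi> z)\<^sup>2 \<partial>Q) - 2 * (\<Sum>i<k. (\<integral>z. \<phi> z * u i z \<partial>Q) * a i) + (\<Sum>i<k. \<Sum>l<k. a i * W i l * a l)"
proof -
  have "(\<phi> z - dotm k u z a)\<^sup>2 =
      (\<phi> z)\<^sup>2 - 2 * (\<Sum>i<k. \<phi> z * u i z * a i) + (\<Sum>i<k. \<Sum>l<k. a i * (u i z * u l z) * a l)" for z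
  proof -
    have "(dotm k u z a)\<^sup>2 = (\<Sum>i<k. \<Sum>l<k. a i * (u i z * u l z) * a l)"
      unfolding dotm_def power2_eq_square sum_product by (simp add: mult_ac)
    then show ?thesis
      unfolding power2_diff by (simp add: dotm_def sum_distrib_left mult.assoc)
  qed
  then show ?thesis
    using sq_integrable_mult[OF \<phi> u_sq_integrable] sq_integrable_mult[OF u_sq_integrable u_sq_integrable]
      sq_integrable_square[OF \<phi>]
    by simp
qed

text \<open>The coefficients solve the normal equations, so the mean squared error J satisfies J(a)
  - J(b) = (a - b)^T W (a - b) >= 0. Since J(b) >= 0, the form b^T W b is at most the second moment
  of \<open>\<phi>\<close>, and the lower regularity constant turns this into a bound on
  \<open>b\<close> common to all \<open>n\<close>.\<close>

lemma regression:
  assumes \<phi>: "sq_integrable Q \<phi>"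
  obtains b where "\<And>k. k < m n \<Longrightarrow> (\<Sum>l<m n. W k l * b l) = (\<integral>z. \<phi> z * u k z \<partial>Q)"
    and "L2_set b {..<m n} \<le> sqrt ((\<integral>z. (\<phi> z)\<^sup>2 \<partial>Q) / c)"
    and "\<And>a. (\<integral>z. (\<phi> z - dotm (m n) u z b)\<^sup>2 \<partial>Q) \<le> (\<integral>z. (\<phi> z - dotm (m n) u z a)\<^sup>2 \<partial>Q)"
proof -
  have W_sym: "W i j = W j i" for i j by (simp add: mult.commute)
  obtain b where b: "\<And>k. k < m n \<Longrightarrow> (\<Sum>l<m n. W k l * b l) = (\<integral>z. \<phi> z * u k z \<partial>Q)"
    using positive_definite_solve[of c W "m n" "\<lambda>k. \<integral>z. \<phi> z * u k z \<partial>Q"] c W_sym W_low by blast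
  have cross: "(\<Sum>i<m n. (\<integral>z. \<phi> z * u i z \<partial>Q) * a i) = (\<Sum>i<m n. \<Sum>l<m n. a i * W i l * b l)" for a
    by (simp add: b[symmetric] sum_distrib_left sum_distrib_right mult_ac cong: sum.cong_simp)
  have Jb: "(\<integral>z. (\<phi> z - dotm (m n) u z b)\<^sup>2 \<partial>Q) = (\<integral>z. (\<phi> z)\<^sup>2 \<partial>Q) - (\<Sum>i<m n. \<Sum>l<m n. b i * W i l * b l)"
    unfolding integral_square_diff_dotm[OF \<phi>] cross by simp
  have "0 \<le> (\<integral>z. (\<phi> z - dotm (m n) u z b)\<^sup>2 \<partial>Q)" by simp
  then have "c * (\<Sum>k<m n. (b k)\<^sup>2) \<le> (\<integral>z. (\<phi> z)\<^sup>2 \<partial>Q)"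
    using W_low[where a=b and n=n] unfolding Jb by linarith
  then have "(\<Sum>k<m n. (b k)\<^sup>2) \<le> (\<integral>z. (\<phi> z)\<^sup>2 \<partial>Q) / c"
    using c by (simp add: pos_le_divide_eq mult.commute)
  then have norm: "L2_set b {..<m n} \<le> sqrt ((\<integral>z. (\<phi> z)\<^sup>2 \<partial>Q) / c)"
    unfolding L2_set_def by (rule real_sqrt_le_mono)
  have "(\<integral>z. (\<phi> z - dotm (m n) u z b)\<^sup>2 \<partial>Q) \<le> (\<integral>z. (\<phi> z - dotm (m n) u z a)\<^sup>2 \<partial>Q)" for a
  proof -
    have sw: "(\<Sum>i<m n. \<Sum>l<m n. b i * W i l * a l) = (\<Sum>i<m n. \<Sum>l<m n. a i * W i l * b l)"
      by (subst sum.swap) (simp add: W_sym mult_ac)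
    have "(\<Sum>i<m n. \<Sum>k<m n. (a i - b i) * W i k * (a k - b k)) =
        (\<Sum>i<m n. \<Sum>l<m n. a i * W i l * a l) - (\<Sum>i<m n. \<Sum>l<m n. a i * W i l * b l)
        - (\<Sum>i<m n. \<Sum>l<m n. b i * W i l * a l) + (\<Sum>i<m n. \<Sum>l<m n. b i * W i l * b l)"
      by (simp add: left_diff_distrib right_diff_distrib sum_subtractf)
    moreover have "0 \<le> c * (\<Sum>k<m n. (a k - b k)\<^sup>2)" using c by (simp add: sum_nonneg)
    ultimately show ?thesis
      using W_low[where a="\<lambda>k. a k - b k" and n=n]
      unfolding Jb integral_square_diff_dotm[OF \<phi>, of _ a] cross sw by linarith
  qed
  then show thesis using that b norm by blast
qed

text \<open>The order of choice matters: \<open>T\<close> is fixed first, then \<open>K\<close> may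
  be taken large relative to \<open>T\<close>, and \<open>\<delta>\<close> small relative to
  \<open>K\<close>. Five exceptional sets of probability at most \<open>\<eta> / 5\<close> are
  united: three covers from the stochastic-order conditions and two events handled by Markov's
  inequality.\<close>

lemma eventually_good_sample:
  assumes p: "sq_integrable Q p"
    and p_cov: "oP M (\<lambda>n \<omega>. L2_set (\<lambda>k. (1 / real n) * (\<Sum>j<n. p (Z j \<omega>) * u k (Z j \<omega>)
        - (\<integral>z. p z * u k z \<partial>Q))) {..<m n}) (\<lambda>n. real (m n) powr (-1/2))"
    and \<eta>: "0 < \<eta>"
  obtains T where "0 < T"
    and "\<And>K \<delta>. \<lbrakk>T < c * K / 16; 0 < \<delta>; \<delta> \<le> c / 2; \<delta> * K \<le> 1 / 2\<rbrakk> \<Longrightarrow>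
      \<exists>B. (\<forall>n. B n \<in> sets M) \<and> (\<forall>\<^sub>F n in sequentially. M.prob (B n) \<le> \<eta> \<and>
        (\<forall>\<omega>\<in>space M - B n. good_sample n (m n) u Z \<omega> W c C T \<delta> K \<and>
          L2_set (\<lambda>k. (1 / real n) * (\<Sum>j<n. p (Z j \<omega>) * u k (Z j \<omega>)) - (\<integral>z. p z * u k z \<partial>Q)) {..<m n}
            \<le> \<delta> / sqrt (real (m n)) \<and>
          (1 / real n) * (\<Sum>j<n. (p (Z j \<omega>))\<^sup>2) \<le> T\<^sup>2))"
proof -
  define V where "V = (\<integral>z. (p z)\<^sup>2 \<partial>Q)"
  have V: "0 \<le> V" by (simp add: V_def)
  \<comment> \<open>Makes the Markov bounds \<open>C / T\<^sup>2\<close> and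
    \<open>V / T\<^sup>2\<close> at most \<open>\<eta> / 5\<close>; the added 1 keeps
    \<open>T\<close> positive.\<close>
  define T where "T = sqrt (5 * (\<bar>C\<bar> + V) / \<eta> + 1)"
  have "0 \<le> 5 * (\<bar>C\<bar> + V) / \<eta>" using \<eta> V by (intro divide_nonneg_pos mult_nonneg_nonneg) auto
  then have T: "0 < T" and T2: "T\<^sup>2 = 5 * (\<bar>C\<bar> + V) / \<eta> + 1" by (auto simp: T_def)
  have CV: "C / T\<^sup>2 \<le> \<eta> / 5" "V / T\<^sup>2 \<le> \<eta> / 5"
  proof -
    have "5 * (\<bar>C\<bar> + V) + \<eta> = \<eta> * T\<^sup>2" using \<eta> by (simp add: T2 field_simps)
    then have "5 * C \<le> \<eta> * T\<^sup>2" "5 * V \<le> \<eta> * T\<^sup>2"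
      using V \<eta> abs_ge_self[of C] abs_ge_zero[of C] unfolding distrib_left by linarith+
    then show "C / T\<^sup>2 \<le> \<eta> / 5" "V / T\<^sup>2 \<le> \<eta> / 5" using T by (simp_all add: field_simps)
  qed
  show thesis
  proof (rule that[OF T])
    fix K \<delta> assume K: "T < c * K / 16" and \<delta>: "0 < \<delta>" "\<delta> \<le> c / 2" "\<delta> * K \<le> 1 / 2"
    have \<eta>5: "0 < \<eta> / 5" using \<eta> by simp
    obtain B1 where B1: "\<And>n. B1 n \<in> sets M" "\<And>n \<omega>. \<omega> \<in> space M \<Longrightarrow> \<omega> \<notin> B1 n \<Longrightarrow>
        norm (Max ((\<lambda>j. vnorm (m n) u (Z j \<omega>)) ` {..<n})) \<le> \<delta> * (real (m n) powr (-3/2) * sqrt (real n))"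
      "\<forall>\<^sub>F n in sequentially. measure M (B1 n) < \<eta> / 5"
      by (rule oP_D[OF cond_i \<delta>(1) \<eta>5]) blast
    obtain B2 where B2: "\<And>n. B2 n \<in> sets M" "\<And>n \<omega>. \<omega> \<in> space M \<Longrightarrow> \<omega> \<notin> B2 n \<Longrightarrow>
        norm (mat_opnorm (m n) (\<lambda>k l. (1 / real n) * (\<Sum>j<n. u k (Z j \<omega>) * u l (Z j \<omega>)) - W k l))
          \<le> \<delta> * real (m n) powr (-1)"
      "\<forall>\<^sub>F n in sequentially. measure M (B2 n) < \<eta> / 5"
      by (rule oP_D[OF cond_ii \<delta>(1) \<eta>5]) blast
    obtain B3 where B3: "\<And>n. B3 n \<in> sets M" "\<And>n \<omega>. \<omega> \<in> space M \<Longrightarrow> \<omega> \<notin> B3 n \<Longrightarrow>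
        norm (L2_set (\<lambda>k. (1 / real n) * (\<Sum>j<n. p (Z j \<omega>) * u k (Z j \<omega>) - (\<integral>z. p z * u k z \<partial>Q))) {..<m n})
          \<le> \<delta> * real (m n) powr (-1/2)"
      "\<forall>\<^sub>F n in sequentially. measure M (B3 n) < \<eta> / 5"
      by (rule oP_D[OF p_cov \<delta>(1) \<eta>5]) blast
    note [measurable] = compose_measurable[OF u_meas] compose_measurable[OF sq_integrable_measurable[OF p]]
    define B4 where "B4 n = {\<omega> \<in> space M. T\<^sup>2 * (real (m n) / real n) < (\<Sum>k<m n. ((1 / real n) * (\<Sum>j<n. u k (Z j \<omega>)))\<^sup>2)}" for n
    define B5 where "B5 n = {\<omega> \<in> space M. T\<^sup>2 < (1 / real n) * (\<Sum>j<n. (p (Z j \<omega>))\<^sup>2)}" for n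
    have B45: "B4 n \<in> sets M" "B5 n \<in> sets M" for n
      unfolding B4_def B5_def by measurable
    have P4: "M.prob (B4 n) \<le> \<eta> / 5" if n: "0 < n" "0 < m n" for n
    proof -
      have int: "integrable M (\<lambda>\<omega>. ((1 / real n) * (\<Sum>j<n. u k (Z j \<omega>)))\<^sup>2)" for k
        unfolding power_mult_distrib
        by (intro integrable_mult_right expectation_square_sum[OF u_sq_integrable u_mean])
      \<comment> \<open>Diagonal entries are values of the form at unit vectors; summing them bounds
        the expected squared norm of the mean of \<open>u\<close> by
        \<open>C * m / n\<close>.\<close>
      have "W k k \<le> C" if "k < m n" for k
      proof -
        have "(\<Sum>i<m n. \<Sum>l<m n. (if i = k then 1 else 0) * W i l * (if l = k then 1 else 0)) = W k k"
          using that by (simp add: if_distrib[of "\<lambda>z. z * _"] if_distrib[of "\<lambda>z. _ * z"] sum.delta cong: if_cong)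
        moreover have "(\<Sum>i<m n. (if i = k then 1 else 0 :: real)\<^sup>2) = 1"
          using that by (simp add: if_distrib[of "\<lambda>z. z\<^sup>2"] sum.delta cong: if_cong)
        ultimately show ?thesis using W_up[where a="\<lambda>i. if i = k then 1 else 0" and n=n] by simp
      qed
      then have "(\<Sum>k<m n. W k k / real n) \<le> (\<Sum>k<m n. C / real n)"
        by (intro sum_mono divide_right_mono) auto
      moreover have "M.expectation (\<lambda>\<omega>. \<Sum>k<m n. ((1 / real n) * (\<Sum>j<n. u k (Z j \<omega>)))\<^sup>2) = (\<Sum>k<m n. W k k / real n)"
      proof -
        have "M.expectation (\<lambda>\<omega>. ((1 / real n) * (\<Sum>j<n. u k (Z j \<omega>)))\<^sup>2) = W k k / real n" for k
          using n expectation_square_sum(1)[OF u_sq_integrable u_mean, of k n]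
          by (simp add: power_divide power2_eq_square[of "real n"]) (simp add: power2_eq_square)
        then show ?thesis by (subst Bochner_Integration.integral_sum) (simp_all only: int)
      qed
      ultimately have E: "M.expectation (\<lambda>\<omega>. \<Sum>k<m n. ((1 / real n) * (\<Sum>j<n. u k (Z j \<omega>)))\<^sup>2) \<le> C * (real (m n) / real n)"
        by (simp add: mult.commute)
      have "M.prob (B4 n) \<le> M.expectation (\<lambda>\<omega>. \<Sum>k<m n. ((1 / real n) * (\<Sum>j<n. u k (Z j \<omega>)))\<^sup>2) / (T\<^sup>2 * (real (m n) / real n))"
        unfolding B4_def using n T
        by (intro M.prob_greater_le Bochner_Integration.integrable_sum int) (auto simp: sum_nonneg)
      also have "\<dots> \<le> C * (real (m n) / real n) / (T\<^sup>2 * (real (m n) / real n))"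
        by (intro divide_right_mono E) simp
      also have "\<dots> = C / T\<^sup>2" using n by simp
      finally show ?thesis using CV(1) by linarith
    qed
    have P5: "M.prob (B5 n) \<le> \<eta> / 5" if n: "0 < n" for n
    proof -
      have "M.prob (B5 n) \<le> V / T\<^sup>2"
        unfolding B5_def V_def using n T by (intro prob_mean_greater_le sq_integrable_square[OF p]) auto
      then show ?thesis using CV(2) by linarith
    qed
    define B where "B n = B1 n \<union> B2 n \<union> B3 n \<union> B4 n \<union> B5 n" for n
    have "\<forall>\<^sub>F n in sequentially. M.prob (B n) \<le> \<eta> \<and>
        (\<forall>\<omega>\<in>space M - B n. good_sample n (m n) u Z \<omega> W c C T \<delta> K \<and>
          L2_set (\<lambda>k. (1 / real n) * (\<Sum>j<n. p (Z j \<omega>) * u k (Z j \<omega>)) - (\<integral>z. p z * u k z \<partial>Q)) {..<m n}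
            \<le> \<delta> / sqrt (real (m n)) \<and>
          (1 / real n) * (\<Sum>j<n. (p (Z j \<omega>))\<^sup>2) \<le> T\<^sup>2)"
      using eventually_m_gt[of 0] B1(3) B2(3) B3(3) eventually_gt_at_top[of 0]
    proof eventually_elim
      case (elim n)
      have "M.prob (B n) \<le> M.prob (B1 n) + M.prob (B2 n) + M.prob (B3 n) + M.prob (B4 n) + M.prob (B5 n)"
        unfolding B_def
        by (intro order_trans[OF measure_Un_le] add_right_mono sets.Un B1 B2 B3 B45 order_refl)
      then have "M.prob (B n) \<le> \<eta>" using elim P4[of n] P5[of n] by simp
      moreover have "good_sample n (m n) u Z \<omega> W c C T \<delta> K" if \<omega>: "\<omega> \<in> space M" "\<omega> \<notin> B n" for \<omega>
      proof
        show "vnorm (m n) u (Z j \<omega>) \<le> \<delta> * (real (m n) powr (-3/2) * sqrt (real n))" if "j < n" for j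
        proof -
          have "vnorm (m n) u (Z j \<omega>) \<le> Max ((\<lambda>j. vnorm (m n) u (Z j \<omega>)) ` {..<n})"
            using that by (intro Max_ge) auto
          then show ?thesis using B1(2)[OF \<omega>(1), of n] \<omega>(2) by (simp add: B_def)
        qed
        show "mat_opnorm (m n) (\<lambda>k l. (1 / real n) * (\<Sum>j<n. u k (Z j \<omega>) * u l (Z j \<omega>)) - W k l) \<le> \<delta> / real (m n)"
          using B2(2)[OF \<omega>(1), of n] \<omega>(2) by (simp add: B_def powr_minus divide_inverse)
        show "(\<Sum>k<m n. ((1 / real n) * (\<Sum>j<n. u k (Z j \<omega>)))\<^sup>2) \<le> T\<^sup>2 * (real (m n) / real n)"
          using \<omega> by (simp add: B_def B4_def not_less)
        show "c * (\<Sum>k<m n. (a k)\<^sup>2) \<le> (\<Sum>i<m n. \<Sum>k<m n. a i * W i k * a k)"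
          "(\<Sum>i<m n. \<Sum>k<m n. a i * W i k * a k) \<le> C * (\<Sum>k<m n. (a k)\<^sup>2)" for a
          by (rule W_low W_up)+
      qed (fact elim(1) elim(5) c less_imp_le[OF T] \<delta> K)+
      moreover have "L2_set (\<lambda>k. (1 / real n) * (\<Sum>j<n. p (Z j \<omega>) * u k (Z j \<omega>)) - (\<integral>z. p z * u k z \<partial>Q)) {..<m n}
            \<le> \<delta> / sqrt (real (m n))" if \<omega>: "\<omega> \<in> space M" "\<omega> \<notin> B n" for \<omega>
      proof -
        have "(1 / real n) * (\<Sum>j<n. p (Z j \<omega>) * u k (Z j \<omega>) - (\<integral>z. p z * u k z \<partial>Q))
            = (1 / real n) * (\<Sum>j<n. p (Z j \<omega>) * u k (Z j \<omega>)) - (\<integral>z. p z * u k z \<partial>Q)" for k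
        proof -
          have "(\<Sum>j<n. p (Z j \<omega>) * u k (Z j \<omega>) - (\<integral>z. p z * u k z \<partial>Q))
              = (\<Sum>j<n. p (Z j \<omega>) * u k (Z j \<omega>)) - real n * (\<integral>z. p z * u k z \<partial>Q)"
            by (simp add: sum_subtractf)
          then show ?thesis using elim(5) by (simp only: right_diff_distrib) simp
        qed
        moreover have "real (m n) powr (-1/2) = 1 / sqrt (real (m n))"
          by (rule powr_minus_half) simp
        ultimately show ?thesis
          using B3(2)[OF \<omega>(1), of n] \<omega>(2) by (simp add: B_def)
      qed
      moreover have "(1 / real n) * (\<Sum>j<n. (p (Z j \<omega>))\<^sup>2) \<le> T\<^sup>2" if "\<omega> \<in> space M" "\<omega> \<notin> B n" for \<omega>
        using that by (simp add: B_def B5_def not_less)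
      ultimately show ?case by blast
    qed
    moreover have "B n \<in> sets M" for n unfolding B_def by (intro sets.Un B1 B2 B3 B45)
    ultimately show "\<exists>B. (\<forall>n. B n \<in> sets M) \<and> (\<forall>\<^sub>F n in sequentially. M.prob (B n) \<le> \<eta> \<and>
        (\<forall>\<omega>\<in>space M - B n. good_sample n (m n) u Z \<omega> W c C T \<delta> K \<and>
          L2_set (\<lambda>k. (1 / real n) * (\<Sum>j<n. p (Z j \<omega>) * u k (Z j \<omega>)) - (\<integral>z. p z * u k z \<partial>Q)) {..<m n}
            \<le> \<delta> / sqrt (real (m n)) \<and>
          (1 / real n) * (\<Sum>j<n. (p (Z j \<omega>))\<^sup>2) \<le> T\<^sup>2))"
      by (intro exI[of _ B] conjI allI)
  qed
qed

end

lemma tendsto_zero_if_eventually_le: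
  fixes f :: "nat \<Rightarrow> real"
  assumes "\<And>n. 0 \<le> f n" "\<And>\<eta>. 0 < \<eta> \<Longrightarrow> \<forall>\<^sub>F n in sequentially. f n \<le> \<eta>"
  shows "f \<longlonglongrightarrow> 0"
proof (rule tendstoI)
  fix e :: real assume "0 < e"
  then have "\<forall>\<^sub>F n in sequentially. f n \<le> e / 2" by (intro assms(2)) simp
  then show "\<forall>\<^sub>F n in sequentially. dist (f n) 0 < e"
    by eventually_elim (use assms(1) \<open>0 < e\<close> in \<open>simp add: dist_real_def\<close>)
qed

lemma obtain_small_delta:
  fixes c K D e :: real
  assumes "0 < c" "0 < K" "0 < D" "0 < e"
  obtains \<delta> where "0 < \<delta>" "\<delta> \<le> c / 2" "\<delta> * K \<le> 1 / 2" "\<delta> * D \<le> e"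
proof -
  define \<delta> where "\<delta> = min (c / 2) (min (1 / (2 * K)) (e / D))"
  have "\<delta> \<le> c / 2" "\<delta> \<le> 1 / (2 * K)" "\<delta> \<le> e / D" "0 < \<delta>"
    using assms unfolding \<delta>_def by (simp_all only: min.cobounded1 min.coboundedI2 min_less_iff_conj) simp_all
  moreover from this have "\<delta> * K \<le> 1 / (2 * K) * K" "\<delta> * D \<le> e / D * D"
    using assms by (auto simp del: times_divide_eq_left intro!: mult_right_mono)
  ultimately show thesis using assms by (intro that[of \<delta>]) auto
qed

section \<open>Probability of unique solvability, the closed span, and the scalar expansion\<close>

context empirical_likelihood
begin

lemma sets_ex1: "{\<omega> \<in> space M. \<exists>!\<zeta>. zeta_eq n (m n) u Z \<omega> \<zeta>} \<in> sets M"
  by (rule sets_ex1_zeta_eq) (rule compose_measurable[OF u_meas])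

lemma prob_ex1: "(\<lambda>n. M.prob {\<omega> \<in> space M. \<exists>!\<zeta>. zeta_eq n (m n) u Z \<omega> \<zeta>}) \<longlonglongrightarrow> 1"
proof -
  let ?A = "\<lambda>n. {\<omega> \<in> space M. \<exists>!\<zeta>. zeta_eq n (m n) u Z \<omega> \<zeta>}"
  have "(\<lambda>n. M.prob (space M - ?A n)) \<longlonglongrightarrow> 0"
  proof (rule tendsto_zero_if_eventually_le)
    fix \<eta> :: real assume \<eta>: "0 < \<eta>"
    \<comment> \<open>The tilting equation does not involve the averaged function. The zero function
      meets the covariance condition trivially, so (i) and (ii) decide alone.\<close>
    define p :: "'z \<Rightarrow> real" where "p = (\<lambda>_. 0)"
    have p: "sq_integrable Q p" by (simp add: sq_integrable_def p_def)
    have p_cov: "oP M (\<lambda>n \<omega>. L2_set (\<lambda>k. (1 / real n) * (\<Sum>j<n. p (Z j \<omega>) * u k (Z j \<omega>)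
        - (\<integral>z. p z * u k z \<partial>Q))) {..<m n}) (\<lambda>n. real (m n) powr (-1/2))"
      unfolding oP_def by (intro allI impI exI[of _ "\<lambda>_. {}"]) (auto simp: p_def L2_set_def not_less)
    obtain T where T: "0 < T" "\<And>K \<delta>. \<lbrakk>T < c * K / 16; 0 < \<delta>; \<delta> \<le> c / 2; \<delta> * K \<le> 1 / 2\<rbrakk> \<Longrightarrow>
      \<exists>B. (\<forall>n. B n \<in> sets M) \<and> (\<forall>\<^sub>F n in sequentially. M.prob (B n) \<le> \<eta> \<and>
        (\<forall>\<omega>\<in>space M - B n. good_sample n (m n) u Z \<omega> W c C T \<delta> K \<and>
          L2_set (\<lambda>k. (1 / real n) * (\<Sum>j<n. p (Z j \<omega>) * u k (Z j \<omega>)) - (\<integral>z. p z * u k z \<partial>Q)) {..<m n}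
            \<le> \<delta> / sqrt (real (m n)) \<and>
          (1 / real n) * (\<Sum>j<n. (p (Z j \<omega>))\<^sup>2) \<le> T\<^sup>2))"
      by (rule eventually_good_sample[OF p p_cov \<eta>]) (rule that)
    define K where "K = 16 * T / c + 1"
    have K: "0 < K" "T < c * K / 16" using T(1) c by (auto simp: K_def field_simps add_pos_pos)
    obtain \<delta> where \<delta>: "0 < \<delta>" "\<delta> \<le> c / 2" "\<delta> * K \<le> 1 / 2"
      using obtain_small_delta[OF c K(1) zero_less_one zero_less_one] by blast
    obtain B where B: "\<And>n. B n \<in> sets M" "\<forall>\<^sub>F n in sequentially. M.prob (B n) \<le> \<eta> \<and>
        (\<forall>\<omega>\<in>space M - B n. good_sample n (m n) u Z \<omega> W c C T \<delta> K)"
    proof -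
      from T(2)[OF K(2) \<delta>] obtain B where B: "\<forall>n. B n \<in> sets M"
        "\<forall>\<^sub>F n in sequentially. M.prob (B n) \<le> \<eta> \<and>
        (\<forall>\<omega>\<in>space M - B n. good_sample n (m n) u Z \<omega> W c C T \<delta> K \<and>
          L2_set (\<lambda>k. (1 / real n) * (\<Sum>j<n. p (Z j \<omega>) * u k (Z j \<omega>)) - (\<integral>z. p z * u k z \<partial>Q)) {..<m n}
            \<le> \<delta> / sqrt (real (m n)) \<and>
          (1 / real n) * (\<Sum>j<n. (p (Z j \<omega>))\<^sup>2) \<le> T\<^sup>2)" by blast
      from B(2) have "\<forall>\<^sub>F n in sequentially. M.prob (B n) \<le> \<eta> \<and>
        (\<forall>\<omega>\<in>space M - B n. good_sample n (m n) u Z \<omega> W c C T \<delta> K)"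
        by (rule eventually_mono) blast
      then show thesis using that B(1) by blast
    qed
    from B(2) show "\<forall>\<^sub>F n in sequentially. M.prob (space M - ?A n) \<le> \<eta>"
    proof eventually_elim
      case (elim n)
      then have "good_sample n (m n) u Z \<omega> W c C T \<delta> K" if "\<omega> \<in> space M - B n" for \<omega>
        using that by blast
      then have "\<exists>!\<zeta>. zeta_eq n (m n) u Z \<omega> \<zeta>" if "\<omega> \<in> space M - B n" for \<omega>
        by (rule good_sample.zeta_ex1) (rule that)
      then have "space M - ?A n \<subseteq> B n" by blast
      then have "M.prob (space M - ?A n) \<le> M.prob (B n)" by (rule M.finite_measure_mono) (rule B(1))
      then show ?case using elim by linarith
    qed
  qed simp
  then have "(\<lambda>n. 1 - M.prob (space M - ?A n)) \<longlonglongrightarrow> 1 - 0" by (intro tendsto_intros)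
  moreover have "1 - M.prob (space M - ?A n) = M.prob (?A n)" for n
    using M.prob_compl[OF sets_ex1] by simp
  ultimately show ?thesis by simp
qed

lemma in_L2_span_sq_integrable: "in_L2_span Q u f \<Longrightarrow> sq_integrable Q f"
  by (simp add: in_L2_span_def sq_integrable_def)

text \<open>Padding the coefficients with 0 makes one finite combination available in every larger
  dimension, as a growing \<open>m n\<close> demands.\<close>

lemma in_L2_span_approx:
  assumes "in_L2_span Q u f" "0 < \<epsilon>"
  obtains K a where "\<And>l. K \<le> l \<Longrightarrow> (\<integral>z. (f z - dotm l u z (\<lambda>k. if k < K then a k else 0))\<^sup>2 \<partial>Q) < \<epsilon>"
proof -
  obtain K a where a: "(\<integral>z. (f z - (\<Sum>k<K. a k * u k z))\<^sup>2 \<partial>Q) < \<epsilon>"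
    using assms unfolding in_L2_span_def by blast
  have "dotm l u z (\<lambda>k. if k < K then a k else 0) = (\<Sum>k<K. a k * u k z)" if "K \<le> l" for l z
  proof -
    have "dotm l u z (\<lambda>k. if k < K then a k else 0) = (\<Sum>k<K. u k z * (if k < K then a k else 0))"
      unfolding dotm_def using that by (intro sum.mono_neutral_right) auto
    then show ?thesis by (simp add: mult.commute)
  qed
  then show thesis using a by (intro that[of K a]) simp
qed

text \<open>\<open>h\<close> is orthogonal to every finite combination of the \<open>u k\<close>, so
  only the approximation error e of \<open>f\<close> contributes; it is controlled by |h e| <= r h^2
  / 2 + e^2 / (2 r).\<close>

lemma in_L2_span_orthogonal:
  assumes h: "sq_integrable Q h" "\<And>k. (\<integral>z. h z * u k z \<partial>Q) = 0" and f: "in_L2_span Q u f"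
  shows "(\<integral>z. h z * f z \<partial>Q) = 0"
proof -
  note f2 = in_L2_span_sq_integrable[OF f]
  have "\<bar>\<integral>z. h z * f z \<partial>Q\<bar> \<le> \<eta>" if \<eta>: "0 < \<eta>" for \<eta>
  proof -
    define H where "H = (\<integral>z. (h z)\<^sup>2 \<partial>Q)"
    have H: "0 \<le> H" by (simp add: H_def)
    \<comment> \<open>With \<open>r * H \<le> \<eta>\<close> and a squared error below
      \<open>r * \<eta>\<close>, each half of the weighted inequality is at most
      \<open>\<eta> / 2\<close>.\<close>
    define r where "r = \<eta> / (H + 1)"
    have r: "0 < r" "r * H \<le> \<eta>" using \<eta> H by (auto simp: r_def divide_simps add_nonneg_pos)
    have "0 < r * \<eta>" using r(1) \<eta> by simp
    from in_L2_span_approx[OF f this] obtain K a where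
      "\<And>l. K \<le> l \<Longrightarrow> (\<integral>z. (f z - dotm l u z (\<lambda>k. if k < K then a k else 0))\<^sup>2 \<partial>Q) < r * \<eta>"
      by blast
    from this[of K] obtain s where s: "(\<integral>z. (f z - dotm K u z s)\<^sup>2 \<partial>Q) < r * \<eta>" by blast
    define e where "e z = f z - dotm K u z s" for z
    have e: "sq_integrable Q e" unfolding e_def by (intro sq_integrable_diff f2 dotm_sq_integrable)
    have hd: "(\<integral>z. h z * dotm K u z s \<partial>Q) = 0"
    proof -
      have "h z * dotm K u z s = (\<Sum>k<K. h z * u k z * s k)" for z
        by (simp add: dotm_def sum_distrib_left mult.assoc)
      then show ?thesis using sq_integrable_mult[OF h(1) u_sq_integrable] by (simp add: h(2))
    qed
    have "h z * f z = h z * e z + h z * dotm K u z s" for z by (simp add: e_def algebra_simps)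
    then have eq: "(\<integral>z. h z * f z \<partial>Q) = (\<integral>z. h z * e z \<partial>Q)"
      using sq_integrable_mult[OF h(1) e] sq_integrable_mult[OF h(1) dotm_sq_integrable] by (simp add: hd)
    have "\<bar>\<integral>z. h z * e z \<partial>Q\<bar> \<le> (\<integral>z. \<bar>h z * e z\<bar> \<partial>Q)" by (rule integral_abs_bound)
    also have "\<dots> \<le> (\<integral>z. r / 2 * (h z)\<^sup>2 + (e z)\<^sup>2 / (2 * r) \<partial>Q)"
    proof (rule integral_mono)
      show "\<bar>h z * e z\<bar> \<le> r / 2 * (h z)\<^sup>2 + (e z)\<^sup>2 / (2 * r)" for z
      proof -
        have "0 \<le> (r * \<bar>h z\<bar> - \<bar>e z\<bar>)\<^sup>2 / (2 * r)" using r(1) by simp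
        also have "\<dots> = r / 2 * (h z)\<^sup>2 + (e z)\<^sup>2 / (2 * r) - \<bar>h z * e z\<bar>"
          using r(1) by (simp add: power2_diff power_mult_distrib abs_mult field_simps power2_eq_square[of r])
        finally show ?thesis by simp
      qed
    qed (intro integrable_abs Bochner_Integration.integrable_add integrable_mult_right integrable_divide
        sq_integrable_mult sq_integrable_square h(1) e)+
    also have "\<dots> = r / 2 * H + (\<integral>z. (e z)\<^sup>2 \<partial>Q) / (2 * r)"
      using sq_integrable_square[OF h(1)] sq_integrable_square[OF e] by (simp add: H_def)
    also have "\<dots> \<le> \<eta> / 2 + r * \<eta> / (2 * r)"
      using r s by (intro add_mono divide_right_mono) (auto simp: e_def)
    also have "\<dots> = \<eta>" using r(1) by simp
    finally show ?thesis by (simp add: eq)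
  qed
  then show ?thesis by (metis abs_le_zero_iff field_le_epsilon add.left_neutral)
qed

text \<open>The constant 1 is orthogonal to all the centred \<open>u k\<close>, hence to their
  closed span.\<close>

lemma in_L2_span_mean:
  assumes "in_L2_span Q u f"
  shows "(\<integral>z. f z \<partial>Q) = 0"
  using in_L2_span_orthogonal[of "\<lambda>_. 1", OF sq_integrable_const[OF Q.finite_measure_axioms] _ assms] u_mean
  by simp

text \<open>One coordinate of the estimator, with the same default value 0 as
  \<open>theta_tilde\<close>; it reduces the vector statement to a scalar one.\<close>

definition weighted_mean :: "nat \<Rightarrow> ('z \<Rightarrow> real) \<Rightarrow> 'a \<Rightarrow> real" where
  "weighted_mean n p \<omega> = (if \<exists>!\<zeta>. zeta_eq n (m n) u Z \<omega> \<zeta> then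
    (1 / real n) * (\<Sum>j<n. p (Z j \<omega>) / (1 + dotm (m n) u (Z j \<omega>) (THE \<zeta>. zeta_eq n (m n) u Z \<omega> \<zeta>))) else 0)"

text \<open>On a good sample \<open>expansion\<close> passes to the mean of the finite-dimensional
  residual of \<open>p\<close>. That differs from the mean of \<open>p - \<phi>\<close> by the mean
  of the remainder \<open>r n\<close>, which is centred with vanishing second moment, hence small at
  scale n^(-1/2) by Chebyshev. Each of the two errors gets \<open>\<epsilon> / 2\<close> and
  \<open>\<eta> / 2\<close>.\<close>

theorem weighted_mean_approx:
  assumes p: "sq_integrable Q p" and \<phi>: "in_L2_span Q u \<phi>"
    and orth: "\<And>k. (\<integral>z. (p z - \<phi> z) * u k z \<partial>Q) = 0"
    and p_cov: "oP M (\<lambda>n \<omega>. L2_set (\<lambda>k. (1 / real n) * (\<Sum>j<n. p (Z j \<omega>) * u k (Z j \<omega>)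
        - (\<integral>z. p z * u k z \<partial>Q))) {..<m n}) (\<lambda>n. real (m n) powr (-1/2))"
    and \<epsilon>: "0 < \<epsilon>"
  shows "(\<lambda>n. M.prob {\<omega> \<in> space M. \<epsilon> / sqrt (real n) <
      \<bar>weighted_mean n p \<omega> - ((1 / real n) * (\<Sum>j<n. p (Z j \<omega>)) - (1 / real n) * (\<Sum>j<n. \<phi> (Z j \<omega>)))\<bar>}) \<longlonglongrightarrow> 0"
    (is "(\<lambda>n. M.prob (?E n)) \<longlonglongrightarrow> 0")
proof (rule tendsto_zero_if_eventually_le)
  fix \<eta> :: real assume \<eta>: "0 < \<eta>"
  note \<phi>2 = in_L2_span_sq_integrable[OF \<phi>]
  \<comment> \<open>\<open>p\<close> and its projection have the same inner products with
    \<open>u\<close>, so coefficients computed from \<open>\<phi>\<close> also solve the normal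
    equations of \<open>p\<close>.\<close>
  have cov: "(\<integral>z. p z * u k z \<partial>Q) = (\<integral>z. \<phi> z * u k z \<partial>Q)" for k
    using orth[of k] sq_integrable_mult[OF p u_sq_integrable] sq_integrable_mult[OF \<phi>2 u_sq_integrable]
    by (simp add: left_diff_distrib)
  define \<beta> where "\<beta> = sqrt ((\<integral>z. (\<phi> z)\<^sup>2 \<partial>Q) / c)"
  have "\<exists>b. (\<forall>k<m n. (\<Sum>l<m n. W k l * b l) = (\<integral>z. \<phi> z * u k z \<partial>Q)) \<and> L2_set b {..<m n} \<le> \<beta> \<and>
      (\<forall>a. (\<integral>z. (\<phi> z - dotm (m n) u z b)\<^sup>2 \<partial>Q) \<le> (\<integral>z. (\<phi> z - dotm (m n) u z a)\<^sup>2 \<partial>Q))"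
      for n
    unfolding \<beta>_def by (rule regression[OF \<phi>2, of n]) blast
  then have "\<exists>b. \<forall>n. (\<forall>k<m n. (\<Sum>l<m n. W k l * b n l) = (\<integral>z. \<phi> z * u k z \<partial>Q)) \<and> L2_set (b n) {..<m n} \<le> \<beta> \<and>
      (\<forall>a. (\<integral>z. (\<phi> z - dotm (m n) u z (b n))\<^sup>2 \<partial>Q) \<le> (\<integral>z. (\<phi> z - dotm (m n) u z a)\<^sup>2 \<partial>Q))"
    by (intro choice allI)
  then obtain b where b: "\<And>n k. k < m n \<Longrightarrow> (\<Sum>l<m n. W k l * b n l) = (\<integral>z. \<phi> z * u k z \<partial>Q)"
    "\<And>n. L2_set (b n) {..<m n} \<le> \<beta>"
    "\<And>n a. (\<integral>z. (\<phi> z - dotm (m n) u z (b n))\<^sup>2 \<partial>Q) \<le> (\<integral>z. (\<phi> z - dotm (m n) u z a)\<^sup>2 \<partial>Q)"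
    by blast
  obtain T where T: "0 < T" "\<And>K \<delta>. \<lbrakk>T < c * K / 16; 0 < \<delta>; \<delta> \<le> c / 2; \<delta> * K \<le> 1 / 2\<rbrakk> \<Longrightarrow>
      \<exists>B. (\<forall>n. B n \<in> sets M) \<and> (\<forall>\<^sub>F n in sequentially. M.prob (B n) \<le> \<eta> / 2 \<and>
        (\<forall>\<omega>\<in>space M - B n. good_sample n (m n) u Z \<omega> W c C T \<delta> K \<and>
          L2_set (\<lambda>k. (1 / real n) * (\<Sum>j<n. p (Z j \<omega>) * u k (Z j \<omega>)) - (\<integral>z. p z * u k z \<partial>Q)) {..<m n}
            \<le> \<delta> / sqrt (real (m n)) \<and>
          (1 / real n) * (\<Sum>j<n. (p (Z j \<omega>))\<^sup>2) \<le> T\<^sup>2))"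
    by (rule eventually_good_sample[OF p p_cov half_gt_zero[OF \<eta>]]) (rule that)
  define K where "K = 16 * T / c + 1"
  have K: "0 < K" "T < c * K / 16" using T(1) c by (auto simp: K_def field_simps add_pos_pos)
  \<comment> \<open>The constant of \<open>expansion\<close>; being independent of \<open>n\<close>,
    it can be beaten by the choice of \<open>\<delta>\<close>.\<close>
  define D where "D = K * (1 + \<beta>) + 2 * K\<^sup>2 * sqrt (2 * C) * (T + sqrt (2 * C) * \<beta>)"
  have "0 < \<bar>D\<bar> + 1" "0 < \<epsilon> / 2" using \<epsilon> by (simp_all add: add_nonneg_pos)
  then obtain \<delta> where \<delta>: "0 < \<delta>" "\<delta> \<le> c / 2" "\<delta> * K \<le> 1 / 2" "\<delta> * (\<bar>D\<bar> + 1) \<le> \<epsilon> / 2"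
    using obtain_small_delta[OF c K(1)] by blast
  have \<delta>D: "\<delta> * D \<le> \<epsilon> / 2"
  proof -
    have "\<delta> * D \<le> \<delta> * (\<bar>D\<bar> + 1)" using \<delta>(1) by (intro mult_left_mono) auto
    then show ?thesis using \<delta>(4) by linarith
  qed
  obtain B where B: "\<And>n. B n \<in> sets M" "\<forall>\<^sub>F n in sequentially. M.prob (B n) \<le> \<eta> / 2 \<and>
        (\<forall>\<omega>\<in>space M - B n. good_sample n (m n) u Z \<omega> W c C T \<delta> K \<and>
          L2_set (\<lambda>k. (1 / real n) * (\<Sum>j<n. p (Z j \<omega>) * u k (Z j \<omega>)) - (\<integral>z. p z * u k z \<partial>Q)) {..<m n}
            \<le> \<delta> / sqrt (real (m n)) \<and>
          (1 / real n) * (\<Sum>j<n. (p (Z j \<omega>))\<^sup>2) \<le> T\<^sup>2)"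
    using T(2)[OF K(2) \<delta>(1-3)] by blast
  define r where "r n z = \<phi> z - dotm (m n) u z (b n)" for n z
  have r: "sq_integrable Q (r n)" for n
    unfolding r_def by (intro sq_integrable_diff \<phi>2 dotm_sq_integrable)
  have r_mean: "(\<integral>z. r n z \<partial>Q) = 0" for n
    using sq_integrable_imp_integrable[OF Q.finite_measure_axioms] \<phi>2 dotm_sq_integrable
    by (simp add: r_def in_L2_span_mean[OF \<phi>] dotm_mean)
  define B' where "B' n = {\<omega> \<in> space M. \<epsilon> / 2 / sqrt (real n) < \<bar>(1 / real n) * (\<Sum>j<n. r n (Z j \<omega>))\<bar>}" for n
  have B': "B' n \<in> sets M" for n
  proof -
    note [measurable] = compose_measurable[OF sq_integrable_measurable[OF r]]
    show ?thesis unfolding B'_def by measurable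
  qed
  \<comment> \<open>A fixed finite combination close to \<open>\<phi>\<close> becomes a competitor
    once \<open>m n > L\<close>, and \<open>b n\<close> does at least as well.\<close>
  have r_small: "\<forall>\<^sub>F n in sequentially. (\<integral>z. (r n z)\<^sup>2 \<partial>Q) \<le> \<eta> / 2 * (\<epsilon> / 2)\<^sup>2"
  proof -
    have "0 < \<eta> / 2 * (\<epsilon> / 2)\<^sup>2" using \<eta> \<epsilon> by simp
    from in_L2_span_approx[OF \<phi> this] obtain L a where
      a: "\<And>l. L \<le> l \<Longrightarrow> (\<integral>z. (\<phi> z - dotm l u z (\<lambda>k. if k < L then a k else 0))\<^sup>2 \<partial>Q) < \<eta> / 2 * (\<epsilon> / 2)\<^sup>2"
      by blast
    show ?thesis using eventually_m_gt[of L]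
    proof eventually_elim
      case (elim n)
      then show ?case
        using b(3)[of n "\<lambda>k. if k < L then a k else 0"] a[of "m n"] unfolding r_def by linarith
    qed
  qed
  from B(2) r_small eventually_gt_at_top[of 0] show "\<forall>\<^sub>F n in sequentially. M.prob (?E n) \<le> \<eta>"
  proof eventually_elim
    case (elim n)
    have "M.prob (B' n) \<le> (\<integral>z. (r n z)\<^sup>2 \<partial>Q) / (\<epsilon> / 2)\<^sup>2"
      unfolding B'_def using elim \<epsilon> by (intro prob_mean_le r r_mean) auto
    also have "\<dots> \<le> \<eta> / 2"
      using elim(2) \<epsilon> by (subst pos_divide_le_eq) auto
    finally have B'n: "M.prob (B' n) \<le> \<eta> / 2" .
    have "?E n \<subseteq> B n \<union> B' n"
    proof (rule subsetI, rule ccontr)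
      fix \<omega> assume \<omega>: "\<omega> \<in> ?E n" "\<omega> \<notin> B n \<union> B' n"
      then interpret good_sample n "m n" u Z \<omega> W c C T \<delta> K using elim(1) by blast
      define \<zeta> where "\<zeta> = (THE \<zeta>. zeta_eq n (m n) u Z \<omega> \<zeta>)"
      have \<zeta>: "zeta_eq n (m n) u Z \<omega> \<zeta>" unfolding \<zeta>_def by (rule theI'[OF zeta_ex1])
      have wm: "weighted_mean n p \<omega> = (1 / real n) * (\<Sum>j<n. p (Z j \<omega>) / (1 + dotm (m n) u (Z j \<omega>) \<zeta>))"
        unfolding weighted_mean_def \<zeta>_def using zeta_ex1 by simp
      have "\<bar>(1 / real n) * (\<Sum>j<n. p (Z j \<omega>) / (1 + dotm (m n) u (Z j \<omega>) \<zeta>))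
          - (1 / real n) * (\<Sum>j<n. p (Z j \<omega>) - dotm (m n) u (Z j \<omega>) (b n))\<bar> \<le> \<delta> * D / sqrt (real n)"
        unfolding D_def
      proof (rule expansion[OF \<zeta> _ b(2), where v="\<lambda>k. \<integral>z. p z * u k z \<partial>Q"])
        show "(\<Sum>l<m n. W k l * b n l) = (\<integral>z. p z * u k z \<partial>Q)" if "k < m n" for k
          using b(1)[OF that] by (simp add: cov)
      qed (use elim(1) \<omega> in auto)
      also have "\<dots> \<le> \<epsilon> / 2 / sqrt (real n)" by (intro divide_right_mono \<delta>D) simp
      finally have 1: "\<bar>weighted_mean n p \<omega> - (1 / real n) * (\<Sum>j<n. p (Z j \<omega>) - dotm (m n) u (Z j \<omega>) (b n))\<bar>
          \<le> \<epsilon> / 2 / sqrt (real n)" unfolding wm .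
      have 2: "\<bar>(1 / real n) * (\<Sum>j<n. r n (Z j \<omega>))\<bar> \<le> \<epsilon> / 2 / sqrt (real n)"
        using \<omega> by (simp add: B'_def not_less)
      have 3: "(1 / real n) * (\<Sum>j<n. p (Z j \<omega>) - dotm (m n) u (Z j \<omega>) (b n))
          = (1 / real n) * (\<Sum>j<n. p (Z j \<omega>)) - (1 / real n) * (\<Sum>j<n. \<phi> (Z j \<omega>)) + (1 / real n) * (\<Sum>j<n. r n (Z j \<omega>))"
        by (simp add: r_def sum_subtractf right_diff_distrib)
      have "\<epsilon> / sqrt (real n) < \<bar>weighted_mean n p \<omega> - ((1 / real n) * (\<Sum>j<n. p (Z j \<omega>)) - (1 / real n) * (\<Sum>j<n. \<phi> (Z j \<omega>)))\<bar>"
        using \<omega>(1) by simp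
      moreover have "\<epsilon> / sqrt (real n) = \<epsilon> / 2 / sqrt (real n) + \<epsilon> / 2 / sqrt (real n)" by simp
      ultimately show False using 1 2 unfolding 3 by linarith
    qed
    then have "M.prob (?E n) \<le> M.prob (B n \<union> B' n)"
      by (rule M.finite_measure_mono) (intro sets.Un B(1) B')
    also have "\<dots> \<le> M.prob (B n) + M.prob (B' n)"
      by (intro measure_Un_le B(1) B')
    finally show ?case using elim(1) B'n by linarith
  qed
qed simp

end


section \<open>The central limit theorem\<close>

lemma abs_cos_diff_le: "\<bar>cos x - cos y\<bar> \<le> \<bar>x - y\<bar>" for x y :: real
proof -
  have "\<bar>cos x - cos y\<bar> = 2 * (\<bar>sin ((x + y) / 2)\<bar> * \<bar>sin ((y - x) / 2)\<bar>)"
    by (simp add: cos_diff_cos abs_mult)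
  also have "\<dots> \<le> 2 * (1 * \<bar>(y - x) / 2\<bar>)"
    by (intro mult_left_mono mult_mono abs_sin_x_le_abs_x) auto
  finally show ?thesis by (simp add: abs_minus_commute)
qed

lemma abs_sin_diff_le: "\<bar>sin x - sin y\<bar> \<le> \<bar>x - y\<bar>" for x y :: real
proof -
  have "\<bar>sin x - sin y\<bar> = 2 * (\<bar>sin ((x - y) / 2)\<bar> * \<bar>cos ((x + y) / 2)\<bar>)"
    by (simp add: sin_diff_sin abs_mult)
  also have "\<dots> \<le> 2 * (\<bar>(x - y) / 2\<bar> * 1)"
    by (intro mult_left_mono mult_mono abs_sin_x_le_abs_x) auto
  finally show ?thesis by simp
qed

text \<open>Slutsky's theorem in trigonometric form: sin and cos are bounded and 1-Lipschitz, so a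
  perturbation tending to 0 in probability leaves their limits unchanged. Tightness passes from
  \<open>Y\<close> to \<open>X\<close> by enlarging the radius by 1.\<close>

theorem weak_limit_if_trig_limits_perturbed:
  fixes X Y :: "nat \<Rightarrow> 'a \<Rightarrow> 'b::euclidean_space"
  assumes M: "prob_space M" and N: "prob_space N" "sets N = sets borel"
    and X [measurable]: "\<And>n. X n \<in> borel_measurable M" and Y [measurable]: "\<And>n. Y n \<in> borel_measurable M"
    and close: "\<And>\<epsilon>. \<epsilon> > 0 \<Longrightarrow> (\<lambda>n. measure M {\<omega>\<in>space M. \<epsilon> < norm (X n \<omega> - Y n \<omega>)}) \<longlonglongrightarrow> 0"
    and tight: "\<And>\<eta>. \<eta> > 0 \<Longrightarrow> \<exists>R. \<forall>\<^sub>F n in sequentially. measure M {\<omega>\<in>space M. R < norm (Y n \<omega>)} \<le> \<eta>"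
    and cos: "\<And>t. (\<lambda>n. \<integral>\<omega>. cos (t \<bullet> Y n \<omega>) \<partial>M) \<longlonglongrightarrow> (\<integral>x. cos (t \<bullet> x) \<partial>N)"
    and sin: "\<And>t. (\<lambda>n. \<integral>\<omega>. sin (t \<bullet> Y n \<omega>) \<partial>M) \<longlonglongrightarrow> (\<integral>x. sin (t \<bullet> x) \<partial>N)"
    and f: "continuous_on UNIV f" "bounded (range f)"
  shows "(\<lambda>n. \<integral>\<omega>. f (X n \<omega>) \<partial>M) \<longlonglongrightarrow> ((\<integral>x. f x \<partial>N) :: real)"
proof -
  interpret prob_space M by fact
  have diff: "(\<lambda>n. expectation (\<lambda>\<omega>. h (t \<bullet> X n \<omega>)) - expectation (\<lambda>\<omega>. h (t \<bullet> Y n \<omega>))) \<longlonglongrightarrow> 0"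
    if h [measurable]: "h \<in> borel_measurable borel" and h1: "\<And>x. \<bar>h x\<bar> \<le> 1" and hL: "\<And>x y. \<bar>h x - h y\<bar> \<le> \<bar>x - y\<bar>"
    for h :: "real \<Rightarrow> real" and t
  proof (subst tendsto_rabs_zero_iff[symmetric], rule tendsto_zero_if_eventually_le)
    fix \<eta> :: real assume \<eta>: "0 < \<eta>"
    \<comment> \<open>The added 1 covers \<open>t = 0\<close>. The Lipschitz error is at most
      \<open>\<eta> / 2\<close>, and an event of probability below \<open>\<eta> / 4\<close> adds
      twice that.\<close>
    define e where "e = \<eta> / (2 * (norm t + 1))"
    have t1: "0 < norm t + 1" by (simp add: add_nonneg_pos)
    then have e: "0 < e" using \<eta> by (simp add: e_def)
    have te: "norm t * e \<le> \<eta> / 2"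
    proof -
      have "norm t * e \<le> (norm t + 1) * e" using e by (intro mult_right_mono) auto
      also have "\<dots> = \<eta> / 2"
      proof -
        have "x * (\<eta> / (2 * x)) = \<eta> / 2" if "0 < x" for x using that by simp
        then show ?thesis using t1 unfolding e_def by blast
      qed
      finally show ?thesis .
    qed
    have "\<forall>\<^sub>F n in sequentially. prob {\<omega>\<in>space M. e < norm (X n \<omega> - Y n \<omega>)} < \<eta> / 4"
      by (rule order_tendstoD(2)[OF close[OF e]]) (use \<eta> in simp)
    then show "\<forall>\<^sub>F n in sequentially. \<bar>expectation (\<lambda>\<omega>. h (t \<bullet> X n \<omega>)) - expectation (\<lambda>\<omega>. h (t \<bullet> Y n \<omega>))\<bar> \<le> \<eta>"
    proof eventually_elim
      case (elim n)
      have "\<bar>expectation (\<lambda>\<omega>. h (t \<bullet> X n \<omega>)) - expectation (\<lambda>\<omega>. h (t \<bullet> Y n \<omega>))\<bar>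
          \<le> norm t * e + (1 + 1) * prob {\<omega>\<in>space M. e < norm (X n \<omega> - Y n \<omega>)}"
      proof (rule expectation_diff_le_on_set)
        fix \<omega> assume \<omega>: "\<omega> \<in> space M" "\<omega> \<notin> {\<omega> \<in> space M. e < norm (X n \<omega> - Y n \<omega>)}"
        have "\<bar>h (t \<bullet> X n \<omega>) - h (t \<bullet> Y n \<omega>)\<bar> \<le> \<bar>t \<bullet> (X n \<omega> - Y n \<omega>)\<bar>"
          using hL by (simp add: inner_diff_right)
        also have "\<dots> \<le> norm t * norm (X n \<omega> - Y n \<omega>)" by (rule Cauchy_Schwarz_ineq2)
        also have "\<dots> \<le> norm t * e" using \<omega> by (intro mult_left_mono) auto
        finally show "\<bar>h (t \<bullet> X n \<omega>) - h (t \<bullet> Y n \<omega>)\<bar> \<le> norm t * e" .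
      qed (use h1 e in \<open>auto\<close>)
      then show ?case using elim te unfolding one_add_one by linarith
    qed
  qed simp
  show ?thesis
  proof (rule weak_limit_if_trig_limits[OF M N X _ _ _ f])
    fix \<eta> :: real assume \<eta>: "0 < \<eta>"
    obtain R where R: "\<forall>\<^sub>F n in sequentially. prob {\<omega>\<in>space M. R < norm (Y n \<omega>)} \<le> \<eta> / 2"
      using tight[of "\<eta> / 2"] \<eta> by auto
    have "\<forall>\<^sub>F n in sequentially. prob {\<omega>\<in>space M. 1 < norm (X n \<omega> - Y n \<omega>)} < \<eta> / 2"
      by (rule order_tendstoD(2)[OF close]) (use \<eta> in simp_all)
    with R have "\<forall>\<^sub>F n in sequentially. prob {\<omega>\<in>space M. R + 1 < norm (X n \<omega>)} \<le> \<eta>"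
    proof eventually_elim
      case (elim n)
      have "R < norm (Y n \<omega>) \<or> 1 < norm (X n \<omega> - Y n \<omega>)" if "R + 1 < norm (X n \<omega>)" for \<omega>
        using that norm_triangle_sub[of "X n \<omega>" "Y n \<omega>"] by linarith
      then have "prob {\<omega>\<in>space M. R + 1 < norm (X n \<omega>)}
          \<le> prob ({\<omega>\<in>space M. R < norm (Y n \<omega>)} \<union> {\<omega>\<in>space M. 1 < norm (X n \<omega> - Y n \<omega>)})"
        by (intro finite_measure_mono) auto
      also have "\<dots> \<le> prob {\<omega>\<in>space M. R < norm (Y n \<omega>)} + prob {\<omega>\<in>space M. 1 < norm (X n \<omega> - Y n \<omega>)}"
        by (intro measure_Un_le) measurable
      finally show ?case using elim by linarith
    qed
    then show "\<exists>R. \<forall>\<^sub>F n in sequentially. prob {\<omega>\<in>space M. R < norm (X n \<omega>)} \<le> \<eta>" by blast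
  next
    fix t
    show "(\<lambda>n. expectation (\<lambda>\<omega>. cos (t \<bullet> X n \<omega>))) \<longlonglongrightarrow> (\<integral>x. cos (t \<bullet> x) \<partial>N)"
      using tendsto_add[OF diff[of cos t] cos[of t]] abs_cos_diff_le abs_cos_le_one by simp
    show "(\<lambda>n. expectation (\<lambda>\<omega>. sin (t \<bullet> X n \<omega>))) \<longlonglongrightarrow> (\<integral>x. sin (t \<bullet> x) \<partial>N)"
      using tendsto_add[OF diff[of sin t] sin[of t]] abs_sin_diff_le abs_sin_le_one by simp
  qed
qed

text \<open>The bridge from characteristic functions, on which Levy continuity rests, to the real
  moments used for weak convergence here.\<close>

lemma (in real_distribution) Re_char: "Re (char M t) = (\<integral>x. cos (t * x) \<partial>M)"
  and Im_char: "Im (char M t) = (\<integral>x. sin (t * x) \<partial>M)"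
proof -
  have i: "integrable M (\<lambda>x. iexp (t * x))"
    by (rule integrable_iexp) auto
  show "Re (char M t) = (\<integral>x. cos (t * x) \<partial>M)"
    unfolding char_def integral_Re[OF i, symmetric] by (simp add: Re_exp)
  show "Im (char M t) = (\<integral>x. sin (t * x) \<partial>M)"
    unfolding char_def integral_Im[OF i, symmetric] by (simp add: Im_exp)
qed

text \<open>The law is that of \<open>s\<close> times a standard normal variable, so the integrals
  are the real and imaginary parts of the standard characteristic function at
  \<open>s\<close>.\<close>

lemma normal_trig_integrals:
  assumes s: "0 < s"
  shows "(\<integral>x. cos x \<partial>density lborel (normal_density 0 s)) = exp (- s\<^sup>2 / 2)"
    and "(\<integral>x. sin x \<partial>density lborel (normal_density 0 s)) = 0"
proof -
  interpret std: real_distribution std_normal_distribution by (rule real_dist_normal_dist)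
  have "distributed std_normal_distribution lborel (\<lambda>x. x) std_normal_density"
    by (simp add: distributed_def distr_id2)
  then have "distributed std_normal_distribution lborel (\<lambda>x. s * x) (normal_density 0 s)"
    using std.normal_density_affine[of "\<lambda>x. x" 0 1 s 0] s by simp
  then have eq: "density lborel (normal_density 0 s) = distr std_normal_distribution borel (\<lambda>x. s * x)"
    using distr_distributed_normal by metis
  show "(\<integral>x. cos x \<partial>density lborel (normal_density 0 s)) = exp (- s\<^sup>2 / 2)"
    unfolding eq using std.Re_char[of s] by (simp add: integral_distr char_std_normal_distribution)
  show "(\<integral>x. sin x \<partial>density lborel (normal_density 0 s)) = 0"
    unfolding eq using std.Im_char[of s] by (simp add: integral_distr char_std_normal_distribution)
qed

lemma mvnormal_trig_integrals:
  fixes \<Sigma> :: "real^'r^'r"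
  assumes N: "mvnormal \<Sigma> N" and q: "0 \<le> t \<bullet> (\<Sigma> *v t)"
  shows "(\<integral>x. cos (t \<bullet> x) \<partial>N) = exp (- (t \<bullet> (\<Sigma> *v t)) / 2)"
    and "(\<integral>x. sin (t \<bullet> x) \<partial>N) = 0"
proof -
  have sN: "sets N = sets borel" using N by (simp add: mvnormal_def)
  have t [measurable]: "(\<lambda>x. t \<bullet> x) \<in> borel_measurable N"
    unfolding measurable_cong_sets[OF sN refl] by measurable
  have "(\<integral>x. cos (t \<bullet> x) \<partial>N) = (\<integral>x. cos x \<partial>distr N borel (\<lambda>x. t \<bullet> x))"
    "(\<integral>x. sin (t \<bullet> x) \<partial>N) = (\<integral>x. sin x \<partial>distr N borel (\<lambda>x. t \<bullet> x))"
    by (simp_all add: integral_distr)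
  moreover have "distr N borel (\<lambda>x. t \<bullet> x) = (if t \<bullet> (\<Sigma> *v t) = 0 then return borel 0
         else density lborel (normal_density 0 (sqrt (t \<bullet> (\<Sigma> *v t)))))"
    using N unfolding mvnormal_def by blast
  ultimately show "(\<integral>x. cos (t \<bullet> x) \<partial>N) = exp (- (t \<bullet> (\<Sigma> *v t)) / 2)" "(\<integral>x. sin (t \<bullet> x) \<partial>N) = 0"
    using q normal_trig_integrals[of "sqrt (t \<bullet> (\<Sigma> *v t))"] by (auto simp: integral_return)
qed

section \<open>Trigonometric limits and tightness of normalized sums\<close>

context iid_sample
begin

text \<open>The central limit theorem covers positive variance; with variance 0 the sums vanish
  almost surely. The second case does arise, for instance from the projection direction 0.\<close>

lemma sum_trig_limits:
  assumes g: "sq_integrable Q g" "(\<integral>z. g z \<partial>Q) = 0"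
  shows "(\<lambda>n. M.expectation (\<lambda>\<omega>. cos ((\<Sum>j<n. g (Z j \<omega>)) / sqrt (real n)))) \<longlonglongrightarrow> exp (- (\<integral>z. (g z)\<^sup>2 \<partial>Q) / 2)"
      (is "?C \<longlonglongrightarrow> _")
    and "(\<lambda>n. M.expectation (\<lambda>\<omega>. sin ((\<Sum>j<n. g (Z j \<omega>)) / sqrt (real n)))) \<longlonglongrightarrow> 0"
      (is "?S \<longlonglongrightarrow> _")
proof -
  note [measurable] = sq_integrable_measurable[OF g(1)]
  note [measurable] = compose_measurable[OF sq_integrable_measurable[OF g(1)]]
  have "?C \<longlonglongrightarrow> exp (- (\<integral>z. (g z)\<^sup>2 \<partial>Q) / 2) \<and> ?S \<longlonglongrightarrow> 0"
  proof (cases "(\<integral>z. (g z)\<^sup>2 \<partial>Q) = 0")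
    case True
    have AE0: "AE \<omega> in M. (\<Sum>j<n. g (Z j \<omega>)) = 0" for n
    proof -
      have "M.expectation (\<lambda>\<omega>. (\<Sum>j<n. g (Z j \<omega>))\<^sup>2) = 0"
        using expectation_square_sum(1)[OF g, of n] True by simp
      then have "AE \<omega> in M. (\<Sum>j<n. g (Z j \<omega>))\<^sup>2 = 0"
        by (subst (asm) integral_nonneg_eq_0_iff_AE[OF expectation_square_sum(2)[OF g]]) auto
      then show ?thesis by simp
    qed
    have "AE \<omega> in M. cos ((\<Sum>j<n. g (Z j \<omega>)) / sqrt (real n)) = 1 \<and> sin ((\<Sum>j<n. g (Z j \<omega>)) / sqrt (real n)) = 0" for n
      using AE0[of n] by eventually_elim simp
    then have "M.expectation (\<lambda>\<omega>. cos ((\<Sum>j<n. g (Z j \<omega>)) / sqrt (real n))) = M.expectation (\<lambda>\<omega>. 1)"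
      and "M.expectation (\<lambda>\<omega>. sin ((\<Sum>j<n. g (Z j \<omega>)) / sqrt (real n))) = M.expectation (\<lambda>\<omega>. 0)" for n
      by (intro integral_cong_AE; simp)+
    then show ?thesis by (simp add: True M.prob_space)
  next
    case False
    define s where "s = sqrt (\<integral>z. (g z)\<^sup>2 \<partial>Q)"
    have s: "0 < s" "s\<^sup>2 = (\<integral>z. (g z)\<^sup>2 \<partial>Q)" using False by (auto simp: s_def less_le)
    \<comment> \<open>Sums standardized by \<open>s\<close>; evaluating their characteristic
      function at \<open>s\<close> undoes the standardization.\<close>
    let ?W = "\<lambda>n. distr M borel (\<lambda>\<omega>. (\<Sum>j<n. g (Z j \<omega>)) / sqrt (real n * s\<^sup>2))"
    have mean: "M.expectation (\<lambda>\<omega>. g (Z j \<omega>)) = 0" for j using g(2) by (simp add: expectation_sample)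
    have "weak_conv_m ?W std_normal_distribution"
    proof (rule M.central_limit_theorem_zero_mean[where X="\<lambda>j \<omega>. g (Z j \<omega>)" and \<mu>="distr Q borel g"])
      show "M.indep_vars (\<lambda>i. borel) (\<lambda>j \<omega>. g (Z j \<omega>)) UNIV"
        by (rule M.indep_vars_compose2[OF indep]) simp
      show "integrable M (\<lambda>\<omega>. (g (Z j \<omega>))\<^sup>2)" for j
        by (rule integrable_sample[OF sq_integrable_square[OF g(1)]])
      show "M.variance (\<lambda>\<omega>. g (Z j \<omega>)) = s\<^sup>2" for j
        unfolding mean s(2) using expectation_sample[of "\<lambda>z. (g z)\<^sup>2" j] by simp
      show "distr M borel (\<lambda>\<omega>. g (Z j \<omega>)) = distr Q borel g" for j
      proof -
        have "distr (distr M Q (Z j)) borel g = distr M borel (g \<circ> Z j)"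
          by (rule distr_distr) measurable
        then show ?thesis by (simp add: distr comp_def)
      qed
    qed (use mean s in auto)
    then have "(\<lambda>n. char (?W n) s) \<longlonglongrightarrow> char std_normal_distribution s"
      by (intro levy_continuity1 M.real_distribution_distr real_dist_normal_dist) measurable
    then have "(\<lambda>n. Re (char (?W n) s)) \<longlonglongrightarrow> exp (- s\<^sup>2 / 2)" "(\<lambda>n. Im (char (?W n) s)) \<longlonglongrightarrow> 0"
      by (auto dest: tendsto_Re tendsto_Im simp: char_std_normal_distribution)
    moreover have "Re (char (?W n) s) = ?C n" and "Im (char (?W n) s) = ?S n" for n
    proof -
      interpret W: real_distribution "?W n" by (rule M.real_distribution_distr) measurable
      have "s * (x / sqrt (real n * s\<^sup>2)) = x / sqrt (real n)" for x
        using s(1) by (simp add: real_sqrt_mult)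
      then show "Re (char (?W n) s) = ?C n" "Im (char (?W n) s) = ?S n"
        unfolding W.Re_char W.Im_char by (simp_all add: integral_distr)
    qed
    ultimately show ?thesis by (simp add: s(2))
  qed
  then show "?C \<longlonglongrightarrow> exp (- (\<integral>z. (g z)\<^sup>2 \<partial>Q) / 2)" "?S \<longlonglongrightarrow> 0" by blast+
qed

text \<open>The second moment of the norm equals \<open>V\<close> for every positive
  \<open>n\<close>, so Markov's inequality yields one radius for all of them.\<close>

lemma normalized_sum_tight:
  fixes G :: "'z \<Rightarrow> real^'r"
  assumes G: "\<And>i. sq_integrable Q (\<lambda>z. G z $ i)" "\<And>i. (\<integral>z. G z $ i \<partial>Q) = 0" and \<eta>: "0 < \<eta>"
  shows "\<exists>R. \<forall>\<^sub>F n in sequentially. M.prob {\<omega>\<in>space M. R < norm ((1 / sqrt (real n)) *\<^sub>R (\<Sum>j<n. G (Z j \<omega>)))} \<le> \<eta>"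
proof -
  define V where "V = (\<Sum>i\<in>UNIV. \<integral>z. (G z $ i)\<^sup>2 \<partial>Q)"
  have V: "0 \<le> V" by (simp add: V_def sum_nonneg)
  define R where "R = sqrt (V / \<eta> + 1)"
  have R: "0 < R" "R\<^sup>2 = V / \<eta> + 1" using V \<eta> by (auto simp: R_def add_nonneg_pos)
  have "M.prob {\<omega>\<in>space M. R < norm ((1 / sqrt (real n)) *\<^sub>R (\<Sum>j<n. G (Z j \<omega>)))} \<le> \<eta>" if n: "0 < n" for n
  proof -
    have "R < norm x \<longleftrightarrow> R\<^sup>2 < (norm x)\<^sup>2" for x :: "real^'r"
      using R(1) by (simp add: abs_le_square_iff[symmetric] not_le[symmetric])
    moreover have "(norm ((1 / sqrt (real n)) *\<^sub>R (\<Sum>j<n. G (Z j \<omega>))))\<^sup>2 = (\<Sum>i\<in>UNIV. (\<Sum>j<n. G (Z j \<omega>) $ i)\<^sup>2) / real n" for \<omega>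
    proof -
      have "(norm ((1 / sqrt (real n)) *\<^sub>R x))\<^sup>2 = (norm x)\<^sup>2 / real n" for x :: "real^'r"
        by (simp add: power_mult_distrib power_divide)
      moreover have "(norm x)\<^sup>2 = (\<Sum>i\<in>UNIV. (x $ i)\<^sup>2)" for x :: "real^'r"
        by (simp add: norm_vec_def L2_set_squared)
      ultimately show ?thesis by simp
    qed
    ultimately have "M.prob {\<omega>\<in>space M. R < norm ((1 / sqrt (real n)) *\<^sub>R (\<Sum>j<n. G (Z j \<omega>)))}
        = M.prob {\<omega>\<in>space M. R\<^sup>2 < (\<Sum>i\<in>UNIV. (\<Sum>j<n. G (Z j \<omega>) $ i)\<^sup>2) / real n}" by presburger
    also have "\<dots> \<le> M.expectation (\<lambda>\<omega>. (\<Sum>i\<in>UNIV. (\<Sum>j<n. G (Z j \<omega>) $ i)\<^sup>2) / real n) / R\<^sup>2"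
      using R(1) by (intro M.prob_greater_le integrable_divide Bochner_Integration.integrable_sum expectation_square_sum G)
        (auto simp: sum_nonneg)
    also have "M.expectation (\<lambda>\<omega>. (\<Sum>i\<in>UNIV. (\<Sum>j<n. G (Z j \<omega>) $ i)\<^sup>2) / real n) = V"
      using n by (simp add: V_def expectation_square_sum[OF G] sum_distrib_left[symmetric])
    also have "V / R\<^sup>2 \<le> \<eta>"
      using V \<eta> R by (subst pos_divide_le_eq) (auto simp: field_simps)
    finally show ?thesis .
  qed
  then show ?thesis
    by (intro exI[of _ R] eventually_mono[OF eventually_gt_at_top[of 0]]) auto
qed

end

text \<open>The norm is at most the sum of the absolute coordinates, so a large norm forces some
  coordinate above an equal share of the threshold.\<close>

lemma prob_norm_tendsto_0_if_components:
  fixes X :: "nat \<Rightarrow> 'a \<Rightarrow> real^'r"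
  assumes M: "prob_space M" and X [measurable]: "\<And>n. X n \<in> borel_measurable M" and a: "\<And>n. 0 \<le> a n"
    and comp: "\<And>i \<epsilon>. 0 < \<epsilon> \<Longrightarrow> (\<lambda>n. measure M {\<omega>\<in>space M. \<epsilon> * a n < \<bar>X n \<omega> $ i\<bar>}) \<longlonglongrightarrow> 0"
    and \<epsilon>: "0 < \<epsilon>"
  shows "(\<lambda>n. measure M {\<omega>\<in>space M. \<epsilon> * a n < norm (X n \<omega>)}) \<longlonglongrightarrow> 0"
proof (rule tendsto_sandwich[OF _ _ tendsto_const])
  interpret prob_space M by fact
  let ?e = "\<epsilon> / real CARD('r)"
  have [measurable]: "(\<lambda>\<omega>. X n \<omega> $ i) \<in> borel_measurable M" for n i
    using measurable_compose[OF X borel_measurable_continuous_onI[of "\<lambda>x. x $ i"]]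
    by (simp add: continuous_on_component)
  have e: "0 < ?e" using \<epsilon> by simp
  show "(\<lambda>n. \<Sum>i\<in>(UNIV :: 'r set). prob {\<omega>\<in>space M. ?e * a n < \<bar>X n \<omega> $ i\<bar>}) \<longlonglongrightarrow> 0"
    using tendsto_sum[of UNIV, OF comp[OF e]] by simp
  have "prob {\<omega>\<in>space M. \<epsilon> * a n < norm (X n \<omega>)} \<le> (\<Sum>i\<in>(UNIV :: 'r set). prob {\<omega>\<in>space M. ?e * a n < \<bar>X n \<omega> $ i\<bar>})" for n
  proof -
    have "{\<omega>\<in>space M. \<epsilon> * a n < norm (X n \<omega>)} \<subseteq> (\<Union>i. {\<omega>\<in>space M. ?e * a n < \<bar>X n \<omega> $ i\<bar>})"
    proof
      fix \<omega> assume \<omega>: "\<omega> \<in> {\<omega>\<in>space M. \<epsilon> * a n < norm (X n \<omega>)}"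
      show "\<omega> \<in> (\<Union>i. {\<omega>\<in>space M. ?e * a n < \<bar>X n \<omega> $ i\<bar>})"
      proof (rule ccontr)
        assume "\<omega> \<notin> (\<Union>i. {\<omega>\<in>space M. ?e * a n < \<bar>X n \<omega> $ i\<bar>})"
        then have "\<bar>X n \<omega> $ i\<bar> \<le> ?e * a n" for i using \<omega> by (auto simp: not_less)
        then have "(\<Sum>i\<in>UNIV. \<bar>X n \<omega> $ i\<bar>) \<le> (\<Sum>i\<in>(UNIV :: 'r set). ?e * a n)" by (intro sum_mono)
        then have "norm (X n \<omega>) \<le> \<epsilon> * a n" using norm_le_l1_cart[of "X n \<omega>"] by simp
        then show False using \<omega> by simp
      qed
    qed
    then have "prob {\<omega>\<in>space M. \<epsilon> * a n < norm (X n \<omega>)} \<le> prob (\<Union>i\<in>UNIV. {\<omega>\<in>space M. ?e * a n < \<bar>X n \<omega> $ i\<bar>})"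
      by (intro finite_measure_mono) auto
    also have "\<dots> \<le> (\<Sum>i\<in>(UNIV :: 'r set). prob {\<omega>\<in>space M. ?e * a n < \<bar>X n \<omega> $ i\<bar>})"
      by (intro finite_measure_subadditive_finite) auto
    finally show ?thesis .
  qed
  then show "\<forall>\<^sub>F n in sequentially. prob {\<omega>\<in>space M. \<epsilon> * a n < norm (X n \<omega>)}
      \<le> (\<Sum>i\<in>(UNIV :: 'r set). prob {\<omega>\<in>space M. ?e * a n < \<bar>X n \<omega> $ i\<bar>})" by simp
qed simp


section \<open>The main theorem\<close>

context empirical_likelihood
begin

lemma theta_tilde_component:
  "theta_tilde n (m n) u \<psi> Z \<omega> $ i = weighted_mean n (\<lambda>z. \<psi> z $ i) \<omega>"
  by (simp add: theta_tilde_def weighted_mean_def Let_def)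

text \<open>The projection has mean 0 and is orthogonal to the residual, so the cross terms drop
  out. Besides identifying the limit variance, this shows that the difference of covariances is
  positive semidefinite.\<close>

lemma covariance_residual:
  fixes \<psi> \<phi> :: "'z \<Rightarrow> real^'r" and \<theta> :: "real^'r"
  assumes \<psi>: "\<And>i. sq_integrable Q (\<lambda>z. \<psi> z $ i)" and \<phi>: "\<And>i. in_L2_span Q u (\<lambda>z. \<phi> z $ i)"
    and orth: "\<And>i k. (\<integral>z. (\<psi> z $ i - \<phi> z $ i) * u k z \<partial>Q) = 0"
    and \<theta>: "\<And>i. (\<integral>z. \<psi> z $ i \<partial>Q) = \<theta> $ i"
  shows "(\<integral>z. (t \<bullet> (\<psi> z - \<phi> z - \<theta>))\<^sup>2 \<partial>Q) = t \<bullet> ((cov_mat Q \<psi> - cov_mat Q \<phi>) *v t)"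
proof -
  note \<phi>2 = in_L2_span_sq_integrable[OF \<phi>]
  have d: "sq_integrable Q (\<lambda>z. \<psi> z $ i - \<phi> z $ i)" for i by (intro sq_integrable_diff \<psi> \<phi>2)
  have d_mean: "(\<integral>z. \<psi> z $ i - \<phi> z $ i \<partial>Q) = \<theta> $ i" for i
    using sq_integrable_imp_integrable[OF Q.finite_measure_axioms] \<psi> \<phi>2 by (simp add: in_L2_span_mean[OF \<phi>] \<theta>)
  have d_int: "integrable Q (\<lambda>z. \<psi> z $ i - \<phi> z $ i)" for i
    by (rule sq_integrable_imp_integrable[OF Q.finite_measure_axioms d])
  have d_orth: "(\<integral>z. (\<psi> z $ i - \<phi> z $ i) * \<phi> z $ l \<partial>Q) = 0" for i l
    by (rule in_L2_span_orthogonal[OF d orth \<phi>])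
  define g where "g i z = \<psi> z $ i - \<phi> z $ i - \<theta> $ i" for i z
  have g: "sq_integrable Q (g i)" for i
    unfolding g_def by (intro sq_integrable_diff d sq_integrable_const Q.finite_measure_axioms)
  have gg: "(\<integral>z. g i z * g l z \<partial>Q) = (cov_mat Q \<psi> - cov_mat Q \<phi>) $ i $ l" for i l
  proof -
    have dd: "(\<integral>z. (\<psi> z $ i - \<phi> z $ i) * (\<psi> z $ l - \<phi> z $ l) \<partial>Q)
        = (\<integral>z. \<psi> z $ i * \<psi> z $ l \<partial>Q) - (\<integral>z. \<phi> z $ i * \<phi> z $ l \<partial>Q)"
    proof -
      have "(\<integral>z. \<psi> z $ l * \<phi> z $ i \<partial>Q) = (\<integral>z. \<phi> z $ l * \<phi> z $ i \<partial>Q)"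
        using d_orth[of l i] sq_integrable_mult[OF \<psi> \<phi>2] sq_integrable_mult[OF \<phi>2 \<phi>2] by (simp add: left_diff_distrib)
      also have "\<dots> = (\<integral>z. \<phi> z $ i * \<phi> z $ l \<partial>Q)" by (simp only: mult.commute)
      finally have "(\<integral>z. \<psi> z $ l * \<phi> z $ i \<partial>Q) = (\<integral>z. \<phi> z $ i * \<phi> z $ l \<partial>Q)" .
      moreover have "(\<psi> z $ i - \<phi> z $ i) * (\<psi> z $ l - \<phi> z $ l)
          = (\<psi> z $ i * \<psi> z $ l - \<psi> z $ l * \<phi> z $ i) - (\<psi> z $ i - \<phi> z $ i) * \<phi> z $ l" for z
        by (simp add: algebra_simps)
      ultimately show ?thesis
        using sq_integrable_mult[OF \<psi> \<psi>] sq_integrable_mult[OF \<psi> \<phi>2] sq_integrable_mult[OF d \<phi>2]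
        by (simp add: d_orth)
    qed
    have "g i z * g l z = (\<psi> z $ i - \<phi> z $ i) * (\<psi> z $ l - \<phi> z $ l) - \<theta> $ i * (\<psi> z $ l - \<phi> z $ l)
        - \<theta> $ l * (\<psi> z $ i - \<phi> z $ i) + \<theta> $ i * \<theta> $ l" for z
      by (simp add: g_def algebra_simps)
    then have "(\<integral>z. g i z * g l z \<partial>Q) = (\<integral>z. (\<psi> z $ i - \<phi> z $ i) * (\<psi> z $ l - \<phi> z $ l) \<partial>Q)
        - \<theta> $ i * \<theta> $ l - \<theta> $ l * \<theta> $ i + \<theta> $ i * \<theta> $ l"
      using sq_integrable_mult[OF d d] d_int by (simp add: d_mean Q.prob_space del: integral_diff)
    then show ?thesis by (simp add: dd cov_mat_def in_L2_span_mean[OF \<phi>] \<theta>)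
  qed
  have "t \<bullet> (\<psi> z - \<phi> z - \<theta>) = (\<Sum>i\<in>UNIV. t $ i * g i z)" for z
    by (simp add: inner_vec_def g_def)
  then have "(\<integral>z. (t \<bullet> (\<psi> z - \<phi> z - \<theta>))\<^sup>2 \<partial>Q) = (\<integral>z. (\<Sum>i\<in>UNIV. \<Sum>l\<in>UNIV. t $ i * (g i z * g l z) * t $ l) \<partial>Q)"
    by (simp add: power2_eq_square sum_product mult_ac)
  also have "\<dots> = (\<Sum>i\<in>UNIV. \<Sum>l\<in>UNIV. t $ i * (cov_mat Q \<psi> - cov_mat Q \<phi>) $ i $ l * t $ l)"
    using sq_integrable_mult[OF g g] by (simp add: gg)
  also have "\<dots> = t \<bullet> ((cov_mat Q \<psi> - cov_mat Q \<phi>) *v t)"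
    by (simp add: inner_vec_def matrix_vector_mult_def sum_distrib_left mult.assoc)
  finally show ?thesis .
qed

end

theorem theorem3:
  fixes M :: "'a measure" and Q :: "'z measure"
    and Z :: "nat \<Rightarrow> 'a \<Rightarrow> 'z"
    and \<psi> :: "'z \<Rightarrow> real^'r"
    and u :: "nat \<Rightarrow> 'z \<Rightarrow> real"
    and m :: "nat \<Rightarrow> nat"
    and \<phi>\<^sub>0 :: "'z \<Rightarrow> real^'r"
  assumes M: "prob_space M" and Qp: "prob_space Q"
    and iid_indep: "prob_space.indep_vars M (\<lambda>_. Q) Z UNIV"
    and iid_distr: "\<And>j. distr M Q (Z j) = Q"
    and psi_meas: "\<psi> \<in> borel_measurable Q"
    and psi_L2: "integrable Q (\<lambda>z. (norm (\<psi> z))\<^sup>2)"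
    and u_meas: "\<And>k. u k \<in> borel_measurable Q"
    and m_lim: "filterlim m at_top sequentially"
    and u_L2: "\<And>n. integrable Q (\<lambda>z. \<Sum>k<m n. (u k z)\<^sup>2)"
    and u_mean0: "\<And>n k. k < m n \<Longrightarrow> (\<integral>z. u k z \<partial>Q) = 0"
    and W_nonsing: "\<And>n. nonsingular_m (m n) (\<lambda>k l. \<integral>z. u k z * u l z \<partial>Q)"
    and W_reg: "regular_disp m (\<lambda>n k l. \<integral>z. u k z * u l z \<partial>Q)"
    and cond_i: "oP M (\<lambda>n \<omega>. Max ((\<lambda>j. vnorm (m n) u (Z j \<omega>)) ` {..<n}))
                   (\<lambda>n. real (m n) powr (-3/2) * sqrt (real n))"
    and cond_ii: "oP M (\<lambda>n \<omega>. mat_opnorm (m n)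
                   (\<lambda>k l. (1 / real n) * (\<Sum>j<n. u k (Z j \<omega>) * u l (Z j \<omega>))
                          - (\<integral>z. u k z * u l z \<partial>Q)))
                   (\<lambda>n. real (m n) powr (-1))"
    and cond_iii: "oP M (\<lambda>n \<omega>. sqrt (\<Sum>i\<in>UNIV. \<Sum>k<m n.
                   ((1 / real n) * (\<Sum>j<n. \<psi> (Z j \<omega>) $ i * u k (Z j \<omega>)
                       - (\<integral>z. \<psi> z $ i * u k z \<partial>Q)))\<^sup>2))
                   (\<lambda>n. real (m n) powr (-1/2))"
    and proj: "L2_proj Q u \<psi> \<phi>\<^sub>0"
  shows "(\<exists>A. (\<forall>n. A n \<in> sets M \<and> A n \<subseteq> {\<omega> \<in> space M. \<exists>!\<zeta>. zeta_eq n (m n) u Z \<omega> \<zeta>})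
             \<and> (\<lambda>n. measure M (A n)) \<longlonglongrightarrow> 1)
       \<and> oP M (\<lambda>n \<omega>. theta_tilde n (m n) u \<psi> Z \<omega>
                  - ((1 / real n) *\<^sub>R (\<Sum>j<n. \<psi> (Z j \<omega>))
                     - (1 / real n) *\<^sub>R (\<Sum>j<n. \<phi>\<^sub>0 (Z j \<omega>))))
              (\<lambda>n. real n powr (-1/2))
       \<and> (invertible (cov_mat Q \<psi> - cov_mat Q \<phi>\<^sub>0) \<longrightarrow>
            (\<exists>N. mvnormal (cov_mat Q \<psi> - cov_mat Q \<phi>\<^sub>0) N \<and>
                 conv_distr M (\<lambda>n \<omega>. sqrt (real n) *\<^sub>R
                     (theta_tilde n (m n) u \<psi> Z \<omega> - (\<integral>z. \<psi> z \<partial>Q))) N))"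
proof -
  interpret S: iid_sample M Q Z
    by (intro iid_sample.intro M Qp iid_indep iid_distr)
  obtain c C where c: "0 < c" and W1: "\<And>n a. (\<Sum>k<m n. (a k)\<^sup>2) = 1 \<Longrightarrow>
       c \<le> (\<Sum>i<m n. \<Sum>k<m n. a i * (\<integral>z. u i z * u k z \<partial>Q) * a k) \<and>
       (\<Sum>i<m n. \<Sum>k<m n. a i * (\<integral>z. u i z * u k z \<partial>Q) * a k) \<le> C"
    using W_reg unfolding regular_disp_def by blast
  \<comment> \<open>Regularity is given on unit vectors; dividing \<open>a\<close> by its norm
    \<open>sqrt r\<close> extends it to all vectors.\<close>
  have W: "c * (\<Sum>k<m n. (a k)\<^sup>2) \<le> (\<Sum>i<m n. \<Sum>k<m n. a i * (\<integral>z. u i z * u k z \<partial>Q) * a k) \<and>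
       (\<Sum>i<m n. \<Sum>k<m n. a i * (\<integral>z. u i z * u k z \<partial>Q) * a k) \<le> C * (\<Sum>k<m n. (a k)\<^sup>2)" for n a
  proof (cases "(\<Sum>k<m n. (a k)\<^sup>2) = 0")
    case True
    then have "\<forall>k<m n. a k = 0" by (simp add: sum_nonneg_eq_0_iff)
    then show ?thesis by simp
  next
    case False
    define r where "r = (\<Sum>k<m n. (a k)\<^sup>2)"
    have r: "0 < r" using False by (simp add: r_def less_le sum_nonneg)
    have "(\<Sum>k<m n. (a k / sqrt r)\<^sup>2) = r / r"
      using r by (simp add: power_divide sum_divide_distrib[symmetric] r_def)
    then have "(\<Sum>k<m n. (a k / sqrt r)\<^sup>2) = 1" using r by simp
    from W1[OF this] have "c \<le> (\<Sum>i<m n. \<Sum>k<m n. a i * (\<integral>z. u i z * u k z \<partial>Q) * a k) / r \<and>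
        (\<Sum>i<m n. \<Sum>k<m n. a i * (\<integral>z. u i z * u k z \<partial>Q) * a k) / r \<le> C"
      using r by (simp add: sum_divide_distrib)
    then show ?thesis using r unfolding r_def[symmetric] by (simp add: pos_le_divide_eq pos_divide_le_eq)
  qed
  interpret empirical_likelihood M Q Z u m c C
    by unfold_locales (use u_meas m_lim u_L2 u_mean0 c W cond_i cond_ii in auto)
  let ?\<theta> = "\<integral>z. \<psi> z \<partial>Q"
  let ?\<Sigma> = "cov_mat Q \<psi> - cov_mat Q \<phi>\<^sub>0"
  let ?err = "\<lambda>n \<omega>. theta_tilde n (m n) u \<psi> Z \<omega>
    - ((1 / real n) *\<^sub>R (\<Sum>j<n. \<psi> (Z j \<omega>)) - (1 / real n) *\<^sub>R (\<Sum>j<n. \<phi>\<^sub>0 (Z j \<omega>)))"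
  have psi_comp [measurable]: "(\<lambda>z. \<psi> z $ i) \<in> borel_measurable Q" for i
    using measurable_compose[OF psi_meas borel_measurable_continuous_onI[of "\<lambda>x. x $ i"]]
    by (simp add: continuous_on_component)
  have \<psi>: "sq_integrable Q (\<lambda>z. \<psi> z $ i)" for i
    unfolding sq_integrable_def
  proof
    show "integrable Q (\<lambda>z. (\<psi> z $ i)\<^sup>2)"
    proof (rule Bochner_Integration.integrable_bound[OF psi_L2])
      have "(\<psi> z $ i)\<^sup>2 \<le> (norm (\<psi> z))\<^sup>2" for z
        using component_le_norm_cart[of "\<psi> z" i] by (simp add: abs_le_square_iff[symmetric])
      then show "AE z in Q. norm ((\<psi> z $ i)\<^sup>2) \<le> norm ((norm (\<psi> z))\<^sup>2)" by simp
    qed measurable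
  qed measurable
  have \<phi>: "in_L2_span Q u (\<lambda>z. \<phi>\<^sub>0 z $ i)"
    and orth: "(\<integral>z. (\<psi> z $ i - \<phi>\<^sub>0 z $ i) * u k z \<partial>Q) = 0" for i k
    using proj unfolding L2_proj_def by blast+
  note \<phi>2 = in_L2_span_sq_integrable[OF \<phi>]
  have phi_meas: "\<phi>\<^sub>0 \<in> borel_measurable Q"
    by (rule borel_measurable_euclidean_space[THEN iffD2])
      (auto simp: Basis_vec_def inner_axis sq_integrable_measurable[OF \<phi>2])
  have psi_int: "integrable Q \<psi>"
  proof -
    have "integrable Q (\<lambda>z. norm (\<psi> z))"
      by (rule S.Q.square_integrable_imp_integrable[OF measurable_compose[OF psi_meas borel_measurable_norm] psi_L2])
    then show ?thesis by (rule integrable_norm_cancel) (rule psi_meas)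
  qed
  have \<theta>: "(\<integral>z. \<psi> z $ i \<partial>Q) = ?\<theta> $ i" for i
    by (rule integral_bounded_linear[OF bounded_linear_vec_nth psi_int])
  \<comment> \<open>One row of the matrix in (iii) has norm at most that of the whole
    matrix.\<close>
  have p_cov: "oP M (\<lambda>n \<omega>. L2_set (\<lambda>k. (1 / real n) * (\<Sum>j<n. \<psi> (Z j \<omega>) $ i * u k (Z j \<omega>)
        - (\<integral>z. \<psi> z $ i * u k z \<partial>Q))) {..<m n}) (\<lambda>n. real (m n) powr (-1/2))" for i
  proof (rule oP_mono[OF cond_iii])
    fix n \<omega>
    let ?s = "\<lambda>i. \<Sum>k<m n. ((1 / real n) * (\<Sum>j<n. \<psi> (Z j \<omega>) $ i * u k (Z j \<omega>) - (\<integral>z. \<psi> z $ i * u k z \<partial>Q)))\<^sup>2"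
    have "?s i \<le> (\<Sum>i\<in>UNIV. ?s i)" by (intro member_le_sum) (auto intro: sum_nonneg)
    then have "sqrt (?s i) \<le> sqrt (\<Sum>i\<in>UNIV. ?s i)" by (rule real_sqrt_le_mono)
    moreover have "0 \<le> sqrt (?s i)" by (simp add: sum_nonneg)
    ultimately show "norm (L2_set (\<lambda>k. (1 / real n) * (\<Sum>j<n. \<psi> (Z j \<omega>) $ i * u k (Z j \<omega>)
        - (\<integral>z. \<psi> z $ i * u k z \<partial>Q))) {..<m n}) \<le> norm (sqrt (\<Sum>i\<in>UNIV. ?s i))"
      unfolding L2_set_def real_norm_def by linarith
  qed
  have [measurable]: "theta_tilde n (m n) u \<psi> Z \<in> borel_measurable M" for n
    by (intro measurable_theta_tilde S.compose_measurable[OF u_meas] measurable_compose[OF S.Z_measurable psi_meas])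
  have [measurable]: "(\<lambda>\<omega>. \<psi> (Z j \<omega>)) \<in> borel_measurable M" "(\<lambda>\<omega>. \<phi>\<^sub>0 (Z j \<omega>)) \<in> borel_measurable M" for j
    by (rule measurable_compose[OF S.Z_measurable psi_meas] measurable_compose[OF S.Z_measurable phi_meas])+
  have err_meas [measurable]: "?err n \<in> borel_measurable M" for n by measurable
  have root_n: "real n powr (-1/2) = 1 / sqrt (real n)" for n
    by (rule powr_minus_half) simp
  have err: "(\<lambda>n. measure M {\<omega>\<in>space M. \<epsilon> * real n powr (-1/2) < norm (?err n \<omega>)}) \<longlonglongrightarrow> 0" if "0 < \<epsilon>" for \<epsilon>
  proof (rule prob_norm_tendsto_0_if_components[OF M err_meas _ _ that])
    fix i and \<epsilon> :: real assume "0 < \<epsilon>"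
    from weighted_mean_approx[OF \<psi> \<phi> orth p_cov this, of i]
    show "(\<lambda>n. measure M {\<omega>\<in>space M. \<epsilon> * real n powr (-1/2) < \<bar>?err n \<omega> $ i\<bar>}) \<longlonglongrightarrow> 0"
      unfolding root_n by (simp add: theta_tilde_component)
  qed simp
  have part1: "\<exists>A. (\<forall>n. A n \<in> sets M \<and> A n \<subseteq> {\<omega> \<in> space M. \<exists>!\<zeta>. zeta_eq n (m n) u Z \<omega> \<zeta>})
             \<and> (\<lambda>n. measure M (A n)) \<longlonglongrightarrow> 1"
    by (intro exI[of _ "\<lambda>n. {\<omega> \<in> space M. \<exists>!\<zeta>. zeta_eq n (m n) u Z \<omega> \<zeta>}"] conjI allI sets_ex1 order_refl prob_ex1)
  have part2: "oP M ?err (\<lambda>n. real n powr (-1/2))"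
    unfolding oP_def
  proof (intro allI impI exI conjI)
    fix \<epsilon> :: real and n assume "0 < \<epsilon>"
    \<comment> \<open>The deviation events are themselves measurable and serve as their own
      covers.\<close>
    show "{\<omega> \<in> space M. \<epsilon> * real n powr (-1/2) < norm (?err n \<omega>)} \<in> sets M" by measurable
    show "(\<lambda>n. measure M {\<omega> \<in> space M. \<epsilon> * real n powr (-1/2) < norm (?err n \<omega>)}) \<longlonglongrightarrow> 0"
      by (rule err) fact
  qed (rule order_refl)
  \<comment> \<open>\<open>G\<close> is the centred residual. Its normalized sum \<open>Y n\<close>
    carries the limit law, and for \<open>0 < n\<close> the gap to \<open>X n\<close> is exactly
    \<open>sqrt n\<close> times the remainder already shown to be small.\<close>
  define G where "G z = \<psi> z - \<phi>\<^sub>0 z - ?\<theta>" for z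
  define X where "X n \<omega> = sqrt (real n) *\<^sub>R (theta_tilde n (m n) u \<psi> Z \<omega> - ?\<theta>)" for n \<omega>
  define Y where "Y n \<omega> = (1 / sqrt (real n)) *\<^sub>R (\<Sum>j<n. G (Z j \<omega>))" for n \<omega>
  have quad: "(\<integral>z. (t \<bullet> G z)\<^sup>2 \<partial>Q) = t \<bullet> (?\<Sigma> *v t)" for t
    unfolding G_def by (rule covariance_residual[OF \<psi> \<phi> orth \<theta>])
  \<comment> \<open>The form is a second moment, hence nonnegative; this is what the existence of
    the normal law rests on.\<close>
  have psd: "0 \<le> t \<bullet> (?\<Sigma> *v t)" for t unfolding quad[symmetric] by simp
  have "\<exists>N. mvnormal ?\<Sigma> N"
    by (rule mvnormal_exists[OF _ psd]) (simp add: cov_mat_def mult.commute)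
  then obtain N where N: "mvnormal ?\<Sigma> N" by blast
  have G_comp: "sq_integrable Q (\<lambda>z. G z $ i)" "(\<integral>z. G z $ i \<partial>Q) = 0" for i
  proof -
    show "sq_integrable Q (\<lambda>z. G z $ i)"
      unfolding G_def vector_minus_component
      by (intro sq_integrable_diff \<psi> \<phi>2 sq_integrable_const S.Q.finite_measure_axioms)
    show "(\<integral>z. G z $ i \<partial>Q) = 0"
      using sq_integrable_imp_integrable[OF S.Q.finite_measure_axioms] \<psi> \<phi>2
      by (simp add: G_def in_L2_span_mean[OF \<phi>] \<theta> S.Q.prob_space)
  qed
  have G_inner: "sq_integrable Q (\<lambda>z. t \<bullet> G z)" "(\<integral>z. t \<bullet> G z \<partial>Q) = 0" for t
  proof -
    have eq: "t \<bullet> G z = (\<Sum>i\<in>UNIV. G z $ i * t $ i)" for z by (simp add: inner_vec_def mult.commute)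
    show "sq_integrable Q (\<lambda>z. t \<bullet> G z)"
      unfolding eq by (intro sq_integrable_sum sq_integrable_cmult G_comp) simp
    show "(\<integral>z. t \<bullet> G z \<partial>Q) = 0"
      unfolding eq using sq_integrable_imp_integrable[OF S.Q.finite_measure_axioms G_comp(1)]
      by (simp add: G_comp(2))
  qed
  have [measurable]: "(\<lambda>\<omega>. G (Z j \<omega>)) \<in> borel_measurable M" for j
    unfolding G_def by measurable
  have X_meas [measurable]: "X n \<in> borel_measurable M" for n unfolding X_def by measurable
  have Y_meas [measurable]: "Y n \<in> borel_measurable M" for n unfolding Y_def by measurable
  have tY: "t \<bullet> Y n \<omega> = (\<Sum>j<n. t \<bullet> G (Z j \<omega>)) / sqrt (real n)" for t n \<omega>
    by (simp add: Y_def inner_sum_right)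
  have XY: "X n \<omega> - Y n \<omega> = sqrt (real n) *\<^sub>R ?err n \<omega>" if n: "0 < n" for n \<omega>
  proof -
    have "Y n \<omega> = sqrt (real n) *\<^sub>R ((1 / real n) *\<^sub>R (\<Sum>j<n. G (Z j \<omega>)))"
      using n by (simp add: Y_def real_sqrt_divide field_simps)
    also have "(1 / real n) *\<^sub>R (\<Sum>j<n. G (Z j \<omega>))
        = (1 / real n) *\<^sub>R (\<Sum>j<n. \<psi> (Z j \<omega>)) - (1 / real n) *\<^sub>R (\<Sum>j<n. \<phi>\<^sub>0 (Z j \<omega>)) - ?\<theta>"
      using n by (simp add: G_def sum_subtractf scaleR_diff_right sum_constant_scaleR del: sum_constant)
    finally show ?thesis by (simp add: X_def scaleR_diff_right)
  qed
  have close: "(\<lambda>n. measure M {\<omega>\<in>space M. \<epsilon> < norm (X n \<omega> - Y n \<omega>)}) \<longlonglongrightarrow> 0" if "0 < \<epsilon>" for \<epsilon>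
  proof (rule Lim_transform_eventually[OF err[OF that]])
    show "\<forall>\<^sub>F n in sequentially. measure M {\<omega>\<in>space M. \<epsilon> * real n powr (-1/2) < norm (?err n \<omega>)}
        = measure M {\<omega>\<in>space M. \<epsilon> < norm (X n \<omega> - Y n \<omega>)}"
      using eventually_gt_at_top[of 0]
    proof eventually_elim
      case (elim n)
      have "\<epsilon> * real n powr (-1/2) < x \<longleftrightarrow> \<epsilon> < sqrt (real n) * x" for x
        unfolding root_n using elim by (simp add: pos_divide_less_eq mult.commute)
      then show ?case by (simp add: XY[OF elim])
    qed
  qed
  have "conv_distr M X N"
    unfolding conv_distr_def
  proof (intro allI impI, elim conjE)
    fix f :: "real^'r \<Rightarrow> real" assume f: "continuous_on UNIV f" "bounded (range f)"
    show "(\<lambda>n. \<integral>\<omega>. f (X n \<omega>) \<partial>M) \<longlonglongrightarrow> (\<integral>x. f x \<partial>N)"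
    proof (rule weak_limit_if_trig_limits_perturbed[OF M _ _ X_meas Y_meas close _ _ _ f])
      show "prob_space N" "sets N = sets borel" using N by (auto simp: mvnormal_def)
      show "\<exists>R. \<forall>\<^sub>F n in sequentially. measure M {\<omega>\<in>space M. R < norm (Y n \<omega>)} \<le> \<eta>" if "0 < \<eta>" for \<eta>
        unfolding Y_def by (rule S.normalized_sum_tight[OF G_comp that])
      show "(\<lambda>n. \<integral>\<omega>. cos (t \<bullet> Y n \<omega>) \<partial>M) \<longlonglongrightarrow> (\<integral>x. cos (t \<bullet> x) \<partial>N)" for t
        unfolding tY mvnormal_trig_integrals(1)[OF N psd] quad[symmetric]
        by (rule S.sum_trig_limits(1)[OF G_inner])
      show "(\<lambda>n. \<integral>\<omega>. sin (t \<bullet> Y n \<omega>) \<partial>M) \<longlonglongrightarrow> (\<integral>x. sin (t \<bullet> x) \<partial>N)" for t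
        unfolding tY mvnormal_trig_integrals(2)[OF N psd]
        by (rule S.sum_trig_limits(2)[OF G_inner])
    qed
  qed
  then have part3: "\<exists>N. mvnormal ?\<Sigma> N \<and> conv_distr M (\<lambda>n \<omega>. sqrt (real n) *\<^sub>R
      (theta_tilde n (m n) u \<psi> Z \<omega> - ?\<theta>)) N"
    using N unfolding X_def by blast
  show ?thesis using part1 part2 part3 by blast
qed

end
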